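(* Let $(A,B)$ be a regular inclusion of C*-algebras with $A$ abelian, let $X$ be the spectrum of $A$ and $F\subseteq X$ the set of free points. Let $\Delta$ be the opaque ideal and $\Gamma$ the gray ideal of $(A,B)$. Then: (i) $\Delta$ has trivial intersection with $A$. (ii) $\Gamma\cap A$ consists of all elements of $A$ vanishing on $F$ (and hence also on $\overline F$). (iii) If $F$ is dense in $X$, then $\Gamma$ is the largest ideal of $B$ whose intersection with $A$ is trivial.
   Context: Ideals are closed and two-sided. An inclusion $(A,B)$ is a C*-algebra $B$ with a closed $*$-subalgebra $A$ (no units assumed). A normalizer is $n\in B$ with $nAn^*\subseteq A$, $n^*An\subseteq A$. $(A,B)$ is regular if $A$ contains an approximate unit for $B$ and the normalizers have dense linear span in $B$. For $x\in X$, $\varphi_x$ is the evaluation state $a\mapsto\langle a,x\rangle$ of $A$ and $J_x=\ker\varphi_x$. The point $x$ is free if $\varphi_x$ has a unique extension to a state of $B$. Products and sums of subspaces denote closed linear spans. Put $C_x=\{c\in B:cJ_x\subseteq J_xB,\ J_xc\subseteq BJ_x\}$, a C*-algebra with closed ideal $H_x=J_xC_x=C_xJ_x=J_xBJ_x$; $L_x=J_xB+BJ_x$; $B(x)=C_x/H_x$. The map $B(x)\to B/L_x$ induced by $C_x\subseteq B$ is an isometric linear bijection, and the localizing projection $E_x:B\to B(x)$ is the composition of the quotient map $B\to B/L_x$ with its inverse (so $E_x(b)=0$ iff $b\in L_x$). The opaque ideal is $\Delta=\{b\in B:E_x(b^*b)=0\ \forall x\in X\}$ and the gray ideal is $\Gamma=\{b\in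 B:E_x(b^*b)=0\ \forall x\in F\}$; both are closed two-sided ideals of $B$. *)

theory Defs
  imports "HOL-Analysis.Analysis" "HOL-Library.Nonpos_Ints"
begin

section \<open>C*-algebras\<close>

text \<open>No unit is assumed, and the zero algebra is allowed. The class already carries a real
  scalar multiplication; the axiom \<open>scaleC_of_real\<close> makes the complex one extend it.\<close>

class cstar_algebra = real_normed_algebra + banach +
  fixes scaleC :: "complex \<Rightarrow> 'a \<Rightarrow> 'a" (infixr \<open>*\<^sub>C\<close> 75)
    and star :: "'a \<Rightarrow> 'a" (\<open>_\<^sup>\<star>\<close> [1000] 999)
  assumes scaleC_add_right: "c *\<^sub>C (x + y) = c *\<^sub>C x + c *\<^sub>C y"
    and scaleC_add_left: "(c + d) *\<^sub>C x = c *\<^sub>C x + d *\<^sub>C x"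
    and scaleC_scaleC: "c *\<^sub>C d *\<^sub>C x = (c * d) *\<^sub>C x"
    and scaleC_of_real: "complex_of_real r *\<^sub>C x = r *\<^sub>R x"
    and norm_scaleC: "norm (c *\<^sub>C x) = cmod c * norm x"
    and mult_scaleC_left: "(c *\<^sub>C x) * y = c *\<^sub>C (x * y)"
    and mult_scaleC_right: "x * (c *\<^sub>C y) = c *\<^sub>C (x * y)"
    and star_star: "(x\<^sup>\<star>)\<^sup>\<star> = x"
    and star_add: "(x + y)\<^sup>\<star> = x\<^sup>\<star> + y\<^sup>\<star>"
    and star_scaleC: "(c *\<^sub>C x)\<^sup>\<star> = cnj c *\<^sub>C x\<^sup>\<star>"
    and star_mult: "(x * y)\<^sup>\<star> = y\<^sup>\<star> * x\<^sup>\<star>"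
    and cstar_identity: "norm (x\<^sup>\<star> * x) = (norm x)\<^sup>2"

interpretation complex_vector: vector_space "scaleC :: complex \<Rightarrow> 'b \<Rightarrow> 'b::cstar_algebra"
proof
  show "1 *\<^sub>C x = x" for x :: 'b
    using scaleC_of_real[of 1 x] by simp
qed (simp_all add: scaleC_add_right scaleC_add_left scaleC_scaleC)

definition closed_span :: "'b::cstar_algebra set \<Rightarrow> 'b set" where
  "closed_span S = closure (complex_vector.span S)"

definition closed_prod :: "'b::cstar_algebra set \<Rightarrow> 'b set \<Rightarrow> 'b set" (infixl \<open>\<odot>\<close> 70) where
  "S \<odot> T = closed_span {s * t | s t. s \<in> S \<and> t \<in> T}"

definition closed_sum :: "'b::cstar_algebra set \<Rightarrow> 'b set \<Rightarrow> 'b set" (infixl \<open>\<oplus>\<close> 65) where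
  "S \<oplus> T = closed_span (S \<union> T)"

definition closed_star_subalgebra :: "'b::cstar_algebra set \<Rightarrow> bool" where
  "closed_star_subalgebra A \<longleftrightarrow>
     complex_vector.subspace A \<and> closed A \<and>
     (\<forall>a\<in>A. \<forall>b\<in>A. a * b \<in> A) \<and> (\<forall>a\<in>A. a\<^sup>\<star> \<in> A)"

definition closed_ideal :: "'b::cstar_algebra set \<Rightarrow> bool" where
  "closed_ideal I \<longleftrightarrow>
     complex_vector.subspace I \<and> closed I \<and> (\<forall>i\<in>I. \<forall>b. b * i \<in> I \<and> i * b \<in> I)"

definition is_state :: "('b::cstar_algebra \<Rightarrow> complex) \<Rightarrow> bool" where
  "is_state f \<longleftrightarrow>
     bounded_linear f \<and> (\<forall>c b. f (c *\<^sub>C b) = c * f b) \<and>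
     (\<forall>b. f (b\<^sup>\<star> * b) \<in> \<real>\<^sub>\<ge>\<^sub>0) \<and> onorm f = 1"


section \<open>Regular inclusions\<close>

text \<open>The ambient algebra \<open>B\<close> is the whole type \<open>'b\<close>, so an inclusion is given by the set \<open>A\<close>.\<close>

definition normalizers :: "'b::cstar_algebra set \<Rightarrow> 'b set" where
  "normalizers A = {n. \<forall>a\<in>A. n * a * n\<^sup>\<star> \<in> A \<and> n\<^sup>\<star> * a * n \<in> A}"

text \<open>The net of an approximate unit is represented by the filter it generates. Its
  members are positive contractions of \<open>A\<close>; the net is not required to be increasing.\<close>

definition contains_approximate_unit :: "'b::cstar_algebra set \<Rightarrow> bool" where
  "contains_approximate_unit A \<longleftrightarrow>
     (\<exists>U :: 'b filter. U \<noteq> bot \<and>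
        (\<forall>\<^sub>F u in U. u \<in> A \<and> (\<exists>c. u = c\<^sup>\<star> * c) \<and> norm u \<le> 1) \<and>
        (\<forall>b. ((\<lambda>u. u * b) \<longlongrightarrow> b) U \<and> ((\<lambda>u. b * u) \<longlongrightarrow> b) U))"

definition regular_inclusion :: "'b::cstar_algebra set \<Rightarrow> bool" where
  "regular_inclusion A \<longleftrightarrow>
     closed_star_subalgebra A \<and> contains_approximate_unit A \<and>
     closed_span (normalizers A) = UNIV"


section \<open>The spectrum and the free points\<close>

text \<open>A point of the spectrum \<open>X\<close> of \<open>A\<close> is a character \<open>x\<close> of \<open>A\<close>, so the pairing
  \<open>\<langle>a, x\<rangle>\<close> is \<open>x a\<close> and the evaluation state at \<open>x\<close> is \<open>x\<close> itself. Characters are taken to be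
  extensional, so that they are determined by their values on \<open>A\<close> and so that the topology
  of pointwise convergence on \<open>A\<close> is the one induced from the product topology.\<close>

definition spectrum :: "'b::cstar_algebra set \<Rightarrow> ('b \<Rightarrow> complex) set" where
  "spectrum A = {x \<in> extensional A.
     (\<forall>a\<in>A. \<forall>b\<in>A. x (a + b) = x a + x b) \<and>
     (\<forall>c. \<forall>a\<in>A. x (c *\<^sub>C a) = c * x a) \<and>
     (\<forall>a\<in>A. \<forall>b\<in>A. x (a * b) = x a * x b) \<and>
     (\<exists>a\<in>A. x a \<noteq> 0)}"

definition spectrum_topology :: "'b::cstar_algebra set \<Rightarrow> ('b \<Rightarrow> complex) topology" where
  "spectrum_topology A = subtopology (product_topology (\<lambda>_. euclidean) A) (spectrum A)"

definition free_points :: "'b::cstar_algebra set \<Rightarrow> ('b \<Rightarrow> complex) set" where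
  "free_points A = {x \<in> spectrum A. \<exists>!f. is_state f \<and> (\<forall>a\<in>A. f a = x a)}"


section \<open>Localization at a point\<close>

text \<open>In the order of definition: \<open>J\<^sub>x\<close>, \<open>C\<^sub>x\<close>, \<open>H\<^sub>x = J\<^sub>x C\<^sub>x\<close> and \<open>L\<^sub>x = J\<^sub>x B + B J\<^sub>x\<close>.\<close>

definition kernel_ideal :: "'b::cstar_algebra set \<Rightarrow> ('b \<Rightarrow> complex) \<Rightarrow> 'b set" where
  "kernel_ideal A x = {a \<in> A. x a = 0}"

definition localizing_algebra :: "'b::cstar_algebra set \<Rightarrow> ('b \<Rightarrow> complex) \<Rightarrow> 'b set" where
  "localizing_algebra A x =
     {c. (\<forall>j \<in> kernel_ideal A x. c * j \<in> kernel_ideal A x \<odot> UNIV) \<and>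
         (\<forall>j \<in> kernel_ideal A x. j * c \<in> UNIV \<odot> kernel_ideal A x)}"

definition localizing_ideal :: "'b::cstar_algebra set \<Rightarrow> ('b \<Rightarrow> complex) \<Rightarrow> 'b set" where
  "localizing_ideal A x = kernel_ideal A x \<odot> localizing_algebra A x"

definition kernel_sum :: "'b::cstar_algebra set \<Rightarrow> ('b \<Rightarrow> complex) \<Rightarrow> 'b set" where
  "kernel_sum A x = (kernel_ideal A x \<odot> UNIV) \<oplus> (UNIV \<odot> kernel_ideal A x)"

definition coset :: "'b::cstar_algebra \<Rightarrow> 'b set \<Rightarrow> 'b set" where
  "coset b S = {b + s | s. s \<in> S}"

text \<open>The quotients \<open>B(x) = C\<^sub>x / H\<^sub>x\<close> and \<open>B / L\<^sub>x\<close> are sets of cosets.\<close>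

definition localized_algebra :: "'b::cstar_algebra set \<Rightarrow> ('b \<Rightarrow> complex) \<Rightarrow> 'b set set" where
  "localized_algebra A x = (\<lambda>c. coset c (localizing_ideal A x)) ` localizing_algebra A x"

text \<open>The map \<open>B(x) \<rightarrow> B / L\<^sub>x\<close> induced by the inclusion of \<open>C\<^sub>x\<close> in \<open>B\<close>: since \<open>H\<^sub>x \<subseteq> L\<^sub>x\<close>, the
  union below is the single coset \<open>c + L\<^sub>x\<close> when \<open>K = c + H\<^sub>x\<close>.\<close>

definition localized_to_quotient ::
    "'b::cstar_algebra set \<Rightarrow> ('b \<Rightarrow> complex) \<Rightarrow> 'b set \<Rightarrow> 'b set" where
  "localized_to_quotient A x K = (\<Union>k\<in>K. coset k (kernel_sum A x))"

definition localizing_projection ::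
    "'b::cstar_algebra set \<Rightarrow> ('b \<Rightarrow> complex) \<Rightarrow> 'b \<Rightarrow> 'b set" where
  "localizing_projection A x b =
     the_inv_into (localized_algebra A x) (localized_to_quotient A x) (coset b (kernel_sum A x))"

text \<open>\<open>E\<^sub>x(b) = 0\<close> is expressed as \<open>E\<^sub>x(b) = H\<^sub>x\<close>, the zero coset.\<close>

definition opaque_ideal :: "'b::cstar_algebra set \<Rightarrow> 'b set" where
  "opaque_ideal A = {b. \<forall>x \<in> spectrum A. localizing_projection A x (b\<^sup>\<star> * b) = localizing_ideal A x}"

definition gray_ideal :: "'b::cstar_algebra set \<Rightarrow> 'b set" where
  "gray_ideal A = {b. \<forall>x \<in> free_points A. localizing_projection A x (b\<^sup>\<star> * b) = localizing_ideal A x}"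

end

theory Submission
  imports Defs
begin

text \<open>Let \<open>J\<close> be the kernel of the character \<open>x\<close> and \<open>L\<close> the closed sum of \<open>J B\<close> and \<open>B J\<close>. Call
  \<open>v\<close> in \<open>A\<close> a peak at \<open>x\<close> if it is a self-adjoint contraction with \<open>x v = 1\<close>. Modulo \<open>L\<close> a peak
  acts as a unit, and the infimum of the norms of the compressions \<open>v b v\<close> by peaks is the norm of
  \<open>b\<close> in \<open>B / L\<close>; in particular it vanishes iff \<open>b\<close> is in \<open>L\<close> (\<open>kernel_sum_iff\<close>).
  Compressions also show \<open>C \<inter> L \<subseteq> H\<close>
  (\<open>localizing_algebra_inter_kernel_sum\<close>), so for an element \<open>b\<close> congruent modulo \<open>L\<close> to an
  element of \<open>C\<close>, the projection of \<open>b\<close> is zero iff \<open>b\<close> is in \<open>L\<close>.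

  For \<open>a\<close> in \<open>A\<close> the norm of \<open>a\<close> modulo \<open>L\<close> is at least \<open>cmod (x a)\<close>. So an element of \<open>A\<close> in the opaque
  ideal vanishes at every character, and characters separate the points of \<open>A\<close>; this is the first
  assertion.

  Let \<open>x\<close> be free with unique state \<open>f\<close>. By the Hahn-Banach theorem, the derivative of the norm of
  \<open>B / L\<close> at the class of a peak \<open>e\<close>, in the direction \<open>c\<close>, is the value at \<open>c\<close> of the real part of
  some state extending \<open>x\<close>, hence it is \<open>Re (f c)\<close> (\<open>unique_state_is_derivative\<close>). This has
  two consequences. If \<open>c\<close> is self-adjoint and
  \<open>f c = 0\<close>, both one-sided derivatives vanish and positivity in \<open>B\<close> forces the class of \<open>c\<close> to be
  zero (\<open>unique_state_kernel\<close>); so \<open>b\<close> is in the gray ideal iff \<open>f (b\<^sup>\<star> b) = 0\<close> for all free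
  points, which gives the second assertion. And if \<open>b\<close> lies in a closed ideal meeting \<open>A\<close>
  trivially, then \<open>f (b\<^sup>\<star> b) = 0\<close>, because the quotient map by the ideal is isometric on \<open>A\<close>
  (\<open>isometric_on_quotient\<close>, \<open>unique_state_null_on_ideal\<close>); this is the maximality of the
  gray ideal.

  The elements \<open>b\<close> with \<open>f (b\<^sup>\<star> b) = 0\<close> form a closed left ideal for every state \<open>f\<close>. That the gray ideal is also a right ideal is where
  normalizers enter: if \<open>x\<close> is free with state \<open>f\<close> and \<open>n\<close> is a normalizer with \<open>f (n\<^sup>\<star> n) \<noteq> 0\<close>,
  then \<open>f (n\<^sup>\<star> _ n)\<close> is a multiple of the state of another free point
  (\<open>free_state_translate\<close>).

  The ingredients from the general theory of C*-algebras are built first: characters of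
  commutative algebras from minimal C*-seminorms, functional calculus, and Kaplansky's theorem that
  \<open>b\<^sup>\<star> b\<close> is positive, which makes norm-one extensions of characters into states.\<close>

section \<open>Linear structure and real inequalities\<close>

lemma le_mult_if_approx:
  fixes k p r :: real
  assumes k: "0 \<le> k" and approx: "\<And>e. 0 < e \<Longrightarrow> \<exists>s. s < p + e \<and> r \<le> k * s"
  shows "r \<le> k * p"
proof (rule field_le_epsilon)
  fix e :: real assume e: "0 < e"
  then obtain s where s: "s < p + e / (k + 1)" "r \<le> k * s" using approx[of "e / (k + 1)"] k by auto
  have "r \<le> k * (p + e / (k + 1))"
    by (rule order_trans[OF s(2)]) (use s(1) k in \<open>intro mult_left_mono, auto\<close>)
  also have "\<dots> = k * p + e * (k / (k + 1))" by (simp add: algebra_simps)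
  also have "\<dots> \<le> k * p + e * 1" using e k by (intro add_left_mono mult_left_mono) auto
  finally show "r \<le> k * p + e" by simp
qed

lemma le_mult_if_le_mult_add:
  fixes a b r :: real
  assumes "\<And>e. 0 < e \<Longrightarrow> r \<le> (a + e) * (b + e)" shows "r \<le> a * b"
proof -
  have ev: "\<forall>\<^sub>F e in at_right 0. r \<le> (a + e) * (b + e)"
    by (rule eventually_mono[OF eventually_at_right_less]) (rule assms)
  have "((\<lambda>e. (a + e) * (b + e)) \<longlongrightarrow> (a + 0) * (b + 0)) (at_right 0)" by (intro tendsto_intros)
  from tendsto_lowerbound[OF this ev trivial_limit_at_right_real] show ?thesis by simp
qed

lemma scaleC_scaleR: "c *\<^sub>C (r *\<^sub>R x) = r *\<^sub>R (c *\<^sub>C (x::'b::cstar_algebra))"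
  by (simp flip: scaleC_of_real add: scaleC_scaleC mult.commute)

lemma star_scaleR: "(r *\<^sub>R x)\<^sup>\<star> = r *\<^sub>R (x::'b::cstar_algebra)\<^sup>\<star>"
  by (metis complex_cnj_complex_of_real scaleC_of_real star_scaleC)

lemma star_minus: "(- x)\<^sup>\<star> = - (x::'b::cstar_algebra)\<^sup>\<star>"
  by (metis scaleR_minus1_left star_scaleR)

lemma star_diff: "(x - y)\<^sup>\<star> = (x::'b::cstar_algebra)\<^sup>\<star> - y\<^sup>\<star>"
  by (metis diff_conv_add_uminus star_add star_minus)

lemma norm_star: "norm (x\<^sup>\<star>) = norm (x::'b::cstar_algebra)"
proof -
  have le: "norm y \<le> norm (y\<^sup>\<star>)" for y :: 'b
  proof (cases "norm y = 0")
    case False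
    have "norm y * norm y \<le> norm (y\<^sup>\<star>) * norm y"
      using cstar_identity[of y] norm_mult_ineq[of "y\<^sup>\<star>" y] by (simp add: power2_eq_square)
    then show ?thesis using False by simp
  qed simp
  show ?thesis using le[of x] le[of "x\<^sup>\<star>"] by (simp add: star_star)
qed

lemma cstar_identity': "norm (x * x\<^sup>\<star>) = (norm (x::'b::cstar_algebra))\<^sup>2"
  using cstar_identity[of "x\<^sup>\<star>"] by (simp add: star_star norm_star)

lemma bounded_linear_scaleC: "bounded_linear ((*\<^sub>C) c :: 'b::cstar_algebra \<Rightarrow> 'b)"
  by (rule bounded_linear_intro[of _ "cmod c"])
     (simp_all add: scaleC_add_right scaleC_scaleR norm_scaleC mult.commute)

lemma scaleC_homogeneous:
  fixes q :: "'b::cstar_algebra \<Rightarrow> real"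
  assumes le: "\<And>l b. b \<in> S \<Longrightarrow> q (l *\<^sub>C b) \<le> cmod l * q b"
    and S: "\<And>l b. b \<in> S \<Longrightarrow> l *\<^sub>C b \<in> S" and nonneg: "\<And>b. 0 \<le> q b" and b: "b \<in> S"
  shows "q (l *\<^sub>C b) = cmod l * q b"
proof (cases "l = 0")
  case True
  then show ?thesis using le[OF b, of 0] nonneg[of 0] by simp
next
  case False
  have "q b \<le> cmod (inverse l) * q (l *\<^sub>C b)"
    using le[OF S[OF b], of "inverse l" l] False by (simp add: scaleC_scaleC)
  then have "cmod l * q b \<le> q (l *\<^sub>C b)"
    using False by (simp add: norm_inverse norm_divide field_simps)
  then show ?thesis using le[OF b, of l] by simp
qed

lemmas tendsto_scaleC = bounded_linear.tendsto[OF bounded_linear_scaleC]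

section \<open>Minimal functions and the Hahn-Banach theorem\<close>

text \<open>Linear functionals are minimal among sublinear ones, and moduli of characters are minimal
  among nonzero C*-seminorms. Both are found by Zorn's lemma in this form.\<close>

lemma minimal_function_exists:
  fixes S :: "('a \<Rightarrow> real) set"
  assumes ne: "S \<noteq> {}" and bdd: "\<And>x. bdd_below ((\<lambda>q. q x) ` S)"
    and inf: "\<And>C. C \<subseteq> S \<Longrightarrow> C \<noteq> {} \<Longrightarrow> (\<And>p q. p \<in> C \<Longrightarrow> q \<in> C \<Longrightarrow> p \<le> q \<or> q \<le> p) \<Longrightarrow>
               (\<lambda>x. INF q\<in>C. q x) \<in> S"
  obtains m where "m \<in> S" "\<And>q. q \<in> S \<Longrightarrow> q \<le> m \<Longrightarrow> q = m"
proof -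
  have "\<exists>m\<in>S. \<forall>a\<in>S. m \<ge> a \<longrightarrow> a = m"
  proof (rule predicate_Zorn)
    show "partial_order_on S (relation_of (\<ge>) S)"
      by (auto simp: partial_order_on_def preorder_on_def refl_on_def trans_def antisym_def
          relation_of_def)
    fix C assume "C \<in> Chains (relation_of (\<ge>) S)"
    then have CS: "C \<subseteq> S" and tot: "\<And>p q. p \<in> C \<Longrightarrow> q \<in> C \<Longrightarrow> p \<le> q \<or> q \<le> p"
      by (auto simp: Chains_def relation_of_def)
    show "\<exists>u\<in>S. \<forall>a\<in>C. a \<ge> u"
    proof (cases "C = {}")
      case True then show ?thesis using ne by auto
    next
      case False
      have "(\<lambda>x. INF q\<in>C. q x) \<le> a" if "a \<in> C" for a
        unfolding le_fun_def
        using that bdd CS by (auto intro!: cINF_lower bdd_below_mono[OF bdd])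
      then show ?thesis using inf[OF CS False tot] by blast
    qed
  qed
  then show ?thesis using that by blast
qed

lemma chain_INF_approx:
  fixes C :: "('a \<Rightarrow> real) set"
  assumes "C \<noteq> {}" "\<And>p q. p \<in> C \<Longrightarrow> q \<in> C \<Longrightarrow> p \<le> q \<or> q \<le> p"
    and bdd: "\<And>x. bdd_below ((\<lambda>q. q x) ` C)" and e: "e > 0"
  obtains q where "q \<in> C" "q x < (INF q\<in>C. q x) + e" "q y < (INF q\<in>C. q y) + e"
proof -
  have *: "\<exists>q\<in>C. q z < (INF q\<in>C. q z) + e" for z
    using cINF_less_iff[OF assms(1) bdd, of z "(INF q\<in>C. q z) + e"] e by auto
  obtain p q where p: "p \<in> C" "p x < (INF q\<in>C. q x) + e" and q: "q \<in> C" "q y < (INF q\<in>C. q y) + e"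
    using * by blast
  consider "p \<le> q" | "q \<le> p" using assms(2) p q by blast
  then show ?thesis
  proof cases
    case 1 then show ?thesis using that[of p] p q le_funD[OF 1, of y] by linarith
  next
    case 2 then show ?thesis using that[of q] p q le_funD[OF 2, of x] by linarith
  qed
qed

definition sublinear :: "('a::real_vector \<Rightarrow> real) \<Rightarrow> bool" where
  "sublinear Q \<longleftrightarrow> (\<forall>x y. Q (x + y) \<le> Q x + Q y) \<and> (\<forall>r x. 0 \<le> r \<longrightarrow> Q (r *\<^sub>R x) = r * Q x)"

lemma sublinear_zero: "sublinear Q \<Longrightarrow> Q 0 = 0"
  unfolding sublinear_def by (metis mult_zero_left order_refl scaleR_zero_left)

lemma sublinear_neg: "sublinear Q \<Longrightarrow> - Q (- x) \<le> Q x"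
  using sublinear_zero[of Q] unfolding sublinear_def
  by (metis add.right_inverse minus_le_iff diff_ge_0_iff_ge add.commute diff_minus_eq_add)

lemma sublinearI:
  assumes "\<And>x y. Q (x + y) \<le> Q x + Q y" "\<And>r x. 0 < r \<Longrightarrow> Q (r *\<^sub>R x) \<le> r * Q x" "Q 0 = 0"
  shows "sublinear Q"
  unfolding sublinear_def
proof (intro conjI allI impI)
  fix r x assume "(0::real) \<le> r"
  show "Q (r *\<^sub>R x) = r * Q x"
  proof (cases "r = 0")
    case False
    with \<open>0 \<le> r\<close> have r: "0 < r" by simp
    have "Q x \<le> inverse r * Q (r *\<^sub>R x)" using assms(2)[of "inverse r" "r *\<^sub>R x"] r by simp
    then have "r * Q x \<le> Q (r *\<^sub>R x)" using r by (simp add: field_simps)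
    then show ?thesis using assms(2)[OF r, of x] by simp
  qed (simp add: assms)
qed (rule assms)

text \<open>The one-sided directional derivative of \<open>Q\<close> at \<open>y\<close>, in the form that makes it visibly an
  infimum. It is the largest sublinear minorant of \<open>Q\<close> whose value at \<open>- y\<close> is \<open>- Q y\<close>.\<close>

definition tangent :: "('a::real_vector \<Rightarrow> real) \<Rightarrow> 'a \<Rightarrow> 'a \<Rightarrow> real" where
  "tangent Q y x = (INF t\<in>{0..}. Q (x + t *\<^sub>R y) - t * Q y)"

lemma tangent_bdd:
  assumes "sublinear Q"
  shows "bdd_below ((\<lambda>t. Q (x + t *\<^sub>R y) - t * Q y) ` {0..})"
proof (rule bdd_belowI2[where m="- Q (- x)"])
  fix t :: real assume "t \<in> {0..}"
  then have "t * Q y = Q (- x + (x + t *\<^sub>R y))" using assms by (simp add: sublinear_def)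
  also have "\<dots> \<le> Q (- x) + Q (x + t *\<^sub>R y)" using assms unfolding sublinear_def by blast
  finally show "- Q (- x) \<le> Q (x + t *\<^sub>R y) - t * Q y" by simp
qed

lemma tangent_le:
  assumes "sublinear Q" "0 \<le> t" shows "tangent Q y x \<le> Q (x + t *\<^sub>R y) - t * Q y"
  unfolding tangent_def using assms(2) by (intro cINF_lower tangent_bdd assms) auto

lemma tangent_approx:
  assumes "sublinear Q" "tangent Q y x < r"
  obtains t where "0 \<le> t" "Q (x + t *\<^sub>R y) - t * Q y < r"
  using cINF_less_iff[OF _ tangent_bdd[OF assms(1)], of x y r] assms(2)
  unfolding tangent_def by auto

lemma tangent_le_self: "sublinear Q \<Longrightarrow> tangent Q y x \<le> Q x"
  using tangent_le[of Q 0 y x] by simp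

lemma tangent_minus: "sublinear Q \<Longrightarrow> tangent Q y (- y) \<le> - Q y"
  using tangent_le[of Q 1 y "- y"] sublinear_zero[of Q] by simp

lemma sublinear_tangent:
  assumes Q: "sublinear Q" shows "sublinear (tangent Q y)"
proof (rule sublinearI)
  fix x z
  show "tangent Q y (x + z) \<le> tangent Q y x + tangent Q y z"
  proof (rule field_le_epsilon)
    fix e :: real assume e: "e > 0"
    obtain s where s: "0 \<le> s" "Q (x + s *\<^sub>R y) - s * Q y < tangent Q y x + e/2"
      using tangent_approx[OF Q, of y x "tangent Q y x + e/2"] e by auto
    obtain t where t: "0 \<le> t" "Q (z + t *\<^sub>R y) - t * Q y < tangent Q y z + e/2"
      using tangent_approx[OF Q, of y z "tangent Q y z + e/2"] e by auto
    have "tangent Q y (x + z) \<le> Q ((x + z) + (s + t) *\<^sub>R y) - (s + t) * Q y"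
      using tangent_le[OF Q, of "s + t"] s t by simp
    also have "(x + z) + (s + t) *\<^sub>R y = (x + s *\<^sub>R y) + (z + t *\<^sub>R y)"
      by (simp add: algebra_simps)
    also have "Q \<dots> \<le> Q (x + s *\<^sub>R y) + Q (z + t *\<^sub>R y)" using Q unfolding sublinear_def by blast
    finally show "tangent Q y (x + z) \<le> tangent Q y x + tangent Q y z + e"
      using s t by (simp add: algebra_simps)
  qed
next
  fix r :: real and x assume r: "0 < r"
  show "tangent Q y (r *\<^sub>R x) \<le> r * tangent Q y x"
  proof (rule le_mult_if_approx)
    fix e :: real assume "0 < e"
    then obtain s where s: "0 \<le> s" "Q (x + s *\<^sub>R y) - s * Q y < tangent Q y x + e"
      using tangent_approx[OF Q, of y x "tangent Q y x + e"] by auto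
    have "tangent Q y (r *\<^sub>R x) \<le> Q (r *\<^sub>R x + (r * s) *\<^sub>R y) - (r * s) * Q y"
      using tangent_le[OF Q, of "r * s"] s r by simp
    also have "r *\<^sub>R x + (r * s) *\<^sub>R y = r *\<^sub>R (x + s *\<^sub>R y)" by (simp add: algebra_simps)
    also have "Q \<dots> = r * Q (x + s *\<^sub>R y)" using Q r unfolding sublinear_def by simp
    finally have "tangent Q y (r *\<^sub>R x) \<le> r * (Q (x + s *\<^sub>R y) - s * Q y)" by (simp add: algebra_simps)
    then show "\<exists>s. s < tangent Q y x + e \<and> tangent Q y (r *\<^sub>R x) \<le> r * s" using s(2) by blast
  qed (use r in simp)
next
  have "tangent Q y 0 = (INF t\<in>{0::real..}. 0)"
    unfolding tangent_def using Q by (intro INF_cong) (auto simp: sublinear_def)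
  then show "tangent Q y 0 = 0" by simp
qed

text \<open>A minimal sublinear functional \<open>m\<close> coincides with its derivative at every \<open>y\<close>, so that
  \<open>m (- y) \<le> - m y\<close>; an odd sublinear functional is linear. Looking for \<open>m\<close> below the derivative of
  \<open>P\<close> at \<open>c\<close> forces the value \<open>P c\<close> at \<open>c\<close>.\<close>

lemma hahn_banach:
  fixes P :: "'a::real_vector \<Rightarrow> real"
  assumes P: "sublinear P"
  obtains g where "linear g" "\<And>x. g x \<le> P x" "g c = P c"
proof -
  define S where "S = {Q. sublinear Q \<and> Q \<le> tangent P c}"
  have bdd: "bdd_below ((\<lambda>q. q x) ` S)" for x
  proof (rule bdd_belowI2[where m="- tangent P c (- x)"])
    fix Q assume "Q \<in> S"
    then show "- tangent P c (- x) \<le> Q x"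
      using sublinear_neg[of Q x] unfolding S_def le_fun_def
      by (metis (no_types, lifting) mem_Collect_eq minus_le_iff order_trans neg_le_iff_le)
  qed
  obtain m where m: "m \<in> S" and min: "\<And>q. q \<in> S \<Longrightarrow> q \<le> m \<Longrightarrow> q = m"
  proof (rule minimal_function_exists[of S])
    show "S \<noteq> {}" using sublinear_tangent[OF P] unfolding S_def by auto
    show "bdd_below ((\<lambda>q. q x) ` S)" for x by (rule bdd)
    fix C assume C: "C \<subseteq> S" "C \<noteq> {}" and tot: "\<And>p q. p \<in> C \<Longrightarrow> q \<in> C \<Longrightarrow> p \<le> q \<or> q \<le> p"
    let ?I = "\<lambda>x. INF q\<in>C. q x"
    have bddC: "bdd_below ((\<lambda>q. q x) ` C)" for x
      using bdd_below_mono[OF bdd[of x]] C by (simp add: image_mono)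
    have low: "?I x \<le> q x" if "q \<in> C" for q x using that by (intro cINF_lower bddC)
    have sub: "sublinear q" if "q \<in> C" for q using that C unfolding S_def by auto
    have "sublinear ?I"
    proof (rule sublinearI)
      fix x z show "?I (x + z) \<le> ?I x + ?I z"
      proof (rule field_le_epsilon)
        fix e :: real assume "e > 0"
        then obtain q where q: "q \<in> C" "q x < ?I x + e/2" "q z < ?I z + e/2"
          using chain_INF_approx[OF C(2) tot bddC, of "e/2" x z] by auto
        have "?I (x + z) \<le> q (x + z)" using low[OF q(1)] .
        also have "\<dots> \<le> q x + q z" using sub[OF q(1)] unfolding sublinear_def by blast
        finally show "?I (x + z) \<le> ?I x + ?I z + e" using q by simp
      qed
    next
      fix r :: real and x assume r: "0 < r"
      show "?I (r *\<^sub>R x) \<le> r * ?I x"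
      proof (rule le_mult_if_approx)
        fix e :: real assume "0 < e"
        then obtain q where q: "q \<in> C" "q x < ?I x + e"
          using chain_INF_approx[OF C(2) tot bddC, of e x x] by auto
        have "?I (r *\<^sub>R x) \<le> q (r *\<^sub>R x)" using low[OF q(1)] .
        also have "\<dots> = r * q x" using sub[OF q(1)] r unfolding sublinear_def by simp
        finally show "\<exists>s. s < ?I x + e \<and> ?I (r *\<^sub>R x) \<le> r * s" using q(2) by blast
      qed (use r in simp)
    next
      have "?I 0 = (INF q\<in>C. 0)" using sub sublinear_zero by (intro INF_cong) auto
      then show "?I 0 = 0" using C(2) by simp
    qed
    moreover have "?I \<le> tangent P c"
    proof -
      obtain q where "q \<in> C" using C(2) by auto
      then show ?thesis using low[of q] C unfolding S_def le_fun_def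
        by (metis (no_types, lifting) mem_Collect_eq order_trans subsetD)
    qed
    ultimately show "?I \<in> S" unfolding S_def by simp
  qed (use that in blast)
  have sm: "sublinear m" and mP: "m x \<le> tangent P c x" for x
    using m unfolding S_def by (auto simp: le_fun_def)
  have odd: "m (- y) = - m y" for y
  proof -
    have "tangent m y \<in> S"
      using sublinear_tangent[OF sm] order_trans[OF tangent_le_self[OF sm] mP] unfolding S_def
      by (auto simp: le_fun_def)
    then have "tangent m y = m" using min tangent_le_self[OF sm] by (auto simp: le_fun_def)
    then have "m (- y) \<le> - m y" using tangent_minus[OF sm, of y] by simp
    then show ?thesis using sublinear_neg[OF sm, of "y"] by simp
  qed
  have add: "m (x + y) = m x + m y" for x y
  proof (rule antisym)
    show "m (x + y) \<le> m x + m y" using sm unfolding sublinear_def by blast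
    have "m (- x + - y) \<le> m (- x) + m (- y)" using sm unfolding sublinear_def by blast
    then show "m x + m y \<le> m (x + y)" using odd[of x] odd[of y] odd[of "x + y"] by simp
  qed
  have "m (r *\<^sub>R x) = r * m x" for r x
  proof (cases "r \<ge> 0")
    case False
    then have "0 \<le> - r" by simp
    then have "m ((- r) *\<^sub>R x) = (- r) * m x" using sm unfolding sublinear_def by blast
    then show ?thesis using odd[of "r *\<^sub>R x"] by simp
  qed (use sm in \<open>simp add: sublinear_def\<close>)
  then have lin: "linear m" using add by (intro linearI) auto
  have le: "m x \<le> P x" for x using mP[of x] tangent_le_self[OF P] order_trans by blast
  have "m (- c) \<le> - P c" using mP[of "- c"] tangent_minus[OF P, of c] by simp
  then have "P c \<le> m c" using odd[of c] by simp
  then show ?thesis using that[OF lin le] le[of c] by simp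
qed

section \<open>Characters of commutative C*-algebras\<close>

definition cstar_seminorm_on :: "'b::cstar_algebra set \<Rightarrow> ('b \<Rightarrow> real) \<Rightarrow> bool" where
  "cstar_seminorm_on A q \<longleftrightarrow>
     (\<forall>a\<in>A. 0 \<le> q a) \<and> (\<forall>a\<in>A. \<forall>b\<in>A. q (a + b) \<le> q a + q b) \<and>
     (\<forall>c. \<forall>a\<in>A. q (c *\<^sub>C a) = cmod c * q a) \<and>
     (\<forall>a\<in>A. \<forall>b\<in>A. q (a * b) \<le> q a * q b) \<and>
     (\<forall>a\<in>A. q (a\<^sup>\<star> * a) = (q a)\<^sup>2)"

definition commutative_star_subalgebra :: "'b::cstar_algebra set \<Rightarrow> bool" where
  "commutative_star_subalgebra A \<longleftrightarrow>
     closed_star_subalgebra A \<and> (\<forall>a\<in>A. \<forall>b\<in>A. a * b = b * a)"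

locale commutative_subalgebra =
  fixes A :: "'b::cstar_algebra set"
  assumes comm_star: "commutative_star_subalgebra A"
begin

lemma subspace: "complex_vector.subspace A" and closed: "closed A"
  and mult [simp, intro]: "a \<in> A \<Longrightarrow> b \<in> A \<Longrightarrow> a * b \<in> A"
  and star [simp, intro]: "a \<in> A \<Longrightarrow> a\<^sup>\<star> \<in> A"
  and comm: "a \<in> A \<Longrightarrow> b \<in> A \<Longrightarrow> a * b = b * a"
  using comm_star unfolding commutative_star_subalgebra_def closed_star_subalgebra_def by auto

lemma add [simp, intro]: "a \<in> A \<Longrightarrow> b \<in> A \<Longrightarrow> a + b \<in> A"
  and diff [simp, intro]: "a \<in> A \<Longrightarrow> b \<in> A \<Longrightarrow> a - b \<in> A"
  and scale [simp, intro]: "a \<in> A \<Longrightarrow> c *\<^sub>C a \<in> A"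
  and zero [simp, intro]: "0 \<in> A"
  using subspace by (auto intro: complex_vector.subspace_add complex_vector.subspace_diff
      complex_vector.subspace_scale complex_vector.subspace_0)

lemma scaleR [simp, intro]: "a \<in> A \<Longrightarrow> r *\<^sub>R a \<in> A"
  by (metis scale scaleC_of_real)

lemma minus [simp, intro]: "a \<in> A \<Longrightarrow> - a \<in> A"
  using diff[OF zero] by simp

lemma left_commute:
  "a \<in> A \<Longrightarrow> b \<in> A \<Longrightarrow> a * (b * c) = b * (a * c)"
  by (simp flip: mult.assoc add: comm)

context
  fixes q assumes q: "cstar_seminorm_on A q"
begin

lemma q_nonneg: "a \<in> A \<Longrightarrow> 0 \<le> q a"
  and q_add: "a \<in> A \<Longrightarrow> b \<in> A \<Longrightarrow> q (a + b) \<le> q a + q b"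
  and q_scale: "a \<in> A \<Longrightarrow> q (c *\<^sub>C a) = cmod c * q a"
  and q_mult: "a \<in> A \<Longrightarrow> b \<in> A \<Longrightarrow> q (a * b) \<le> q a * q b"
  and q_cstar: "a \<in> A \<Longrightarrow> q (a\<^sup>\<star> * a) = (q a)\<^sup>2"
  using q unfolding cstar_seminorm_on_def by blast+

lemma q_scaleR: "a \<in> A \<Longrightarrow> q (r *\<^sub>R a) = \<bar>r\<bar> * q a"
  using q_scale[of a "of_real r"] by (simp add: scaleC_of_real)

lemma q_minus: "a \<in> A \<Longrightarrow> q (- a) = q a"
  using q_scale[of a "-1"] by simp

lemma q_diff: "a \<in> A \<Longrightarrow> b \<in> A \<Longrightarrow> q (a - b) \<le> q a + q b"
  using q_add[of a "- b"] q_minus[of b] by simp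

end

text \<open>If \<open>q\<close> is the supremum of \<open>cmod \<circ> x\<close> over a set of characters \<open>x\<close> and \<open>p\<close> is self-adjoint
  with \<open>q p = 1\<close>, then the limit of \<open>q (a p^n)\<close> is the supremum over the characters at which \<open>p\<close>
  has modulus one.\<close>

definition mpow :: "'b \<Rightarrow> nat \<Rightarrow> 'b \<Rightarrow> 'b" where
  "mpow p n a = ((\<lambda>c. c * p) ^^ n) a"

lemma mpow_0 [simp]: "mpow p 0 a = a"
  and mpow_Suc: "mpow p (Suc n) a = mpow p n a * p"
  by (simp_all add: mpow_def)

lemma mpow_Suc': "mpow p (Suc n) a = mpow p n (a * p)"
  by (induction n) (simp_all add: mpow_Suc)

lemma mpow_in [simp, intro]: "p \<in> A \<Longrightarrow> a \<in> A \<Longrightarrow> mpow p n a \<in> A"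
  by (induction n) (simp_all add: mpow_Suc)

lemma mpow_add: "mpow p n (a + b) = mpow p n a + mpow p n b"
  by (induction n) (simp_all add: mpow_Suc algebra_simps)

lemma mpow_scale: "mpow p n (c *\<^sub>C a) = c *\<^sub>C mpow p n a"
  by (induction n) (simp_all add: mpow_Suc mult_scaleC_left)

lemma mpow_left: "mpow p n (a * b) = a * mpow p n b"
  by (induction n) (simp_all add: mpow_Suc mult.assoc)

lemma mpow_mpow: "mpow p n (mpow p m a) = mpow p (n + m) a"
  by (simp add: mpow_def funpow_add)

lemma mpow_mult:
  assumes "p \<in> A" "a \<in> A" "b \<in> A"
  shows "mpow p n a * mpow p m b = mpow p (n + m) (a * b)"
proof -
  have "mpow p n a * mpow p m b = mpow p m b * mpow p n a" using assms comm by simp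
  also have "\<dots> = mpow p n (mpow p m b * a)" by (simp add: mpow_left)
  also have "mpow p m b * a = mpow p m (a * b)" using assms comm by (simp add: mpow_left)
  finally show ?thesis by (simp add: mpow_mpow)
qed

lemma mpow_star:
  assumes "p \<in> A" "p\<^sup>\<star> = p" "a \<in> A"
  shows "(mpow p n a)\<^sup>\<star> = mpow p n (a\<^sup>\<star>)"
  using assms by (induction n) (auto simp: mpow_Suc star_mult comm)

definition localized_seminorm :: "('b \<Rightarrow> real) \<Rightarrow> 'b \<Rightarrow> 'b \<Rightarrow> real" where
  "localized_seminorm q p a = (if a \<in> A then lim (\<lambda>n. q (mpow p n a)) else 0)"

context
  fixes q p assumes q: "cstar_seminorm_on A q" and p: "p \<in> A" "p\<^sup>\<star> = p" "q p = 1"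
begin

lemma mpow_decseq: assumes "a \<in> A" shows "decseq (\<lambda>n. q (mpow p n a))"
  using q_mult[OF q, of _ p] assms p by (intro decseq_SucI) (auto simp: mpow_Suc)

lemma localized_tendsto:
  assumes a: "a \<in> A" shows "(\<lambda>n. q (mpow p n a)) \<longlonglongrightarrow> localized_seminorm q p a"
proof -
  have "0 \<le> q (mpow p i a)" for i using q_nonneg[OF q] p a by simp
  then obtain L where "(\<lambda>n. q (mpow p n a)) \<longlonglongrightarrow> L"
    using decseq_convergent[OF mpow_decseq[OF a], of 0] by blast
  then have "convergent (\<lambda>n. q (mpow p n a))" by (auto simp: convergent_def)
  then show ?thesis using a by (simp add: localized_seminorm_def convergent_LIMSEQ_iff)
qed

lemma localized_tendsto2:
  assumes a: "a \<in> A" shows "(\<lambda>n. q (mpow p (n + n) a)) \<longlonglongrightarrow> localized_seminorm q p a"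
  using LIMSEQ_subseq_LIMSEQ[OF localized_tendsto[OF a], of "\<lambda>n. n + n"]
  by (simp add: strict_mono_def o_def)

lemma localized_le: assumes a: "a \<in> A" shows "localized_seminorm q p a \<le> q a"
proof (rule LIMSEQ_le_const2[OF localized_tendsto[OF a]])
  show "\<exists>N. \<forall>n\<ge>N. q (mpow p n a) \<le> q a"
    using decseqD[OF mpow_decseq[OF a], of 0] by auto
qed

lemma localized_cstar_seminorm: "cstar_seminorm_on A (localized_seminorm q p)"
  unfolding cstar_seminorm_on_def
proof (intro conjI ballI allI)
  fix a assume a: "a \<in> A"
  show "0 \<le> localized_seminorm q p a"
    using q_nonneg[OF q] a p by (intro LIMSEQ_le_const[OF localized_tendsto[OF a]]) auto
  show "localized_seminorm q p (c *\<^sub>C a) = cmod c * localized_seminorm q p a" for c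
  proof (rule LIMSEQ_unique[OF localized_tendsto])
    show "(\<lambda>n. q (mpow p n (c *\<^sub>C a))) \<longlonglongrightarrow> cmod c * localized_seminorm q p a"
      using localized_tendsto[OF a] a p by (simp add: mpow_scale q_scale[OF q] tendsto_mult_left)
  qed (use a in simp)
  show "localized_seminorm q p (a\<^sup>\<star> * a) = (localized_seminorm q p a)\<^sup>2"
  proof (rule LIMSEQ_unique[OF localized_tendsto2])
    have "q (mpow p (n + n) (a\<^sup>\<star> * a)) = (q (mpow p n a))\<^sup>2" for n
      using q_cstar[OF q, of "mpow p n a"] a p by (simp add: mpow_star mpow_mult)
    then show "(\<lambda>n. q (mpow p (n + n) (a\<^sup>\<star> * a))) \<longlonglongrightarrow> (localized_seminorm q p a)\<^sup>2"
      using tendsto_power[OF localized_tendsto[OF a]] by simp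
  qed (use a in simp)
  fix b assume b: "b \<in> A"
  show "localized_seminorm q p (a + b) \<le> localized_seminorm q p a + localized_seminorm q p b"
    using q_add[OF q] a b p
    by (intro LIMSEQ_le[OF localized_tendsto tendsto_add[OF localized_tendsto localized_tendsto]])
       (auto simp: mpow_add)
  show "localized_seminorm q p (a * b) \<le> localized_seminorm q p a * localized_seminorm q p b"
    using q_mult[OF q] a b p
    by (intro LIMSEQ_le[OF localized_tendsto2 tendsto_mult[OF localized_tendsto localized_tendsto]])
       (auto simp flip: mpow_mult)
qed

lemma localized_shift:
  assumes a: "a \<in> A" shows "localized_seminorm q p (a * p) = localized_seminorm q p a"
proof (rule LIMSEQ_unique[OF localized_tendsto])
  show "(\<lambda>n. q (mpow p n (a * p))) \<longlonglongrightarrow> localized_seminorm q p a"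
    using LIMSEQ_Suc[OF localized_tendsto[OF a]] by (simp add: mpow_Suc')
qed (use a p in simp)

lemma localized_self: "localized_seminorm q p p = 1"
proof -
  have "q (mpow p n p) = 1" for n
  proof (induction n)
    case (Suc n)
    have "q (mpow p (n + n) (p * p)) = (q (mpow p n p))\<^sup>2"
      using q_cstar[OF q, of "mpow p n p"] p by (simp add: mpow_star mpow_mult)
    then have "1 = q (mpow p (Suc (n + n)) p)" using Suc by (simp add: mpow_Suc')
    also have "\<dots> \<le> q (mpow p (Suc n) p)" using decseqD[OF mpow_decseq[OF p(1)]] by simp
    finally show ?case using q_mult[OF q, of "mpow p n p" p] Suc p by (simp add: mpow_Suc)
  qed (use p in simp)
  then show ?thesis using LIMSEQ_unique[OF localized_tendsto[OF p(1)]] by simp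
qed

end

text \<open>For a minimal \<open>q\<close>, localizing at any self-adjoint \<open>p\<close> with \<open>q p = 1\<close> changes nothing, whence
  \<open>q (a p) = q a * q p\<close> for self-adjoint \<open>p\<close>; the C*-identity extends this to all products. The
  condition \<open>q (a h) = q a\<close> in the family keeps the localized seminorms from losing \<open>h\<close>: it passes
  to them and forces their value at \<open>h\<close> to be \<open>1\<close>.\<close>

lemma minimal_multiplicative_seminorm:
  assumes q0: "cstar_seminorm_on A q0" and h: "h \<in> A" "h\<^sup>\<star> = h" "q0 h = 1"
  obtains q where "cstar_seminorm_on A q" "\<And>a. a \<in> A \<Longrightarrow> q a \<le> q0 a" "q h = 1"
    "\<And>a b. a \<in> A \<Longrightarrow> b \<in> A \<Longrightarrow> q (a * b) = q a * q b"
proof -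
  define S where "S = {q. cstar_seminorm_on A q \<and> (\<forall>a\<in>A. q a \<le> q0 a) \<and> (\<forall>a. a \<notin> A \<longrightarrow> q a = 0)
    \<and> (\<forall>a\<in>A. q (a * h) = q a) \<and> q h = 1}"
  have nonneg: "0 \<le> q a" if "q \<in> S" for q a
    using that q_nonneg[of q a] unfolding S_def by (cases "a \<in> A") auto
  then have bdd: "bdd_below ((\<lambda>q. q x) ` S)" for x by (intro bdd_belowI2[where m=0])
  obtain m where m: "m \<in> S" and min: "\<And>q. q \<in> S \<Longrightarrow> q \<le> m \<Longrightarrow> q = m"
  proof (rule minimal_function_exists[of S])
    have "localized_seminorm q0 h \<in> S"
      using localized_cstar_seminorm[OF q0 h] localized_le[OF q0 h] localized_shift[OF q0 h]
        localized_self[OF q0 h] unfolding S_def by (simp add: localized_seminorm_def)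
    then show "S \<noteq> {}" by auto
    show "bdd_below ((\<lambda>q. q x) ` S)" for x by (rule bdd)
    fix C assume C: "C \<subseteq> S" "C \<noteq> {}" and tot: "\<And>p q. p \<in> C \<Longrightarrow> q \<in> C \<Longrightarrow> p \<le> q \<or> q \<le> p"
    let ?I = "\<lambda>x. INF q\<in>C. q x"
    have bddC: "bdd_below ((\<lambda>q. q x) ` C)" for x
      using bdd_below_mono[OF bdd[of x]] C by (simp add: image_mono)
    have low: "?I x \<le> q x" if "q \<in> C" for q x using that by (intro cINF_lower bddC)
    have sn: "cstar_seminorm_on A q" "q h = 1" "a \<in> A \<Longrightarrow> q a \<le> q0 a"
      "a \<notin> A \<Longrightarrow> q a = 0" "a \<in> A \<Longrightarrow> q (a * h) = q a" "0 \<le> q a" if "q \<in> C" for q a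
      using that C nonneg unfolding S_def by auto
    have Inn: "0 \<le> ?I a" for a using C(2) sn(6) by (intro cINF_greatest) auto
    have approx: "\<exists>q\<in>C. q x < ?I x + e \<and> q y < ?I y + e" if "e > 0" for x y e
      using chain_INF_approx[OF C(2) tot bddC that, of x y] by blast
    have "cstar_seminorm_on A ?I"
      unfolding cstar_seminorm_on_def
    proof (intro conjI ballI allI)
      fix a assume a: "a \<in> A"
      show "0 \<le> ?I a" by (rule Inn)
      have scale_le: "?I (l *\<^sub>C d) \<le> cmod l * ?I d" if d: "d \<in> A" for l d
      proof (rule le_mult_if_approx)
        fix e :: real assume "0 < e"
        then obtain q where q: "q \<in> C" "q d < ?I d + e" using approx[of e d d] by auto
        then show "\<exists>s. s < ?I d + e \<and> ?I (l *\<^sub>C d) \<le> cmod l * s"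
          using low[OF q(1), of "l *\<^sub>C d"] q_scale[OF sn(1)[OF q(1)] d] by auto
      qed simp
      show "?I (c *\<^sub>C a) = cmod c * ?I a" for c
        by (rule scaleC_homogeneous[where S = A]) (use scale_le Inn a in auto)
      show "?I (a\<^sup>\<star> * a) = (?I a)\<^sup>2"
      proof (rule antisym)
        show "(?I a)\<^sup>2 \<le> ?I (a\<^sup>\<star> * a)"
        proof (rule cINF_greatest[OF C(2)])
          fix q assume q: "q \<in> C"
          then show "(?I a)\<^sup>2 \<le> q (a\<^sup>\<star> * a)"
            using q_cstar[OF sn(1)[OF q] a] low[OF q, of a] Inn[of a] by (simp add: power_mono)
        qed
        have "?I (a\<^sup>\<star> * a) \<le> (?I a + e) * (?I a + e)" if e: "e > 0" for e
        proof -
          obtain q where q: "q \<in> C" "q a < ?I a + e" using approx[OF e] by blast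
          have "?I (a\<^sup>\<star> * a) \<le> q a * q a"
            using low[OF q(1), of "a\<^sup>\<star> * a"] q_cstar[OF sn(1)[OF q(1)] a] by (simp add: power2_eq_square)
          also have "\<dots> \<le> (?I a + e) * (?I a + e)" using q sn(6)[OF q(1), of a] by (intro mult_mono) auto
          finally show ?thesis .
        qed
        then show "?I (a\<^sup>\<star> * a) \<le> (?I a)\<^sup>2" unfolding power2_eq_square by (rule le_mult_if_le_mult_add)
      qed
      fix b assume b: "b \<in> A"
      show "?I (a + b) \<le> ?I a + ?I b"
      proof (rule field_le_epsilon)
        fix e :: real assume "e > 0"
        then obtain q where q: "q \<in> C" "q a < ?I a + e/2" "q b < ?I b + e/2"
          using approx[of "e/2" a b] by auto
        show "?I (a + b) \<le> ?I a + ?I b + e"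
          using low[OF q(1), of "a + b"] q_add[OF sn(1)[OF q(1)] a b] q by linarith
      qed
      have "?I (a * b) \<le> (?I a + e) * (?I b + e)" if e: "e > 0" for e
      proof -
        obtain q where q: "q \<in> C" "q a < ?I a + e" "q b < ?I b + e" using approx[OF e] by blast
        have "?I (a * b) \<le> q a * q b"
          using low[OF q(1), of "a * b"] q_mult[OF sn(1)[OF q(1)] a b] by simp
        also have "\<dots> \<le> (?I a + e) * (?I b + e)"
          using q sn(6)[OF q(1)] Inn[of a] e by (intro mult_mono) auto
        finally show ?thesis .
      qed
      then show "?I (a * b) \<le> ?I a * ?I b" by (rule le_mult_if_le_mult_add)
    qed
    moreover have "?I h = (INF q\<in>C. 1)" using sn(2) by (intro INF_cong) auto
    moreover have "?I a = (INF q\<in>C. 0)" if "a \<notin> A" for a using sn(4) that by (intro INF_cong) auto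
    moreover have "?I (a * h) = ?I a" if "a \<in> A" for a using sn(5) that by (intro INF_cong) auto
    moreover have "?I a \<le> q0 a" if "a \<in> A" for a
      using C(2) low sn(3)[OF _ that] by (meson ex_in_conv order_trans)
    ultimately show "?I \<in> S" using C(2) unfolding S_def by simp
  qed (use that in blast)
  have mq: "cstar_seminorm_on A m" and mh: "\<And>a. a \<in> A \<Longrightarrow> m (a * h) = m a" "m h = 1"
    and mle: "\<And>a. a \<in> A \<Longrightarrow> m a \<le> q0 a" and mout: "\<And>a. a \<notin> A \<Longrightarrow> m a = 0"
    using m unfolding S_def by auto
  have shift: "m (a * p) = m a" if p: "p \<in> A" "p\<^sup>\<star> = p" "m p = 1" and a: "a \<in> A" for a p
  proof -
    let ?Q = "localized_seminorm m p"
    note Q = localized_cstar_seminorm[OF mq p]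
    have le: "?Q a \<le> m a" for a
      using localized_le[OF mq p] mout[of a] by (cases "a \<in> A") (auto simp: localized_seminorm_def)
    have Qh: "?Q (a * h) = ?Q a" if a: "a \<in> A" for a
    proof -
      have "m (mpow p n (a * h)) = m (mpow p n a)" for n
        using mh(1)[of "mpow p n a"] a p h comm by (metis mpow_in mpow_left)
      then show ?thesis using a h by (simp add: localized_seminorm_def)
    qed
    have "1 \<le> ?Q h"
      using Qh[OF p(1)] q_mult[OF Q p(1) h(1)] localized_self[OF mq p] by simp
    then have "?Q h = 1" using le[of h] mh by simp
    moreover have "?Q a = 0" if "a \<notin> A" for a using that by (simp add: localized_seminorm_def)
    ultimately have "?Q \<in> S" using Q Qh order_trans[OF le mle] unfolding S_def by blast
    then have "?Q = m" using min le by (auto simp: le_fun_def)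
    then show ?thesis using localized_shift[OF mq p a] by simp
  qed
  have sa: "m (a * p) = m a * m p" if p: "p \<in> A" "p\<^sup>\<star> = p" and a: "a \<in> A" for a p
  proof (cases "m p = 0")
    case True
    then show ?thesis using q_mult[OF mq a p(1)] q_nonneg[OF mq, of "a * p"] a p by simp
  next
    case False
    let ?p = "inverse (m p) *\<^sub>R p"
    have "m ?p = 1" using q_scaleR[OF mq p(1)] q_nonneg[OF mq p(1)] False by simp
    then have "m (a * ?p) = m a" using p a by (intro shift) (auto simp: star_scaleR)
    then have "inverse (m p) * m (a * p) = m a"
      using q_scaleR[OF mq, of "a * p"] p a q_nonneg[OF mq p(1)] by simp
    then show ?thesis using False by (simp add: field_simps)
  qed
  have "m (a * b) = m a * m b" if a: "a \<in> A" and b: "b \<in> A" for a b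
  proof -
    have "(m (a * b))\<^sup>2 = m ((a * b)\<^sup>\<star> * (a * b))" using q_cstar[OF mq, of "a * b"] a b by simp
    also have "(a * b)\<^sup>\<star> * (a * b) = (a\<^sup>\<star> * a) * (b\<^sup>\<star> * b)"
      using a b by (simp add: star_mult mult.assoc comm left_commute)
    also have "m \<dots> = m (a\<^sup>\<star> * a) * m (b\<^sup>\<star> * b)"
      using a b by (intro sa) (auto simp: star_mult star_star)
    also have "\<dots> = (m a * m b)\<^sup>2" using q_cstar[OF mq] a b by (simp add: power_mult_distrib)
    finally show ?thesis using q_nonneg[OF mq] a b by (simp add: power2_eq_iff_nonneg)
  qed
  then show ?thesis using that[of m] mq mle mh by blast
qed

text \<open>The Gelfand-Mazur theorem for a multiplicative seminorm: the distance from \<open>b\<close> to the scalars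
  is attained and cannot be positive. Multiplication by \<open>h\<close> compensates for the absence of a unit.\<close>

lemma multiplicative_seminorm_eigenvalue:
  assumes q: "cstar_seminorm_on A q" and h: "h \<in> A" "q h = 1"
    and qmult: "\<And>a b. a \<in> A \<Longrightarrow> b \<in> A \<Longrightarrow> q (a * b) = q a * q b" and b: "b \<in> A"
  obtains l where "q (b * h - l *\<^sub>C h) = 0"
proof -
  define N where "N l = q (b * h - l *\<^sub>C h)" for l
  have Nin: "b * h - l *\<^sub>C h \<in> A" for l using b h by simp
  have N0: "0 \<le> N l" for l unfolding N_def using q_nonneg[OF q Nin] .
  have N_diff: "N l \<le> N k + cmod (l - k)" for l k
  proof -
    have "b * h - l *\<^sub>C h = (b * h - k *\<^sub>C h) + (k - l) *\<^sub>C h"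
      by (simp add: complex_vector.scale_left_diff_distrib)
    then have "N l \<le> N k + q ((k - l) *\<^sub>C h)"
      unfolding N_def using q_add[OF q Nin[of k] scale[OF h(1), of "k - l"]] by metis
    then show ?thesis using q_scale[OF q h(1)] h(2) by (simp add: norm_minus_commute)
  qed
  have N_ge: "cmod l - N 0 \<le> N l" for l
  proof -
    have "q (l *\<^sub>C h) \<le> q (b * h) + q (b * h - l *\<^sub>C h)"
      using q_diff[OF q, of "b * h" "b * h - l *\<^sub>C h"] b h by simp
    then show ?thesis unfolding N_def using q_scale[OF q h(1)] h(2) by simp
  qed
  have cont: "continuous_on S N" for S
  proof (rule lipschitz_on_continuous_on[OF lipschitz_onI])
    show "dist (N l) (N k) \<le> 1 * dist l k" for l k
      using N_diff[of l k] N_diff[of k l] by (simp add: dist_norm norm_minus_commute abs_le_iff)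
  qed simp
  have "cball (0::complex) (2 * N 0) \<noteq> {}" using N0[of 0] by simp
  then obtain l0 where l0: "\<And>l. l \<in> cball 0 (2 * N 0) \<Longrightarrow> N l0 \<le> N l"
    using continuous_attains_inf[OF compact_cball _ cont] by blast
  have min: "N l0 \<le> N l" for l
  proof (cases "l \<in> cball 0 (2 * N 0)")
    case False
    then have "N 0 \<le> N l" using N_ge[of l] by auto
    then show ?thesis using l0[of 0] N0[of 0] by simp
  qed (rule l0)
  define m where "m = N l0"
  have "m = 0"
  proof (rule ccontr)
    assume "m \<noteq> 0"
    then have mpos: "0 < m" using N0 unfolding m_def by (metis order_le_less)
    \<comment> \<open>The minimum is attained on a whole disc around each minimizer \<open>c\<close>: with \<open>y = b - c\<close>,
      all \<open>2^k\<close> linear factors of \<open>y^(2^k) - l^(2^k)\<close> have seminorm at least \<open>m\<close>, one of them is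
      \<open>y - l\<close>, and the product has seminorm at most \<open>m^(2^k) + (cmod l)^(2^k)\<close>.\<close>
    have disc: "N (c + l) = m" if c: "N c = m" and l: "cmod l < m" for c l
    proof -
      define y where "y = b * h - c *\<^sub>C h"
      define Y where "Y k = ((\<lambda>z. z * z) ^^ k) y" for k
      define H where "H k = ((\<lambda>z. z * z) ^^ k) h" for k
      have Y: "Y k \<in> A" "q (Y k) = m ^ (2 ^ k)" for k
      proof (induction k)
        case 0
        show "Y 0 \<in> A" "q (Y 0) = m ^ 2 ^ 0" using c Nin unfolding Y_def y_def N_def by auto
      next
        case (Suc k)
        show "Y (Suc k) \<in> A" "q (Y (Suc k)) = m ^ 2 ^ Suc k"
          using Suc qmult[of "Y k" "Y k"] by (simp_all add: Y_def flip: power_add mult_2)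
      qed
      have H: "H k \<in> A" "q (H k) = 1" for k
        by (induction k) (use h qmult in \<open>auto simp: H_def\<close>)
      have fac: "Y (Suc k) - (u * u) *\<^sub>C H (Suc k) = (Y k - u *\<^sub>C H k) * (Y k + u *\<^sub>C H k)" for k u
        using comm[OF Y(1) H(1), of k k]
        by (simp add: Y_def H_def algebra_simps mult_scaleC_left mult_scaleC_right scaleC_scaleC)
      have low: "m ^ (2 ^ k) \<le> q (Y k - u *\<^sub>C H k)" for k u
      proof (induction k arbitrary: u)
        case 0
        have "Y 0 - u *\<^sub>C H 0 = b * h - (c + u) *\<^sub>C h"
          by (simp add: Y_def H_def y_def scaleC_add_left algebra_simps)
        then show ?case using min[of "c + u"] by (simp add: N_def m_def)
      next
        case (Suc k)
        define s where "s = csqrt u"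
        have u: "u = s * s" unfolding s_def by (simp flip: power2_eq_square)
        have "q (Y (Suc k) - u *\<^sub>C H (Suc k)) = q (Y k - s *\<^sub>C H k) * q (Y k + s *\<^sub>C H k)"
          unfolding u fac using Y H by (intro qmult) auto
        also have "\<dots> \<ge> m ^ (2 ^ k) * m ^ (2 ^ k)"
          using Suc[of s] Suc[of "- s"] mpos q_nonneg[OF q, of "Y k - s *\<^sub>C H k"] Y H
          by (intro mult_mono) auto
        finally show ?case by (simp flip: power_add mult_2)
      qed
      have up: "q (Y 0 - l *\<^sub>C H 0) * m ^ (2 ^ k) \<le> m * q (Y k - (l ^ (2 ^ k)) *\<^sub>C H k)" for k
      proof (induction k)
        case (Suc k)
        let ?u = "l ^ (2 ^ k)"
        have "q (Y 0 - l *\<^sub>C H 0) * m ^ (2 ^ Suc k) = (q (Y 0 - l *\<^sub>C H 0) * m ^ (2 ^ k)) * m ^ (2 ^ k)"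
          by (simp add: mult_2 power_add)
        also have "\<dots> \<le> (m * q (Y k - ?u *\<^sub>C H k)) * q (Y k + ?u *\<^sub>C H k)"
          using low[of k "- ?u"] mpos Y H q_nonneg[OF q, of "Y k - ?u *\<^sub>C H k"]
          by (intro mult_mono[OF Suc]) auto
        also have "\<dots> = m * q ((Y k - ?u *\<^sub>C H k) * (Y k + ?u *\<^sub>C H k))"
          using Y H by (simp add: qmult)
        also have "(Y k - ?u *\<^sub>C H k) * (Y k + ?u *\<^sub>C H k) = Y (Suc k) - (?u * ?u) *\<^sub>C H (Suc k)"
          by (rule fac[symmetric])
        also have "?u * ?u = l ^ (2 ^ Suc k)" by (simp flip: power_add mult_2)
        finally show ?case .
      qed (simp add: mult.commute)
      have bound: "N (c + l) \<le> m + m * (cmod l / m) ^ (2 ^ k)" for k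
      proof -
        have "Y 0 - l *\<^sub>C H 0 = b * h - (c + l) *\<^sub>C h"
          by (simp add: Y_def H_def y_def scaleC_add_left algebra_simps)
        then have "N (c + l) * m ^ (2 ^ k) \<le> m * q (Y k - (l ^ (2 ^ k)) *\<^sub>C H k)"
          using up[of k] by (simp add: N_def)
        also have "\<dots> \<le> m * (q (Y k) + q ((l ^ (2 ^ k)) *\<^sub>C H k))"
          using mpos Y H by (intro mult_left_mono q_diff[OF q]) auto
        also have "\<dots> = m * (m ^ (2 ^ k) + cmod l ^ (2 ^ k))"
          using q_scale[OF q H(1)] Y H by (simp add: norm_power)
        finally have "N (c + l) * m ^ (2 ^ k) \<le> m * (m ^ (2 ^ k) + cmod l ^ (2 ^ k))" .
        then have "N (c + l) \<le> m * (m ^ (2 ^ k) + cmod l ^ (2 ^ k)) / m ^ (2 ^ k)"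
          using mpos by (simp add: pos_le_divide_eq)
        also have "\<dots> = m + m * (cmod l / m) ^ (2 ^ k)"
          using mpos by (simp add: field_simps power_divide)
        finally show ?thesis .
      qed
      have "(\<lambda>k. (cmod l / m) ^ k) \<longlonglongrightarrow> 0"
        using l mpos by (intro LIMSEQ_power_zero) simp
      from LIMSEQ_subseq_LIMSEQ[OF this, of "\<lambda>k. 2 ^ k"]
      have "(\<lambda>k. (cmod l / m) ^ (2 ^ k)) \<longlonglongrightarrow> 0" by (simp add: strict_mono_def o_def)
      then have "(\<lambda>k. m + m * (cmod l / m) ^ (2 ^ k)) \<longlonglongrightarrow> m + m * 0"
        by (intro tendsto_intros)
      then have "N (c + l) \<le> m" using bound by (intro LIMSEQ_le_const) auto
      then show ?thesis using min[of "c + l"] unfolding m_def by simp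
    qed
    have ray: "N (l0 + of_real (real n * (m / 2))) = m" for n
    proof (induction n)
      case (Suc n)
      have "cmod (of_real (m / 2)) < m" by (subst norm_of_real) (use mpos in simp)
      from disc[OF Suc this]
      have "N ((l0 + of_real (real n * (m / 2))) + of_real (m / 2)) = m" .
      also have "(l0 + of_real (real n * (m / 2))) + of_real (m / 2) = l0 + of_real (real (Suc n) * (m / 2))"
        by (simp add: algebra_simps)
      finally show ?case .
    qed (simp add: m_def)
    obtain n :: nat where "real n > (m + N 0 + cmod l0) / (m / 2)"
      using reals_Archimedean2 by blast
    then have "real n * (m / 2) > m + N 0 + cmod l0" using mpos by (simp add: pos_divide_less_eq)
    moreover have "real n * (m / 2) = cmod (of_real (real n * (m / 2)))"
      using mpos by (simp only: norm_of_real) simp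
    moreover have "cmod (of_real (real n * (m / 2))) \<le> cmod (l0 + of_real (real n * (m / 2))) + cmod l0"
      using norm_triangle_ineq4[of "l0 + of_real (real n * (m / 2))" l0] by simp
    ultimately show False using N_ge[of "l0 + of_real (real n * (m / 2))"]
      unfolding ray by linarith
  qed
  then show ?thesis using that[of l0] unfolding m_def N_def by simp
qed

lemma spectrumD:
  assumes "x \<in> spectrum A"
  shows char_add: "a \<in> A \<Longrightarrow> b \<in> A \<Longrightarrow> x (a + b) = x a + x b"
    and char_scale: "a \<in> A \<Longrightarrow> x (c *\<^sub>C a) = c * x a"
    and char_mult: "a \<in> A \<Longrightarrow> b \<in> A \<Longrightarrow> x (a * b) = x a * x b"
    and char_nonzero: "\<exists>a\<in>A. x a \<noteq> 0"
  using assms unfolding spectrum_def by auto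

text \<open>The character is the eigenvalue \<open>x b\<close> with \<open>b h = x b \<cdot> h\<close> modulo a multiplicative seminorm
  below \<open>q0\<close> that keeps its value at \<open>h\<close>, a multiple of \<open>a\<^sup>\<star> a\<close>.\<close>

lemma exists_character:
  assumes q0: "cstar_seminorm_on A q0" and a: "a \<in> A" "q0 a > 0"
  obtains x where "x \<in> spectrum A" "\<And>b. b \<in> A \<Longrightarrow> cmod (x b) \<le> q0 b" "cmod (x a) = q0 a"
proof -
  define h where "h = inverse ((q0 a)\<^sup>2) *\<^sub>R (a\<^sup>\<star> * a)"
  have hA: "h \<in> A" and hsa: "h\<^sup>\<star> = h" using a by (auto simp: h_def star_scaleR star_mult star_star)
  have "q0 h = 1" using a q_scaleR[OF q0, of "a\<^sup>\<star> * a"] q_cstar[OF q0 a(1)] by (simp add: h_def)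
  from minimal_multiplicative_seminorm[OF q0 hA hsa this]
  obtain q where q: "cstar_seminorm_on A q" and qle: "\<And>a. a \<in> A \<Longrightarrow> q a \<le> q0 a" and qh: "q h = 1"
    and qmult: "\<And>a b. a \<in> A \<Longrightarrow> b \<in> A \<Longrightarrow> q (a * b) = q a * q b" by metis
  define x where "x = restrict (\<lambda>b. SOME l. q (b * h - l *\<^sub>C h) = 0) A"
  have x: "q (b * h - x b *\<^sub>C h) = 0" if "b \<in> A" for b
  proof -
    have "\<exists>l. q (b * h - l *\<^sub>C h) = 0"
      using multiplicative_seminorm_eigenvalue[OF q hA qh qmult that] by metis
    from someI_ex[OF this] show ?thesis using that by (simp add: x_def)
  qed
  have uniq: "x b = l" if "b \<in> A" "q (b * h - l *\<^sub>C h) = 0" for b l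
  proof -
    have "q ((b * h - l *\<^sub>C h) - (b * h - x b *\<^sub>C h)) \<le> 0"
      using q_diff[OF q, of "b * h - l *\<^sub>C h" "b * h - x b *\<^sub>C h"] x[OF that(1)] that hA by simp
    moreover have "(b * h - l *\<^sub>C h) - (b * h - x b *\<^sub>C h) = (x b - l) *\<^sub>C h"
      by (simp add: complex_vector.scale_left_diff_distrib)
    ultimately show ?thesis using q_scale[OF q hA, of "x b - l"] qh by simp
  qed
  have small: "q c = 0" if "c \<in> A" "q c \<le> 0" for c using q_nonneg[OF q that(1)] that by simp
  have q_x: "cmod (x b) = q b" if b: "b \<in> A" for b
  proof -
    have "q (b * h) \<le> q (b * h - x b *\<^sub>C h) + q (x b *\<^sub>C h)"
      using q_add[OF q, of "b * h - x b *\<^sub>C h" "x b *\<^sub>C h"] b hA by simp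
    moreover have "q (x b *\<^sub>C h) \<le> q (b * h) + q (b * h - x b *\<^sub>C h)"
      using q_diff[OF q, of "b * h" "b * h - x b *\<^sub>C h"] b hA by simp
    ultimately show ?thesis using x[OF b] qmult[OF b hA] qh q_scale[OF q hA] by simp
  qed
  have "x (b + c) = x b + x c" if "b \<in> A" "c \<in> A" for b c
  proof (rule uniq)
    have "(b + c) * h - (x b + x c) *\<^sub>C h = (b * h - x b *\<^sub>C h) + (c * h - x c *\<^sub>C h)"
      by (simp add: scaleC_add_left algebra_simps)
    then show "q ((b + c) * h - (x b + x c) *\<^sub>C h) = 0"
      using q_add[OF q, of "b * h - x b *\<^sub>C h" "c * h - x c *\<^sub>C h"] x that hA by (intro small) auto
  qed (use that in auto)
  moreover have "x (l *\<^sub>C b) = l * x b" if "b \<in> A" for b l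
  proof (rule uniq)
    have "(l *\<^sub>C b) * h - (l * x b) *\<^sub>C h = l *\<^sub>C (b * h - x b *\<^sub>C h)"
      by (simp add: complex_vector.scale_right_diff_distrib mult_scaleC_left scaleC_scaleC)
    then show "q ((l *\<^sub>C b) * h - (l * x b) *\<^sub>C h) = 0"
      using q_scale[OF q, of "b * h - x b *\<^sub>C h" l] x that hA by auto
  qed (use that in auto)
  moreover have "x (b * c) = x b * x c" if "b \<in> A" "c \<in> A" for b c
  proof (rule uniq)
    have "(b * c) * h - (x b * x c) *\<^sub>C h = b * (c * h - x c *\<^sub>C h) + x c *\<^sub>C (b * h - x b *\<^sub>C h)"
      by (simp add: complex_vector.scale_right_diff_distrib mult_scaleC_right scaleC_scaleC
          algebra_simps)
    moreover have "q (b * (c * h - x c *\<^sub>C h)) = 0" "q (x c *\<^sub>C (b * h - x b *\<^sub>C h)) = 0"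
      using x that hA by (simp_all add: qmult q_scale[OF q])
    ultimately show "q ((b * c) * h - (x b * x c) *\<^sub>C h) = 0"
      using q_add[OF q, of "b * (c * h - x c *\<^sub>C h)" "x c *\<^sub>C (b * h - x b *\<^sub>C h)"] that hA
      by (intro small) auto
  qed (use that in auto)
  moreover have "x h \<noteq> 0" using q_x[OF hA] qh by auto
  ultimately have spec: "x \<in> spectrum A" using hA unfolding spectrum_def x_def by auto
  have "q (a\<^sup>\<star> * a) = (q0 a)\<^sup>2"
  proof -
    have "a\<^sup>\<star> * a = (q0 a)\<^sup>2 *\<^sub>R h" using a by (simp add: h_def)
    then show ?thesis using q_scaleR[OF q hA] qh by simp
  qed
  then have "q a = q0 a" using q_cstar[OF q a(1)] q_nonneg[OF q a(1)] a
    by (simp add: power2_eq_iff_nonneg)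
  then show ?thesis using that[OF spec] q_x qle a by simp
qed

end

section \<open>Functional calculus in commutative algebras\<close>

lemma le_if_powers_bounded:
  fixes r s a b :: real
  assumes "0 < a" "0 \<le> r" "0 \<le> s" "\<And>n. r ^ n * a \<le> s ^ n * b"
  shows "r \<le> s"
proof (rule ccontr)
  assume "\<not> r \<le> s"
  then have sr: "s < r" "0 < r" using assms by auto
  have "a \<le> (s / r) ^ n * b" for n
    using assms(4)[of n] sr by (simp add: power_divide field_simps)
  moreover have "(\<lambda>n. (s / r) ^ n * b) \<longlonglongrightarrow> 0 * b"
    using sr assms by (intro tendsto_mult_right LIMSEQ_power_zero) simp
  ultimately have "a \<le> 0 * b" by (intro LIMSEQ_le_const) auto
  then show False using assms(1) by simp
qed

lemma Im_zero_if_quadratic_bound: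
  assumes bound: "\<And>t. (cmod (z + \<i> * of_real t))\<^sup>2 \<le> M + t\<^sup>2"
  shows "Im z = 0"
proof (rule ccontr)
  define v where "v = Im z"
  have quad: "2 * t * v \<le> M" for t
  proof -
    have "(cmod (z + \<i> * of_real t))\<^sup>2 = (Re z)\<^sup>2 + (v + t)\<^sup>2"
      by (simp add: cmod_power2 v_def)
    then have "(v + t)\<^sup>2 \<le> M + t\<^sup>2" using bound[of t] by (smt (verit) zero_le_power2)
    moreover have "(v + t)\<^sup>2 = v\<^sup>2 + 2 * t * v + t\<^sup>2" by (simp add: power2_sum)
    ultimately show ?thesis by (smt (verit) zero_le_power2)
  qed
  assume "Im z \<noteq> 0"
  then have "2 * ((M + 1) / (2 * v)) * v = M + 1" by (simp add: v_def)
  then show False using quad[of "(M + 1) / (2 * v)"] by linarith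
qed

lemma norm_selfadjoint_add_imaginary:
  fixes h :: "'b::cstar_algebra"
  assumes h: "h\<^sup>\<star> = h"
  shows "norm (h * b + (\<i> * of_real t) *\<^sub>C b) \<le> sqrt ((norm h)\<^sup>2 + t\<^sup>2) * norm b"
proof -
  let ?T = "h * b + (\<i> * of_real t) *\<^sub>C b"
  have "(norm ?T)\<^sup>2 = norm (?T\<^sup>\<star> * ?T)" by (simp add: cstar_identity)
  also have "?T\<^sup>\<star> * ?T = (h * b)\<^sup>\<star> * (h * b) + (of_real (t\<^sup>2)) *\<^sub>C (b\<^sup>\<star> * b)"
    using h by (simp add: star_add star_mult star_scaleC algebra_simps mult_scaleC_left
        mult_scaleC_right scaleC_scaleC power2_eq_square scaleC_add_right)
  also have "norm \<dots> \<le> norm ((h * b)\<^sup>\<star> * (h * b)) + t\<^sup>2 * norm (b\<^sup>\<star> * b)"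
    by (rule norm_triangle_le) (simp add: norm_scaleC norm_power)
  also have "\<dots> \<le> (norm h * norm b)\<^sup>2 + t\<^sup>2 * (norm b)\<^sup>2"
    by (simp add: cstar_identity power_mono norm_mult_ineq)
  also have "\<dots> = (sqrt ((norm h)\<^sup>2 + t\<^sup>2) * norm b)\<^sup>2"
    by (simp add: power_mult_distrib algebra_simps)
  finally show ?thesis by (rule power2_le_imp_le) simp
qed

context commutative_subalgebra
begin

context
  fixes x assumes x: "x \<in> spectrum A"
begin

lemma char_zero: "x 0 = 0"
  using char_scale[OF x, of 0 0] by simp

lemma char_scaleR: "a \<in> A \<Longrightarrow> x (r *\<^sub>R a) = of_real r * x a"
  using char_scale[OF x, of a "of_real r"] by (simp add: scaleC_of_real)

lemma char_minus: "a \<in> A \<Longrightarrow> x (- a) = - x a"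
  using char_scale[OF x, of a "-1"] by simp

lemma char_diff: "a \<in> A \<Longrightarrow> b \<in> A \<Longrightarrow> x (a - b) = x a - x b"
  using char_add[OF x, of a "- b"] char_minus[of b] by simp

text \<open>If \<open>x a = 1\<close> and \<open>norm a < 1\<close>, then \<open>b = a + a * b\<close> has a solution, at which \<open>x\<close> gives
  \<open>x b = 1 + x b\<close>.\<close>

lemma char_contractive:
  assumes a: "a \<in> A" shows "cmod (x a) \<le> norm a"
proof (rule ccontr)
  assume "\<not> cmod (x a) \<le> norm a"
  then have gt: "norm a < cmod (x a)" by simp
  then have nz: "x a \<noteq> 0" by (metis norm_eq_zero norm_ge_zero not_le)
  define c where "c = inverse (x a) *\<^sub>C a"
  have c: "c \<in> A" "x c = 1" using a nz char_scale[OF x a] by (auto simp: c_def)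
  have nc: "norm c < 1"
    using gt nz by (simp add: c_def norm_scaleC norm_divide divide_inverse[symmetric] inverse_eq_divide)
  have "\<exists>!b. b \<in> A \<and> c + c * b = b"
  proof (rule Banach_fix[of A "norm c" "\<lambda>b. c + c * b"])
    show "complete A" using closed by (simp add: complete_eq_closed)
    show "A \<noteq> {}" using zero by auto
    show "(\<lambda>b. c + c * b) ` A \<subseteq> A" using c by auto
    show "dist (c + c * b) (c + c * d) \<le> norm c * dist b d" if "b \<in> A" "d \<in> A" for b d
      by (simp add: dist_norm norm_mult_ineq flip: right_diff_distrib)
  qed (use nc in auto)
  then obtain b where b: "b \<in> A" "c + c * b = b" by blast
  then have "x b = x c + x c * x b" using c char_add[OF x] char_mult[OF x] by (metis mult)
  then show False using c by simp
qed

text \<open>The bound \<open>cmod (x h + i t) \<le> norm (h + i t)\<close> is immediate when \<open>h + i t\<close> makes sense.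
  Here \<open>h + i t\<close> is the operator \<open>T\<close>; its powers act on an element \<open>k\<close> with \<open>x k \<noteq> 0\<close>, and
  the factor \<open>norm k / cmod (x k)\<close> disappears in the limit of \<open>n\<close>-th roots.\<close>

lemma char_selfadjoint_real:
  assumes h: "h \<in> A" "h\<^sup>\<star> = h" shows "Im (x h) = 0"
proof -
  obtain k where k: "k \<in> A" "x k \<noteq> 0" using char_nonzero[OF x] by blast
  have bound: "cmod (x h + \<i> * of_real t) \<le> sqrt ((norm h)\<^sup>2 + t\<^sup>2)" for t
  proof (rule le_if_powers_bounded[of "cmod (x k)" _ _ "norm k"])
    define T where "T b = h * b + (\<i> * of_real t) *\<^sub>C b" for b
    have TA: "(T ^^ n) k \<in> A" for n by (induction n) (use h k in \<open>auto simp: T_def\<close>)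
    have nT: "norm (T b) \<le> sqrt ((norm h)\<^sup>2 + t\<^sup>2) * norm b" for b
      unfolding T_def by (rule norm_selfadjoint_add_imaginary[OF h(2)])
    fix n
    have "x ((T ^^ n) k) = (x h + \<i> * of_real t) ^ n * x k"
    proof (induction n)
      case (Suc n)
      have "x (T ((T ^^ n) k)) = (x h + \<i> * of_real t) * x ((T ^^ n) k)"
        using TA[of n] h char_add[OF x] char_mult[OF x] char_scale[OF x]
        by (simp add: T_def algebra_simps)
      then show ?case using Suc by simp
    qed simp
    then have "cmod (x h + \<i> * of_real t) ^ n * cmod (x k) = cmod (x ((T ^^ n) k))"
      by (simp add: norm_mult norm_power)
    also have "\<dots> \<le> norm ((T ^^ n) k)" by (rule char_contractive[OF TA])
    also have "\<dots> \<le> sqrt ((norm h)\<^sup>2 + t\<^sup>2) ^ n * norm k"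
    proof (induction n)
      case (Suc n)
      have "norm ((T ^^ Suc n) k) \<le> sqrt ((norm h)\<^sup>2 + t\<^sup>2) * norm ((T ^^ n) k)" using nT by simp
      also have "\<dots> \<le> sqrt ((norm h)\<^sup>2 + t\<^sup>2) * (sqrt ((norm h)\<^sup>2 + t\<^sup>2) ^ n * norm k)"
        using Suc by (intro mult_left_mono) auto
      finally show ?case by (simp add: mult.assoc)
    qed simp
    finally show "cmod (x h + \<i> * of_real t) ^ n * cmod (x k) \<le> sqrt ((norm h)\<^sup>2 + t\<^sup>2) ^ n * norm k" .
  qed (use k in auto)
  show ?thesis
  proof (rule Im_zero_if_quadratic_bound)
    show "(cmod (x h + \<i> * of_real t))\<^sup>2 \<le> (norm h)\<^sup>2 + t\<^sup>2" for t
      using power_mono[OF bound[of t], of 2] by simp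
  qed
qed

lemma char_selfadjoint: "h \<in> A \<Longrightarrow> h\<^sup>\<star> = h \<Longrightarrow> x h = of_real (Re (x h))"
  using char_selfadjoint_real by (simp add: complex_eq_iff)

lemma char_star: assumes a: "a \<in> A" shows "x (a\<^sup>\<star>) = cnj (x a)"
proof -
  have "Im (x (a + a\<^sup>\<star>)) = 0"
    using a by (intro char_selfadjoint_real) (auto simp: star_add star_star add.commute)
  moreover have "Im (x (\<i> *\<^sub>C (a - a\<^sup>\<star>))) = 0"
    using a by (intro char_selfadjoint_real)
      (auto simp: star_diff star_star star_scaleC complex_vector.scale_right_diff_distrib
        complex_vector.scale_minus_left)
  ultimately show ?thesis using a char_add[OF x] char_scale[OF x] char_diff
    by (simp add: complex_eq_iff)
qed

lemma char_star_self: "a \<in> A \<Longrightarrow> x (a\<^sup>\<star> * a) = of_real ((cmod (x a))\<^sup>2)"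
  using char_mult[OF x, of "a\<^sup>\<star>" a] char_star[of a]
  by (simp add: complex_norm_square mult.commute flip: of_real_power)

end

lemma norm_cstar_seminorm: "cstar_seminorm_on A norm"
  unfolding cstar_seminorm_on_def
  by (auto simp: norm_triangle_ineq norm_scaleC norm_mult_ineq cstar_identity)

lemma norm_attained:
  assumes "a \<in> A" "a \<noteq> 0" obtains x where "x \<in> spectrum A" "cmod (x a) = norm a"
  using exists_character[OF norm_cstar_seminorm assms(1)] assms(2) by auto

lemma norm_le_char:
  assumes "a \<in> A" "0 \<le> r" "\<And>x. x \<in> spectrum A \<Longrightarrow> cmod (x a) \<le> r" shows "norm a \<le> r"
proof (cases "a = 0")
  case False
  then obtain x where "x \<in> spectrum A" "cmod (x a) = norm a" using norm_attained[OF assms(1)] by blast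
  then show ?thesis using assms(3) by metis
qed (use assms in simp)

lemma eq_char:
  assumes "a \<in> A" "b \<in> A" "\<And>x. x \<in> spectrum A \<Longrightarrow> x a = x b" shows "a = b"
proof -
  have "norm (a - b) \<le> 0" using assms by (intro norm_le_char) (auto simp: char_diff)
  then show ?thesis by simp
qed

text \<open>Polynomials without constant term can be evaluated in an algebra without unit. Their uniform
  limits on a neighbourhood of \<open>0\<close> are the continuous functions vanishing at \<open>0\<close>, and uniform
  convergence on the values of \<open>h\<close> is convergence in norm because characters compute the norm.\<close>

lemma polynomial_calculus:
  assumes h: "h \<in> A"
  shows "\<exists>k\<in>A. \<forall>x\<in>spectrum A. x k = (\<Sum>i\<le>n. of_real (a i) * x h ^ Suc i)"
proof -
  have pow: "\<exists>k\<in>A. \<forall>x\<in>spectrum A. x k = x h ^ Suc i" for i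
  proof (induction i)
    case (Suc i)
    then obtain k where "k \<in> A" "\<forall>x\<in>spectrum A. x k = x h ^ Suc i" by blast
    then show ?case using h by (intro bexI[of _ "h * k"]) (auto simp: char_mult)
  qed (use h in auto)
  show ?thesis
  proof (induction n)
    case 0
    show ?case using pow[of 0] h by (intro bexI[of _ "a 0 *\<^sub>R h"]) (auto simp: char_scaleR)
  next
    case (Suc n)
    then obtain k where k: "k \<in> A" "\<forall>x\<in>spectrum A. x k = (\<Sum>i\<le>n. of_real (a i) * x h ^ Suc i)"
      by blast
    obtain l where l: "l \<in> A" "\<forall>x\<in>spectrum A. x l = x h ^ Suc (Suc n)" using pow by blast
    show ?case using k l
      by (intro bexI[of _ "k + a (Suc n) *\<^sub>R l"]) (auto simp: char_add char_scaleR)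
  qed
qed

lemma functional_calculus:
  assumes h: "h \<in> A" "h\<^sup>\<star> = h" and f: "continuous_on UNIV f" "f 0 = 0"
  obtains k where "k \<in> A" "k\<^sup>\<star> = k" "\<And>x. x \<in> spectrum A \<Longrightarrow> x k = of_real (f (Re (x h)))"
proof -
  define M where "M = norm h"
  have xh: "Re (x h) \<in> {-M..M}" if "x \<in> spectrum A" for x
    using char_contractive[OF that h(1)] abs_Re_le_cmod[of "x h"] by (auto simp: M_def)
  have ex: "\<exists>k\<in>A. \<forall>x\<in>spectrum A. cmod (x k - of_real (f (Re (x h)))) \<le> e" if e: "e > 0" for e
  proof -
    obtain p where p: "real_polynomial_function p" "\<And>t. t \<in> {-M..M} \<Longrightarrow> \<bar>f t - p t\<bar> < e / 2"
      using Stone_Weierstrass_real_polynomial_function[of "{-M..M}" f "e/2"] e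
        continuous_on_subset[OF f(1)] by auto
    obtain a n where pan: "p = (\<lambda>t. \<Sum>i\<le>n. a i * t ^ i)"
      using p(1) unfolding real_polynomial_function_iff_sum by blast
    have p0: "\<bar>p 0\<bar> < e / 2" using p(2)[of 0] f by (simp add: M_def)
    have split: "p t = p 0 + (\<Sum>i<n. a (Suc i) * t ^ Suc i)" for t
    proof -
      have "p t = a 0 + (\<Sum>i<n. a (Suc i) * t ^ Suc i)" for t
        unfolding pan by (simp add: sum.atMost_shift)
      from this[of t] this[of 0] show ?thesis by simp
    qed
    show ?thesis
    proof (cases n)
      case 0
      have "cmod (x 0 - of_real (f (Re (x h)))) \<le> e" if "x \<in> spectrum A" for x
      proof -
        have "\<bar>f (Re (x h))\<bar> \<le> e"
          using p(2)[OF xh[OF that]] split[of "Re (x h)"] p0 abs_triangle_ineq[of "f (Re (x h)) - p 0" "p 0"]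
          unfolding 0 by simp
        then show ?thesis using char_zero[OF that] by simp
      qed
      then show ?thesis by blast
    next
      case (Suc m)
      obtain k where k: "k \<in> A" "\<forall>x\<in>spectrum A. x k = (\<Sum>i\<le>m. of_real (a (Suc i)) * x h ^ Suc i)"
        using polynomial_calculus[OF h(1), where n=m and a="\<lambda>i. a (Suc i)"] by blast
      have "cmod (x k - of_real (f (Re (x h)))) \<le> e" if x: "x \<in> spectrum A" for x
      proof -
        have "x k = (\<Sum>i\<le>m. of_real (a (Suc i) * Re (x h) ^ Suc i))"
        proof -
          define t where "t = Re (x h)"
          have xt: "x h = of_real t" using char_selfadjoint[OF x h] by (simp add: t_def)
          show ?thesis using bspec[OF k(2) x] by (simp add: xt)
        qed
        also have "\<dots> = of_real (p (Re (x h)) - p 0)"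
          using split[of "Re (x h)"] by (simp add: Suc lessThan_Suc_atMost)
        finally have "x k - of_real (f (Re (x h))) = of_real ((p (Re (x h)) - f (Re (x h))) - p 0)"
          by simp
        then show ?thesis using p(2)[OF xh[OF x]] p0 by (simp only: norm_of_real)
      qed
      then show ?thesis using k(1) by blast
    qed
  qed
  have "\<forall>n. \<exists>k\<in>A. \<forall>x\<in>spectrum A. cmod (x k - of_real (f (Re (x h)))) \<le> inverse (real (Suc n))"
    using ex by simp
  then obtain k where kA: "\<And>n. k n \<in> A"
    and k: "\<And>n x. x \<in> spectrum A \<Longrightarrow> cmod (x (k n) - of_real (f (Re (x h)))) \<le> inverse (real (Suc n))"
    by metis
  have diff: "norm (k m - k n) \<le> inverse (real (Suc m)) + inverse (real (Suc n))" for m n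
  proof (rule norm_le_char)
    fix x assume x: "x \<in> spectrum A"
    have "x (k m - k n) = (x (k m) - of_real (f (Re (x h)))) - (x (k n) - of_real (f (Re (x h))))"
      using kA by (simp add: char_diff[OF x])
    then show "cmod (x (k m - k n)) \<le> inverse (real (Suc m)) + inverse (real (Suc n))"
      using norm_triangle_ineq4 k[OF x, of m] k[OF x, of n] by (smt (verit))
  qed (use kA in auto)
  have "Cauchy k"
  proof (rule metric_CauchyI)
    fix e :: real assume "e > 0"
    then obtain N where N: "inverse (real (Suc N)) < e / 2" using reals_Archimedean[of "e/2"] by auto
    have "dist (k m) (k n) < e" if "m \<ge> N" "n \<ge> N" for m n
    proof -
      have "inverse (real (Suc m)) \<le> inverse (real (Suc N))" "inverse (real (Suc n)) \<le> inverse (real (Suc N))"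
        using that by (auto intro: le_imp_inverse_le)
      then show ?thesis unfolding dist_norm using diff[of m n] N by linarith
    qed
    then show "\<exists>M. \<forall>m\<ge>M. \<forall>n\<ge>M. dist (k m) (k n) < e" by blast
  qed
  then obtain l where l: "k \<longlonglongrightarrow> l" using Cauchy_convergent convergent_def by blast
  have lA: "l \<in> A" using closed_sequentially[OF closed _ l] kA by blast
  have xl: "x l = of_real (f (Re (x h)))" if x: "x \<in> spectrum A" for x
  proof -
    have "(\<lambda>n. x (k n) - x l) \<longlonglongrightarrow> 0"
    proof (rule Lim_null_comparison)
      show "\<forall>\<^sub>F n in sequentially. cmod (x (k n) - x l) \<le> norm (k n - l)"
        using char_contractive[OF x] kA lA by (auto simp flip: char_diff[OF x])
      show "(\<lambda>n. norm (k n - l)) \<longlonglongrightarrow> 0" using l by (simp add: LIM_zero tendsto_norm_zero)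
    qed
    then have "(\<lambda>n. x (k n)) \<longlonglongrightarrow> x l" by (rule LIM_zero_cancel)
    moreover have "(\<lambda>n. x (k n) - of_real (f (Re (x h)))) \<longlonglongrightarrow> 0"
      by (rule Lim_null_comparison[OF _ LIMSEQ_inverse_real_of_nat]) (use k[OF x] in auto)
    then have "(\<lambda>n. x (k n)) \<longlonglongrightarrow> of_real (f (Re (x h)))" by (rule LIM_zero_cancel)
    ultimately show ?thesis by (rule LIMSEQ_unique)
  qed
  have "l\<^sup>\<star> = l"
  proof (rule eq_char)
    show "x (l\<^sup>\<star>) = x l" if "x \<in> spectrum A" for x
      using xl[OF that] char_star[OF that lA] by simp
  qed (use lA in auto)
  then show ?thesis using that lA xl by blast
qed

end

section \<open>Positive elements\<close>

text \<open>A commutative algebra around a given self-adjoint element. The double commutant is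
  automatically closed, which the algebra of polynomials need not be.\<close>

definition bicommutant :: "'b::cstar_algebra \<Rightarrow> 'b set" where
  "bicommutant h = {a. \<forall>c. c * h = h * c \<longrightarrow> a * c = c * a}"

lemma self_in_bicommutant: "h \<in> bicommutant h"
  by (simp add: bicommutant_def)

lemma bicommutant_commutative:
  fixes h :: "'b::cstar_algebra"
  assumes h: "h\<^sup>\<star> = h" shows "commutative_star_subalgebra (bicommutant h)"
  unfolding commutative_star_subalgebra_def closed_star_subalgebra_def
proof (intro conjI ballI)
  let ?D = "bicommutant h"
  show "complex_vector.subspace ?D"
    by (rule complex_vector.subspaceI)
       (auto simp: bicommutant_def algebra_simps mult_scaleC_left mult_scaleC_right)
  have "?D = (\<Inter>c\<in>{c. c * h = h * c}. {a. a * c = c * a})" by (auto simp: bicommutant_def)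
  also have "closed \<dots>" by (intro closed_INT ballI closed_Collect_eq continuous_intros)
  finally show "closed ?D" .
  fix a assume a: "a \<in> ?D"
  have "a\<^sup>\<star> * c = c * a\<^sup>\<star>" if "c * h = h * c" for c
  proof -
    have "c\<^sup>\<star> * h = h * c\<^sup>\<star>" using arg_cong[OF that, of star] h by (simp add: star_mult)
    then have "a * c\<^sup>\<star> = c\<^sup>\<star> * a" using a by (simp add: bicommutant_def)
    from arg_cong[OF this, of star] show ?thesis by (simp add: star_mult star_star)
  qed
  then show "a\<^sup>\<star> \<in> ?D" by (simp add: bicommutant_def)
  fix b assume b: "b \<in> ?D"
  have "(a * b) * c = c * (a * b)" if "c * h = h * c" for c
  proof -
    have "b * c = c * b" "a * c = c * a" using a b that by (simp_all add: bicommutant_def)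
    then show ?thesis by (metis mult.assoc)
  qed
  then show "a * b \<in> ?D" by (simp add: bicommutant_def)
  have "b * h = h * b" using b by (simp add: bicommutant_def)
  then show "a * b = b * a" using a by (simp add: bicommutant_def)
qed

lemma in_commutative_subalgebra:
  fixes h :: "'b::cstar_algebra"
  assumes "h\<^sup>\<star> = h" obtains D where "commutative_subalgebra D" "h \<in> D"
  using that bicommutant_commutative[OF assms] self_in_bicommutant
  by (auto simp: commutative_subalgebra_def)

text \<open>In a unital algebra, a self-adjoint \<open>a\<close> is positive iff \<open>norm (K - a) \<le> K\<close> for some \<open>K\<close>.
  Reading \<open>K - a\<close> as a multiplication operator gives a form of this that makes sense without a unit
  and is visibly stable under sums.\<close>

definition is_positive :: "'b::cstar_algebra \<Rightarrow> bool" where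
  "is_positive a \<longleftrightarrow> a\<^sup>\<star> = a \<and> (\<exists>K\<ge>0. \<forall>c. norm (K *\<^sub>R c - a * c) \<le> K * norm c)"

lemma positive_selfadjoint: "is_positive a \<Longrightarrow> a\<^sup>\<star> = a"
  by (simp add: is_positive_def)

lemma positive_add: assumes "is_positive a" "is_positive b" shows "is_positive (a + b)"
proof -
  obtain K L where K: "K \<ge> 0" "\<And>c. norm (K *\<^sub>R c - a * c) \<le> K * norm c"
    and L: "L \<ge> 0" "\<And>c. norm (L *\<^sub>R c - b * c) \<le> L * norm c"
    using assms unfolding is_positive_def by metis
  have "norm ((K + L) *\<^sub>R c - (a + b) * c) \<le> (K + L) * norm c" for c
  proof -
    have eq: "(K + L) *\<^sub>R c - (a + b) * c = (K *\<^sub>R c - a * c) + (L *\<^sub>R c - b * c)"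
      by (simp add: algebra_simps)
    show ?thesis
      unfolding eq distrib_right[of K L "norm c"] using K(2)[of c] L(2)[of c] by (rule norm_triangle_mono)
  qed
  then show ?thesis using assms K L unfolding is_positive_def
    by (auto simp: star_add intro!: exI[of _ "K + L"])
qed

lemma positive_scaleR: assumes "is_positive a" "0 \<le> r" shows "is_positive (r *\<^sub>R a)"
proof -
  obtain K where K: "K \<ge> 0" "\<And>c. norm (K *\<^sub>R c - a * c) \<le> K * norm c"
    using assms unfolding is_positive_def by metis
  have "norm ((r * K) *\<^sub>R c - (r *\<^sub>R a) * c) \<le> (r * K) * norm c" for c
  proof -
    have "(r * K) *\<^sub>R c - (r *\<^sub>R a) * c = r *\<^sub>R (K *\<^sub>R c - a * c)" by (simp add: algebra_simps)
    then have "norm ((r * K) *\<^sub>R c - (r *\<^sub>R a) * c) = r * norm (K *\<^sub>R c - a * c)" using assms by simp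
    also have "\<dots> \<le> r * (K * norm c)" using K assms by (intro mult_left_mono) auto
    finally show ?thesis by (simp add: mult.assoc)
  qed
  then show ?thesis using assms K unfolding is_positive_def
    by (auto simp: star_scaleR intro!: exI[of _ "r * K"])
qed

context commutative_subalgebra
begin

text \<open>With \<open>s = sqrt (2 K a - a\<^sup>2)\<close> the elements \<open>(K - a) \<plusminus> i s\<close> are \<open>K\<close> times a unitary, and
  \<open>K - a\<close> is their mean.\<close>

lemma norm_complement_le:
  assumes a: "a \<in> A" "a\<^sup>\<star> = a" and K: "0 \<le> K"
    and range: "\<And>x. x \<in> spectrum A \<Longrightarrow> 0 \<le> Re (x a) \<and> Re (x a) \<le> 2 * K"
  shows "norm (K *\<^sub>R c - a * c) \<le> K * norm c"
proof -
  obtain s where s: "s \<in> A" "s\<^sup>\<star> = s"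
    and xs: "\<And>x. x \<in> spectrum A \<Longrightarrow> x s = of_real (sqrt (max 0 (Re (x a) * (2 * K - Re (x a)))))"
    by (rule functional_calculus[OF a, of "\<lambda>t. sqrt (max 0 (t * (2 * K - t)))"])
       (auto intro!: continuous_intros)
  have ss: "s * s = (2 * K) *\<^sub>R a - a * a"
  proof (rule eq_char)
    fix x assume x: "x \<in> spectrum A"
    define t where "t = Re (x a)"
    have xa: "x a = of_real t" using char_selfadjoint[OF x a] by (simp add: t_def)
    have t: "0 \<le> t * (2 * K - t)" using range[OF x] by (simp add: t_def)
    have "x (s * s) = of_real (sqrt (max 0 (t * (2 * K - t))) * sqrt (max 0 (t * (2 * K - t))))"
      by (simp only: char_mult[OF x s(1) s(1)] xs[OF x] of_real_mult t_def)
    also have "\<dots> = of_real (t * (2 * K - t))" using t by simp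
    also have "\<dots> = x ((2 * K) *\<^sub>R a - a * a)"
      using a by (simp add: char_diff[OF x] char_mult[OF x] char_scaleR[OF x] xa algebra_simps)
    finally show "x (s * s) = x ((2 * K) *\<^sub>R a - a * a)" .
  qed (use a s in auto)
  have as: "a * s = s * a" using a s comm by simp
  have W: "norm ((K *\<^sub>R c - a * c) + u *\<^sub>C (s * c)) = K * norm c" if u: "cnj u * u = 1" "cnj u = - u" for u c
  proof -
    let ?W = "(K *\<^sub>R c - a * c) + u *\<^sub>C (s * c)"
    define m where "m = K *\<^sub>R c - a * c"
    define r where "r = s * c"
    have mm: "m\<^sup>\<star> * m = (K * K) *\<^sub>R (c\<^sup>\<star> * c) - c\<^sup>\<star> * ((2 * K) *\<^sub>R a - a * a) * c"
      using a unfolding mult_2[of K] scaleR_left_distrib[of K K]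
      by (simp add: m_def star_diff star_mult star_scaleR algebra_simps)
    have rr: "r\<^sup>\<star> * r = c\<^sup>\<star> * (s * s) * c" using s by (simp add: r_def star_mult mult.assoc)
    have mr: "m\<^sup>\<star> * r = c\<^sup>\<star> * (K *\<^sub>R s - a * s) * c"
      using a by (simp add: m_def r_def star_diff star_mult star_scaleR algebra_simps)
    have rm: "r\<^sup>\<star> * m = c\<^sup>\<star> * (K *\<^sub>R s - s * a) * c"
      using s by (simp add: m_def r_def star_mult algebra_simps)
    have "?W\<^sup>\<star> * ?W = m\<^sup>\<star> * m + (cnj u * u) *\<^sub>C (r\<^sup>\<star> * r) + u *\<^sub>C (m\<^sup>\<star> * r) + cnj u *\<^sub>C (r\<^sup>\<star> * m)"
      unfolding m_def[symmetric] r_def[symmetric]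
      by (simp add: star_add star_scaleC distrib_left distrib_right mult_scaleC_left mult_scaleC_right
          scaleC_scaleC scaleC_add_right mult.commute)
    also have "\<dots> = (K * K) *\<^sub>R (c\<^sup>\<star> * c)"
      unfolding u(1) mm rr mr rm ss as by (simp add: u(2) complex_vector.scale_minus_left)
    finally have "norm (?W\<^sup>\<star> * ?W) = (K * norm c)\<^sup>2"
      using K by (simp add: cstar_identity power_mult_distrib power2_eq_square)
    then have "(norm ?W)\<^sup>2 = (K * norm c)\<^sup>2" by (simp add: cstar_identity)
    then show ?thesis using K by (simp add: power2_eq_iff_nonneg)
  qed
  have "2 *\<^sub>R (K *\<^sub>R c - a * c) = ((K *\<^sub>R c - a * c) + \<i> *\<^sub>C (s * c)) + ((K *\<^sub>R c - a * c) + (-\<i>) *\<^sub>C (s * c))"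
    by (simp add: scaleR_2 complex_vector.scale_minus_left)
  then have "norm (2 *\<^sub>R (K *\<^sub>R c - a * c)) \<le> K * norm c + K * norm c"
    using norm_triangle_ineq[of "(K *\<^sub>R c - a * c) + \<i> *\<^sub>C (s * c)" "(K *\<^sub>R c - a * c) + (-\<i>) *\<^sub>C (s * c)"]
      W[of "\<i>" c] W[of "-\<i>" c] by simp
  then show ?thesis by simp
qed

lemma positive_if_char_nonneg:
  assumes a: "a \<in> A" "a\<^sup>\<star> = a" and pos: "\<And>x. x \<in> spectrum A \<Longrightarrow> 0 \<le> Re (x a)"
  shows "is_positive a"
proof -
  have "norm (norm a *\<^sub>R c - a * c) \<le> norm a * norm c" for c
  proof (rule norm_complement_le[OF a])
    fix x assume x: "x \<in> spectrum A"
    have "Re (x a) \<le> norm a" using char_contractive[OF x a(1)] complex_Re_le_cmod[of "x a"] by linarith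
    then show "0 \<le> Re (x a) \<and> Re (x a) \<le> 2 * norm a" using pos[OF x] by simp
  qed simp
  then show ?thesis using a unfolding is_positive_def by (intro conjI exI[of _ "norm a"]) auto
qed

text \<open>The inequality defining positivity is tested on a function of \<open>T\<close> that peaks at the value
  \<open>x T\<close>.\<close>

lemma char_le_if_positive_diff:
  assumes T: "T \<in> A" "T\<^sup>\<star> = T" and pos: "is_positive (q - T)" and x: "x \<in> spectrum A"
  shows "Re (x T) \<le> norm q"
proof (rule ccontr)
  assume less: "\<not> Re (x T) \<le> norm q"
  define m where "m = Re (x T)"
  have m: "m > 0" using less norm_ge_zero[of q] unfolding m_def by linarith
  obtain K where K: "K \<ge> 0" "\<And>c. norm (K *\<^sub>R c - (q - T) * c) \<le> K * norm c"
    using pos unfolding is_positive_def by metis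
  obtain c where c: "c \<in> A"
    and xc: "\<And>y. y \<in> spectrum A \<Longrightarrow> y c = of_real (max 0 (1 - \<bar>Re (y T) - m\<bar> / m))"
    by (rule functional_calculus[OF T, of "\<lambda>t. max 0 (1 - \<bar>t - m\<bar> / m)"])
       (use m in \<open>auto intro!: continuous_intros\<close>)
  have c1: "norm c \<le> 1" using c m by (intro norm_le_char) (auto simp: xc max_def)
  have "x c = 1" using xc[OF x] by (simp add: m_def)
  then have "x (K *\<^sub>R c + T * c) = of_real (K + m)"
    using T c char_selfadjoint[OF x T]
    by (simp add: char_add[OF x] char_mult[OF x] char_scaleR[OF x] m_def)
  then have "cmod (x (K *\<^sub>R c + T * c)) = \<bar>K + m\<bar>" by (simp only: norm_of_real)
  then have "K + m = cmod (x (K *\<^sub>R c + T * c))" using K(1) m by simp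
  also have "\<dots> \<le> norm (K *\<^sub>R c + T * c)" using T c by (intro char_contractive[OF x]) auto
  also have "K *\<^sub>R c + T * c = (K *\<^sub>R c - (q - T) * c) + q * c" by (simp add: algebra_simps)
  also have "norm \<dots> \<le> K * norm c + norm q * norm c"
    by (intro norm_triangle_mono K norm_mult_ineq)
  also have "\<dots> \<le> K * 1 + norm q * 1" using K c1 by (intro add_mono mult_left_mono) auto
  finally show False using less by (simp add: m_def)
qed

lemma char_nonneg_if_positive:
  assumes a: "a \<in> A" and pos: "is_positive a" and x: "x \<in> spectrum A"
  shows "0 \<le> Re (x a)"
  using char_le_if_positive_diff[of "- a" 0 x] a pos x positive_selfadjoint[OF pos]
  by (simp add: star_minus char_minus[OF x])

end

lemma positive_square_selfadjoint:
  assumes "s\<^sup>\<star> = s" shows "is_positive (s * s)"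
proof -
  obtain D where D: "commutative_subalgebra D" "s \<in> D" using in_commutative_subalgebra[OF assms] .
  interpret commutative_subalgebra D by (rule D)
  show ?thesis
  proof (rule positive_if_char_nonneg)
    fix x assume "x \<in> spectrum D"
    then show "0 \<le> Re (x (s * s))" using char_star_self[of x s] D assms by simp
  qed (use D assms in \<open>auto simp: star_mult\<close>)
qed

text \<open>Kaplansky's theorem. If \<open>h = b\<^sup>\<star> b\<close> had a negative part, cutting it out by \<open>y = b k\<close>
  with \<open>k\<close> in the algebra of \<open>h\<close> would give \<open>y\<^sup>\<star> y \<le> 0\<close>. As \<open>y\<^sup>\<star> y + y y\<^sup>\<star>\<close> is a sum of
  squares, \<open>y y\<^sup>\<star> \<ge> 0\<close>. The two have the same norm \<open>v\<close> and the element \<open>v y + y y\<^sup>\<star> y\<close> has square norm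
  at most \<open>v\<^sup>3\<close> computed from the left product and at least \<open>4 v\<^sup>3\<close> computed from the
  right one.\<close>

lemma positive_star_mult_self:
  fixes b :: "'b::cstar_algebra"
  shows "is_positive (b\<^sup>\<star> * b)"
proof -
  define h where "h = b\<^sup>\<star> * b"
  have hsa: "h\<^sup>\<star> = h" by (simp add: h_def star_mult star_star)
  obtain D where D: "commutative_subalgebra D" "h \<in> D" using in_commutative_subalgebra[OF hsa] .
  interpret D: commutative_subalgebra D by (rule D)
  obtain k where k: "k \<in> D" "k\<^sup>\<star> = k"
    and xk: "\<And>x. x \<in> spectrum D \<Longrightarrow> x k = of_real (max 0 (- Re (x h)))"
    by (rule D.functional_calculus[OF D(2) hsa, of "\<lambda>t. max 0 (- t)"]) (auto intro!: continuous_intros)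
  define y where "y = b * k"
  define N where "N = y\<^sup>\<star> * y"
  define P where "P = y * y\<^sup>\<star>"
  define v where "v = norm N"
  have N_khk: "N = k * h * k" using k by (simp add: N_def y_def h_def star_mult mult.assoc)
  have ND: "N \<in> D" and Nsa: "N\<^sup>\<star> = N" using k D by (auto simp: N_khk star_mult hsa mult.assoc)
  have Psa: "P\<^sup>\<star> = P" by (simp add: P_def star_mult star_star)
  have xN: "x N = of_real (Re (x h) * (max 0 (- Re (x h)))\<^sup>2)" if x: "x \<in> spectrum D" for x
    using k D(2) xk[OF x] D.char_selfadjoint[OF x D(2) hsa]
    by (simp add: N_khk D.char_mult[OF x] power2_eq_square)
  have neg: "Re (x N) \<le> 0" if x: "x \<in> spectrum D" for x
    using xN[OF x] by (simp add: max_def mult_nonpos_nonneg)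
  have "is_positive (- N)"
    using ND Nsa neg by (intro D.positive_if_char_nonneg) (auto simp: star_minus D.char_minus)
  moreover define S where "S = y + y\<^sup>\<star>"
  define T where "T = \<i> *\<^sub>C (y - y\<^sup>\<star>)"
  have "is_positive (S * S)" by (rule positive_square_selfadjoint) (simp add: S_def star_add star_star add.commute)
  moreover have "is_positive (T * T)"
    by (rule positive_square_selfadjoint)
       (simp add: T_def star_diff star_star star_scaleC complex_vector.scale_right_diff_distrib
         complex_vector.scale_minus_left)
  ultimately have "is_positive ((1/2) *\<^sub>R (S * S + T * T) + (- N))"
    by (intro positive_add positive_scaleR) auto
  moreover have "(1/2) *\<^sub>R (S * S + T * T) + (- N) = P"
  proof -
    have "S * S + T * T = 2 *\<^sub>R (P + N)"
      by (simp add: S_def T_def P_def N_def mult_scaleC_left mult_scaleC_right scaleC_scaleC scaleR_2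
          algebra_simps)
    then show ?thesis by simp
  qed
  ultimately have Ppos: "is_positive P" by simp
  have nP: "norm P = v" unfolding P_def v_def N_def by (simp add: cstar_identity cstar_identity')
  define z where "z = v *\<^sub>R y + y * N"
  have "norm (z\<^sup>\<star> * z) \<le> v ^ 3"
  proof -
    have zz: "z\<^sup>\<star> * z = (v * v) *\<^sub>R N + (2 * v) *\<^sub>R (N * N) + N * N * N"
      using Nsa by (simp add: z_def star_add star_scaleR star_mult algebra_simps scaleR_2 N_def
          star_star flip: scaleR_scaleR)
    show ?thesis unfolding zz
    proof (rule D.norm_le_char)
      fix x assume x: "x \<in> spectrum D"
      define t where "t = - Re (x N)"
      have xt: "x N = of_real (- t)" using D.char_selfadjoint[OF x ND Nsa] by (simp add: t_def)
      have t: "0 \<le> t" "t \<le> v"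
        using neg[OF x] D.char_contractive[OF x ND] abs_Re_le_cmod[of "x N"] by (auto simp: t_def v_def)
      have "x ((v * v) *\<^sub>R N + (2 * v) *\<^sub>R (N * N) + N * N * N) = of_real (- (t * (v - t)\<^sup>2))"
        using ND by (simp add: D.char_add[OF x] D.char_mult[OF x] D.char_scaleR[OF x] xt
            power2_eq_square algebra_simps)
      then have "cmod (x ((v * v) *\<^sub>R N + (2 * v) *\<^sub>R (N * N) + N * N * N)) = t * (v - t)\<^sup>2"
        using t by (simp only: norm_of_real) simp
      also have "\<dots> \<le> v * v\<^sup>2" using t by (intro mult_mono power_mono) auto
      finally show "cmod (x ((v * v) *\<^sub>R N + (2 * v) *\<^sub>R (N * N) + N * N * N)) \<le> v ^ 3"
        by (simp add: power3_eq_cube power2_eq_square)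
    qed (use ND in \<open>auto simp: v_def\<close>)
  qed
  moreover have "4 * v ^ 3 \<le> norm (z * z\<^sup>\<star>)"
  proof (cases "P = 0")
    case True
    then show ?thesis using nP by simp
  next
    case False
    obtain E where E: "commutative_subalgebra E" "P \<in> E" using in_commutative_subalgebra[OF Psa] .
    interpret E: commutative_subalgebra E by (rule E)
    obtain x where x: "x \<in> spectrum E" "cmod (x P) = norm P" using E.norm_attained[OF E(2) False] .
    have xP: "x P = of_real v"
      using E.char_selfadjoint[OF x(1) E(2) Psa] x(2) nP E.char_nonneg_if_positive[OF E(2) Ppos x(1)]
      by (metis abs_of_nonneg norm_of_real)
    have zP: "z = v *\<^sub>R y + P * y" by (simp add: z_def N_def P_def mult.assoc)
    have zz: "z * z\<^sup>\<star> = (v * v) *\<^sub>R P + (2 * v) *\<^sub>R (P * P) + P * P * P"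
      unfolding zP using Psa by (simp add: star_add star_scaleR star_mult algebra_simps scaleR_2 P_def
          star_star flip: scaleR_scaleR)
    have "x ((v * v) *\<^sub>R P + (2 * v) *\<^sub>R (P * P) + P * P * P) = of_real (4 * v ^ 3)"
      using E(2) by (simp add: E.char_add[OF x(1)] E.char_mult[OF x(1)] E.char_scaleR[OF x(1)] xP
          power3_eq_cube algebra_simps)
    then have "4 * v ^ 3 = cmod (x (z * z\<^sup>\<star>))" unfolding zz by (simp only: norm_of_real) (simp add: v_def)
    also have "\<dots> \<le> norm (z * z\<^sup>\<star>)" unfolding zz using E(2) by (intro E.char_contractive[OF x(1)]) auto
    finally show ?thesis .
  qed
  moreover have "norm (z\<^sup>\<star> * z) = norm (z * z\<^sup>\<star>)" by (simp add: cstar_identity cstar_identity')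
  ultimately have "v ^ 3 \<le> 0" by linarith
  then have "v = 0" by (simp add: v_def power3_eq_cube zero_less_mult_iff mult_le_0_iff)
  then have N0: "N = 0" by (simp add: v_def)
  show "is_positive (b\<^sup>\<star> * b)"
    unfolding h_def[symmetric]
  proof (rule D.positive_if_char_nonneg[OF D(2) hsa])
    fix x assume x: "x \<in> spectrum D"
    show "0 \<le> Re (x h)" using xN[OF x] D.char_zero[OF x] unfolding N0 by (simp add: max_def split: if_splits)
  qed
qed

section \<open>Closed ideals\<close>

context
  fixes I :: "'b::cstar_algebra set" assumes I: "closed_ideal I"
begin

lemma ideal_closed: "closed I" and ideal_subspace: "complex_vector.subspace I"
  and ideal_left: "i \<in> I \<Longrightarrow> b * i \<in> I" and ideal_right: "i \<in> I \<Longrightarrow> i * b \<in> I"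
  using I unfolding closed_ideal_def by auto

lemma ideal_zero: "0 \<in> I" and ideal_add: "i \<in> I \<Longrightarrow> j \<in> I \<Longrightarrow> i + j \<in> I"
  and ideal_scaleC: "i \<in> I \<Longrightarrow> c *\<^sub>C i \<in> I"
  using ideal_subspace by (auto intro: complex_vector.subspace_0 complex_vector.subspace_add
      complex_vector.subspace_scale)

text \<open>An approximate unit of the ideal, adapted to one element: \<open>e = f (i\<^sup>\<star> i)\<close> with
  \<open>f t = t\<^sup>2 / (t\<^sup>2 + n\<^sup>2)\<close> and \<open>n = d\<^sup>2\<close>. As \<open>f t = t * g t\<close> with \<open>g 0 = 0\<close>, the element \<open>e\<close> is a multiple
  of \<open>i\<^sup>\<star> i\<close> and so lies in the ideal.\<close>

lemma ideal_approximate_unit: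
  assumes i: "i \<in> I" and d: "0 < d"
  obtains e where "e \<in> I" "e\<^sup>\<star> = e" "\<And>c. norm (c - e * c) \<le> norm c" "norm (i - i * e) \<le> d"
proof -
  define h where "h = i\<^sup>\<star> * i"
  define n where "n = d\<^sup>2"
  have n: "n > 0" using d by (simp add: n_def)
  have hsa: "h\<^sup>\<star> = h" by (simp add: h_def star_mult star_star)
  obtain D where D: "commutative_subalgebra D" "h \<in> D" using in_commutative_subalgebra[OF hsa] .
  interpret D: commutative_subalgebra D by (rule D)
  have den: "t\<^sup>2 + n\<^sup>2 > 0" for t using n by (simp add: add_nonneg_pos)
  then have den': "t\<^sup>2 + n\<^sup>2 \<noteq> 0" for t by (metis less_irrefl)
  obtain k where k: "k \<in> D" "k\<^sup>\<star> = k"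
    and xk: "\<And>x. x \<in> spectrum D \<Longrightarrow> x k = of_real (Re (x h) / ((Re (x h))\<^sup>2 + n\<^sup>2))"
    by (rule D.functional_calculus[OF D(2) hsa, of "\<lambda>t. t / (t\<^sup>2 + n\<^sup>2)"])
       (use den' in \<open>auto intro!: continuous_intros\<close>)
  define e where "e = h * k"
  have eD: "e \<in> D" using k D by (simp add: e_def)
  have esa: "e\<^sup>\<star> = e" using k D by (simp add: e_def star_mult hsa D.comm)
  have eI: "e \<in> I" unfolding e_def h_def by (intro ideal_left ideal_right i)
  have xh: "\<exists>t\<ge>0. x h = of_real t \<and> x e = of_real (t\<^sup>2 / (t\<^sup>2 + n\<^sup>2))" if x: "x \<in> spectrum D" for x
  proof (intro exI[of _ "Re (x h)"] conjI)
    show "0 \<le> Re (x h)" using D.char_nonneg_if_positive[OF D(2) _ x] positive_star_mult_self[of i] by (simp add: h_def)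
    show xh: "x h = of_real (Re (x h))" by (rule D.char_selfadjoint[OF x D(2) hsa])
    have "x e = x h * x k" using D.char_mult[OF x D(2) k(1)] by (simp add: e_def)
    also have "\<dots> = of_real (Re (x h)) * of_real (Re (x h) / ((Re (x h))\<^sup>2 + n\<^sup>2))"
      using xh xk[OF x] by metis
    finally show "x e = of_real ((Re (x h))\<^sup>2 / ((Re (x h))\<^sup>2 + n\<^sup>2))"
      by (simp add: power2_eq_square)
  qed
  have "norm (c - e * c) \<le> norm c" for c
  proof -
    have "norm (1 *\<^sub>R c - e * c) \<le> 1 * norm c"
    proof (rule D.norm_complement_le[OF eD esa])
      fix x assume "x \<in> spectrum D"
      then obtain t where "t \<ge> 0" "x e = of_real (t\<^sup>2 / (t\<^sup>2 + n\<^sup>2))" using xh by blast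
      moreover have "0 \<le> t\<^sup>2 / (t\<^sup>2 + n\<^sup>2)" "t\<^sup>2 / (t\<^sup>2 + n\<^sup>2) \<le> 1" for t
        using den[of t] by (simp_all add: divide_le_eq_1)
      ultimately show "0 \<le> Re (x e) \<and> Re (x e) \<le> 2 * 1" by (smt (verit) Re_complex_of_real)
    qed simp
    then show ?thesis by simp
  qed
  moreover have "norm (i - i * e) \<le> d"
  proof -
    have sq: "(i - i * e)\<^sup>\<star> * (i - i * e) = h - h * e - e * h + e * h * e"
      using esa by (simp add: h_def star_diff star_mult algebra_simps)
    have bound: "norm (h - h * e - e * h + e * h * e) \<le> n"
    proof (rule D.norm_le_char)
      fix x assume x: "x \<in> spectrum D"
      then obtain t where t: "t \<ge> 0" "x h = of_real t" "x e = of_real (t\<^sup>2 / (t\<^sup>2 + n\<^sup>2))" using xh by blast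
      define s where "s = n\<^sup>2 / (t\<^sup>2 + n\<^sup>2)"
      have s: "t\<^sup>2 / (t\<^sup>2 + n\<^sup>2) = 1 - s" using den'[of t] by (simp add: s_def field_simps)
      have xe: "x e = of_real (1 - s)" using t(3) s by simp
      have xeq: "x (h - h * e - e * h + e * h * e) = of_real (t * s * s)"
        using D(2) eD by (simp add: D.char_add[OF x] D.char_diff[OF x] D.char_mult[OF x] t(2) xe algebra_simps)
      have s01: "0 \<le> s" "s \<le> 1" using den[of t] by (simp_all add: s_def divide_le_eq_1)
      have ts: "t * s \<le> n"
      proof -
        have "t * n \<le> t\<^sup>2 + n\<^sup>2" using mult_nonneg_nonneg[of t n] t(1) n sum_squares_bound[of t n] by linarith
        then have "t * n * n \<le> (t\<^sup>2 + n\<^sup>2) * n" using n by (intro mult_right_mono) auto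
        then show ?thesis using den[of t] by (simp add: s_def pos_divide_le_eq power2_eq_square algebra_simps)
      qed
      have le: "t * s * s \<le> n * 1" using ts s01 n by (intro mult_mono) auto
      have nn: "0 \<le> t * s * s" using t(1) s01 by simp
      have "cmod (x (h - h * e - e * h + e * h * e)) = \<bar>t * s * s\<bar>" unfolding xeq by (rule norm_of_real)
      also have "\<dots> = t * s * s" using nn by (rule abs_of_nonneg)
      also have "\<dots> \<le> n" using le by simp
      finally show "cmod (x (h - h * e - e * h + e * h * e)) \<le> n" .
    qed (use D(2) eD n in auto)
    have "(norm (i - i * e))\<^sup>2 \<le> d\<^sup>2"
      unfolding n_def[symmetric] cstar_identity[symmetric] sq by (rule bound)
    then show ?thesis using d by (rule power2_le_imp_le[OF _ less_imp_le])
  qed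
  ultimately show ?thesis using that eI esa by blast
qed

lemma infdist_ideal_less:
  assumes "infdist b I < r" obtains i where "i \<in> I" "norm (b - i) < r"
proof -
  have "I \<noteq> {}" using ideal_zero by auto
  then have "(INF a\<in>I. dist b a) < r" using assms by (simp add: infdist_notempty)
  moreover have "bdd_below ((\<lambda>a. dist b a) ` I)" by (intro bdd_belowI2[where m=0]) simp
  ultimately have "\<exists>a\<in>I. dist b a < r" using \<open>I \<noteq> {}\<close> cINF_less_iff by metis
  then show ?thesis using that by (auto simp: dist_norm)
qed

lemma infdist_ideal_le: "i \<in> I \<Longrightarrow> infdist b I \<le> norm (b - i)"
  using infdist_le[of i I b] by (simp add: dist_norm)

lemma infdist_ideal_zero: "infdist b I = 0 \<longleftrightarrow> b \<in> I"
  using in_closed_iff_infdist_zero[OF ideal_closed] ideal_zero by auto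

lemma infdist_ideal_add: "infdist (a + b) I \<le> infdist a I + infdist b I"
proof (rule field_le_epsilon)
  fix e :: real assume "e > 0"
  obtain i where i: "i \<in> I" "norm (a - i) < infdist a I + e/2"
    using infdist_ideal_less[of a "infdist a I + e/2"] \<open>e > 0\<close> by auto
  obtain j where j: "j \<in> I" "norm (b - j) < infdist b I + e/2"
    using infdist_ideal_less[of b "infdist b I + e/2"] \<open>e > 0\<close> by auto
  have "infdist (a + b) I \<le> norm ((a - i) + (b - j))"
    using infdist_ideal_le[of "i + j" "a + b"] ideal_add i j by (simp add: algebra_simps)
  also have "\<dots> \<le> norm (a - i) + norm (b - j)" by (rule norm_triangle_ineq)
  finally show "infdist (a + b) I \<le> infdist a I + infdist b I + e" using i j by simp
qed

lemma infdist_ideal_scaleC: "infdist (c *\<^sub>C a) I = cmod c * infdist a I"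
proof (rule scaleC_homogeneous[where S = UNIV])
  fix l b
  show "infdist (l *\<^sub>C b) I \<le> cmod l * infdist b I"
  proof (rule le_mult_if_approx)
    fix e :: real assume "0 < e"
    then obtain i where i: "i \<in> I" "norm (b - i) < infdist b I + e"
      using infdist_ideal_less[of b "infdist b I + e"] by auto
    have "infdist (l *\<^sub>C b) I \<le> norm (l *\<^sub>C (b - i))"
      using infdist_ideal_le[OF ideal_scaleC[OF i(1), of l], of "l *\<^sub>C b"]
      by (simp add: complex_vector.scale_right_diff_distrib)
    then show "\<exists>s. s < infdist b I + e \<and> infdist (l *\<^sub>C b) I \<le> cmod l * s"
      using i(2) by (auto simp: norm_scaleC)
  qed simp
qed (auto simp: infdist_nonneg)

lemma infdist_ideal_mult: "infdist (a * b) I \<le> infdist a I * infdist b I"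
proof -
  have "infdist (a * b) I \<le> (infdist a I + e) * (infdist b I + e)" if e: "e > 0" for e
  proof -
    obtain i where i: "i \<in> I" "norm (a - i) < infdist a I + e"
      using infdist_ideal_less[of a "infdist a I + e"] e by auto
    obtain j where j: "j \<in> I" "norm (b - j) < infdist b I + e"
      using infdist_ideal_less[of b "infdist b I + e"] e by auto
    have "a * j + i * (b - j) \<in> I" by (intro ideal_add ideal_left ideal_right i j)
    then have "infdist (a * b) I \<le> norm (a * b - (a * j + i * (b - j)))" by (rule infdist_ideal_le)
    also have "a * b - (a * j + i * (b - j)) = (a - i) * (b - j)" by (simp add: algebra_simps)
    also have "norm \<dots> \<le> norm (a - i) * norm (b - j)" by (rule norm_mult_ineq)
    also have "\<dots> \<le> (infdist a I + e) * (infdist b I + e)"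
      using i j e infdist_nonneg[of a I] by (intro mult_mono) auto
    finally show ?thesis .
  qed
  then show ?thesis by (rule le_mult_if_le_mult_add)
qed

text \<open>For \<open>i\<close> in the ideal close to \<open>b\<^sup>\<star> b\<close>, multiplying \<open>b\<^sup>\<star> b - i\<close> on both sides by \<open>1 - e\<close> does
  not increase its norm, nearly removes \<open>i\<close>, and leaves \<open>(b - b e)\<^sup>\<star> (b - b e)\<close>.\<close>

lemma infdist_ideal_cstar_le: "(infdist b I)\<^sup>2 \<le> infdist (b\<^sup>\<star> * b) I"
proof (rule field_le_epsilon)
  fix d :: real assume d: "d > 0"
  obtain i where i: "i \<in> I" "norm (b\<^sup>\<star> * b - i) < infdist (b\<^sup>\<star> * b) I + d/2"
    using infdist_ideal_less[of "b\<^sup>\<star> * b" "infdist (b\<^sup>\<star> * b) I + d/2"] d by auto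
  obtain e where e: "e \<in> I" "e\<^sup>\<star> = e" "\<And>c. norm (c - e * c) \<le> norm c" "norm (i - i * e) \<le> d / 2"
    using ideal_approximate_unit[OF i(1), of "d/2"] d by auto
  have right: "norm (c - c * e) \<le> norm c" for c
    using e(3)[of "c\<^sup>\<star>"] norm_star[of "c - c * e"] by (simp add: star_diff star_mult e(2) norm_star)
  have "infdist b I \<le> norm (b - b * e)" by (intro infdist_ideal_le ideal_left e)
  then have "(infdist b I)\<^sup>2 \<le> (norm (b - b * e))\<^sup>2" by (intro power_mono infdist_nonneg)
  also have "\<dots> = norm ((b\<^sup>\<star> * b - b\<^sup>\<star> * b * e) - e * (b\<^sup>\<star> * b - b\<^sup>\<star> * b * e))"
    using e(2) by (simp add: star_diff star_mult algebra_simps flip: cstar_identity)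
  also have "\<dots> \<le> norm (b\<^sup>\<star> * b - b\<^sup>\<star> * b * e)" by (rule e(3))
  also have "b\<^sup>\<star> * b - b\<^sup>\<star> * b * e = ((b\<^sup>\<star> * b - i) - (b\<^sup>\<star> * b - i) * e) + (i - i * e)"
    by (simp add: algebra_simps)
  also have "norm \<dots> \<le> norm (b\<^sup>\<star> * b - i) + d / 2"
    by (intro norm_triangle_mono right e)
  finally show "(infdist b I)\<^sup>2 \<le> infdist (b\<^sup>\<star> * b) I + d" using i by simp
qed

lemma infdist_ideal_cstar: "infdist (b\<^sup>\<star> * b) I = (infdist b I)\<^sup>2"
proof -
  have le: "infdist c I \<le> infdist (c\<^sup>\<star>) I" for c
  proof (cases "infdist c I = 0")
    case False
    then have "0 < infdist c I" using infdist_nonneg[of c I] by simp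
    moreover have "infdist c I * infdist c I \<le> infdist (c\<^sup>\<star>) I * infdist c I"
      using infdist_ideal_cstar_le[of c] infdist_ideal_mult[of "c\<^sup>\<star>" c] by (simp add: power2_eq_square)
    ultimately show ?thesis by simp
  qed (simp add: infdist_nonneg)
  have "infdist (b\<^sup>\<star>) I = infdist b I" using le[of b] le[of "b\<^sup>\<star>"] by (simp add: star_star)
  then show ?thesis using infdist_ideal_mult[of "b\<^sup>\<star>" b] infdist_ideal_cstar_le[of b]
    by (simp add: power2_eq_square)
qed

text \<open>The quotient norm is a C*-seminorm on \<open>A\<close>. Were it smaller than the norm at
  \<open>h = a\<^sup>\<star> a\<close>, a function of \<open>h\<close> living above that smaller value would be a nonzero element of
  \<open>A\<close> of seminorm zero.\<close>

lemma isometric_on_quotient: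
  assumes A: "commutative_subalgebra A" and triv: "I \<inter> A = {0}" and a: "a \<in> A"
  shows "infdist a I = norm a"
proof -
  interpret A: commutative_subalgebra A by (rule A)
  have q: "cstar_seminorm_on A (\<lambda>a. infdist a I)"
    unfolding cstar_seminorm_on_def
    by (simp add: infdist_nonneg infdist_ideal_add infdist_ideal_scaleC infdist_ideal_mult infdist_ideal_cstar)
  have le: "infdist b I \<le> norm b" for b using infdist_ideal_le[OF ideal_zero, of b] by simp
  have "\<not> infdist a I < norm a"
  proof
    assume less: "infdist a I < norm a"
    define h where "h = a\<^sup>\<star> * a"
    define r where "r = (infdist a I)\<^sup>2"
    have hA: "h \<in> A" and hsa: "h\<^sup>\<star> = h" using a by (simp_all add: h_def star_mult star_star)
    have qh: "infdist h I = r" by (simp add: h_def r_def infdist_ideal_cstar)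
    have r0: "0 \<le> r" by (simp add: r_def)
    obtain k where k: "k \<in> A" "k\<^sup>\<star> = k"
      and xk: "\<And>x. x \<in> spectrum A \<Longrightarrow> x k = of_real (max 0 (Re (x h) - r))"
      by (rule A.functional_calculus[OF hA hsa, of "\<lambda>t. max 0 (t - r)"])
         (use r0 in \<open>auto intro!: continuous_intros\<close>)
    have "infdist k I = 0"
    proof (rule ccontr)
      assume nz: "infdist k I \<noteq> 0"
      then have "infdist k I > 0" using infdist_nonneg[of k I] by linarith
      from A.exists_character[OF q k(1) this]
      obtain x where x: "x \<in> spectrum A" "\<And>b. b \<in> A \<Longrightarrow> cmod (x b) \<le> infdist b I"
        "cmod (x k) = infdist k I" by metis
      have "Re (x h) \<le> r" using x(2)[OF hA] qh complex_Re_le_cmod[of "x h"] by linarith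
      then show False using xk[OF x(1)] x(3) nz by simp
    qed
    then have "k = 0" using triv k infdist_ideal_zero by auto
    have "a \<noteq> 0" using less infdist_nonneg[of a I] by auto
    then obtain x where x: "x \<in> spectrum A" "cmod (x a) = norm a" using A.norm_attained[OF a] by blast
    have "x h = of_real ((norm a)\<^sup>2)" using A.char_star_self[OF x(1) a] x(2) by (simp add: h_def)
    then have "Re (x h) = (norm a)\<^sup>2" by (simp only: Re_complex_of_real)
    moreover have "r < (norm a)\<^sup>2" unfolding r_def using less infdist_nonneg[of a I] by (intro power_strict_mono) auto
    moreover have "Re (x k) = max 0 (Re (x h) - r)" using xk[OF x(1)] by (simp only: Re_complex_of_real)
    ultimately have "Re (x k) \<noteq> 0" by simp
    then have "x k \<noteq> 0" by auto
    then show False using A.char_zero[OF x(1)] \<open>k = 0\<close> by simp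
  qed
  then show ?thesis using le[of a] by simp
qed

end

section \<open>Closed linear spans\<close>

lemma subspace_closure:
  fixes S :: "'b::cstar_algebra set"
  assumes S: "complex_vector.subspace S" shows "complex_vector.subspace (closure S)"
proof (rule complex_vector.subspaceI)
  show "0 \<in> closure S" using complex_vector.subspace_0[OF S] closure_subset by auto
next
  fix a b assume "a \<in> closure S" "b \<in> closure S"
  then obtain f g where f: "\<And>n. f n \<in> S" "f \<longlonglongrightarrow> a" and g: "\<And>n. g n \<in> S" "g \<longlonglongrightarrow> b"
    unfolding closure_sequential by metis
  have "(\<lambda>n. f n + g n) \<longlonglongrightarrow> a + b" using f g by (intro tendsto_add)
  moreover have "f n + g n \<in> S" for n using complex_vector.subspace_add[OF S f(1) g(1)] .
  ultimately show "a + b \<in> closure S" unfolding closure_sequential by (intro exI[of _ "\<lambda>n. f n + g n"]) simp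
next
  fix c a assume "a \<in> closure S"
  then obtain f where f: "\<And>n. f n \<in> S" "f \<longlonglongrightarrow> a" unfolding closure_sequential by metis
  have "(\<lambda>n. c *\<^sub>C f n) \<longlonglongrightarrow> c *\<^sub>C a" using f(2) by (rule tendsto_scaleC)
  moreover have "c *\<^sub>C f n \<in> S" for n using complex_vector.subspace_scale[OF S f(1)] .
  ultimately show "c *\<^sub>C a \<in> closure S" unfolding closure_sequential by (intro exI[of _ "\<lambda>n. c *\<^sub>C f n"]) simp
qed

lemma subspace_closed_span: "complex_vector.subspace (closed_span S)"
  unfolding closed_span_def by (intro subspace_closure complex_vector.subspace_span)

lemma closed_closed_span: "closed (closed_span S)"
  by (simp add: closed_span_def)

lemma closed_span_superset: "S \<subseteq> closed_span S"
  unfolding closed_span_def using complex_vector.span_superset closure_subset by blast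

lemma closed_span_minimal:
  "S \<subseteq> T \<Longrightarrow> complex_vector.subspace T \<Longrightarrow> closed T \<Longrightarrow> closed_span S \<subseteq> T"
  unfolding closed_span_def by (intro closure_minimal complex_vector.span_minimal)

lemma closed_prod_mem: "s \<in> S \<Longrightarrow> t \<in> T \<Longrightarrow> s * t \<in> S \<odot> T"
  unfolding closed_prod_def by (rule subsetD[OF closed_span_superset]) auto

lemma closed_prod_minimal:
  assumes "\<And>s t. s \<in> S \<Longrightarrow> t \<in> T \<Longrightarrow> s * t \<in> K" "complex_vector.subspace K" "closed K"
  shows "S \<odot> T \<subseteq> K"
  unfolding closed_prod_def using assms by (intro closed_span_minimal) auto

lemma subspace_closed_prod: "complex_vector.subspace (S \<odot> T)" and closed_closed_prod: "closed (S \<odot> T)"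
  by (simp_all add: closed_prod_def subspace_closed_span closed_closed_span)

lemma closed_sum_minimal:
  assumes "S \<subseteq> K" "T \<subseteq> K" "complex_vector.subspace K" "closed K" shows "S \<oplus> T \<subseteq> K"
  unfolding closed_sum_def using assms by (intro closed_span_minimal) auto

lemma subspace_vimage_mult_left:
  "complex_vector.subspace K \<Longrightarrow> complex_vector.subspace {c. b * c \<in> (K :: 'b::cstar_algebra set)}"
  unfolding complex_vector.subspace_def by (simp add: distrib_left mult_scaleC_right)

lemma subspace_vimage_mult_right:
  "complex_vector.subspace K \<Longrightarrow> complex_vector.subspace {c. c * b \<in> (K :: 'b::cstar_algebra set)}"
  unfolding complex_vector.subspace_def by (simp add: distrib_right mult_scaleC_left)

lemma closed_vimage_mult_left: "closed K \<Longrightarrow> closed {c. b * c \<in> (K :: 'b::cstar_algebra set)}"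
  using continuous_closed_vimage[of K "\<lambda>c. b * c"] by (simp add: vimage_def)

lemma closed_vimage_mult_right: "closed K \<Longrightarrow> closed {c. c * b \<in> (K :: 'b::cstar_algebra set)}"
  using continuous_closed_vimage[of K "\<lambda>c. c * b"] by (simp add: vimage_def)

section \<open>Localization at a point of the spectrum\<close>

text \<open>The filter \<open>U\<close> is an approximate unit of the ambient algebra inside \<open>A\<close>.\<close>

locale abelian_inclusion = commutative_subalgebra A
  for A :: "'b::cstar_algebra set" +
  fixes U :: "'b filter"
  assumes U_ne: "U \<noteq> bot"
    and U_in: "\<forall>\<^sub>F u in U. u \<in> A \<and> u\<^sup>\<star> = u \<and> norm u \<le> 1"
    and U_left: "((\<lambda>u. u * b) \<longlongrightarrow> b) U" and U_right: "((\<lambda>u. b * u) \<longlongrightarrow> b) U"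

locale abelian_inclusion_point = abelian_inclusion A U
  for A :: "'b::cstar_algebra set" and U +
  fixes x assumes x: "x \<in> spectrum A"
begin

abbreviation "J \<equiv> kernel_ideal A x"
abbreviation "L \<equiv> kernel_sum A x"
abbreviation "C \<equiv> localizing_algebra A x"
abbreviation "H \<equiv> localizing_ideal A x"

lemma J_iff: "j \<in> J \<longleftrightarrow> j \<in> A \<and> x j = 0"
  by (simp add: kernel_ideal_def)

text \<open>Elements of \<open>A\<close> peaking at \<open>x\<close>. Compressing by them is localizing at \<open>x\<close>.\<close>

definition peaks :: "'b set" where
  "peaks = {v \<in> A. v\<^sup>\<star> = v \<and> norm v \<le> 1 \<and> x v = 1}"

lemma peakD: "v \<in> peaks \<Longrightarrow> v \<in> A" "v \<in> peaks \<Longrightarrow> v\<^sup>\<star> = v" "v \<in> peaks \<Longrightarrow> norm v \<le> 1"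
  "v \<in> peaks \<Longrightarrow> x v = 1"
  by (simp_all add: peaks_def)

lemma peak_contractive:
  assumes "v \<in> peaks" shows "norm (b * v) \<le> norm b" "norm (v * b) \<le> norm b"
  using norm_mult_ineq[of b v] norm_mult_ineq[of v b] peakD(3)[OF assms]
    mult_left_le[of "norm v" "norm b"] by (auto simp: mult.commute intro: order_trans)

lemma peak_mult: assumes "v \<in> peaks" "w \<in> peaks" shows "v * w \<in> peaks"
  using assms peak_contractive(1)[OF assms(2), of v] char_mult[OF x]
  by (auto simp: peaks_def star_mult comm intro: order_trans)

lemma truncate_to_peak:
  assumes h: "h \<in> A" "h\<^sup>\<star> = h" "x h = 1"
  obtains v where "v \<in> peaks" "\<And>y. y \<in> spectrum A \<Longrightarrow> Re (y h) \<le> 0 \<Longrightarrow> y v = 0"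
proof -
  obtain v where v: "v \<in> A" "v\<^sup>\<star> = v"
    and yv: "\<And>y. y \<in> spectrum A \<Longrightarrow> y v = of_real (max 0 (min (Re (y h)) 1))"
    by (rule functional_calculus[OF h(1,2), of "\<lambda>t. max 0 (min t 1)"]) (auto intro!: continuous_intros)
  have "norm v \<le> 1"
  proof (rule norm_le_char[OF v(1)])
    fix y assume "y \<in> spectrum A"
    then show "cmod (y v) \<le> 1" unfolding yv[OF \<open>y \<in> spectrum A\<close>] norm_of_real by simp
  qed simp
  moreover have "x v = 1" using yv[OF x] h(3) by simp
  ultimately have "v \<in> peaks" using v by (simp add: peaks_def)
  moreover have "y v = 0" if "y \<in> spectrum A" "Re (y h) \<le> 0" for y using yv[OF that(1)] that(2) by simp
  ultimately show ?thesis by (rule that)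
qed

lemma peak_exists: obtains v where "v \<in> peaks"
proof -
  obtain a where a: "a \<in> A" "x a \<noteq> 0" using char_nonzero[OF x] by blast
  define h where "h = inverse ((cmod (x a))\<^sup>2) *\<^sub>R (a\<^sup>\<star> * a)"
  have "h \<in> A" "h\<^sup>\<star> = h" using a by (auto simp: h_def star_scaleR star_mult star_star)
  moreover have "x h = of_real (inverse ((cmod (x a))\<^sup>2) * (cmod (x a))\<^sup>2)"
    using a by (simp only: h_def char_scaleR[OF x] mult star char_star_self[OF x] of_real_mult)
  then have "x h = 1" using a by simp
  ultimately show ?thesis using truncate_to_peak that by metis
qed

text \<open>The function \<open>v\<^sup>2 - (cmod j)\<^sup>2 / d\<^sup>2\<close> is \<open>1\<close> at \<open>x\<close> and at most \<open>0\<close> wherever the modulus of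
  \<open>j\<close> exceeds \<open>d\<close>, so its truncation vanishes there.\<close>

lemma peak_kills:
  assumes j: "j \<in> J" and d: "0 < d"
  obtains w where "w \<in> peaks" "norm (j * w) \<le> d"
proof -
  obtain v where v: "v \<in> peaks" by (rule peak_exists)
  have jA: "j \<in> A" "x j = 0" using j by (auto simp: J_iff)
  define h where "h = v * v - inverse (d\<^sup>2) *\<^sub>R (j\<^sup>\<star> * j)"
  have hA: "h \<in> A" "h\<^sup>\<star> = h" using peakD[OF v] jA by (auto simp: h_def star_diff star_mult star_scaleR star_star)
  have "x h = 1" using peakD[OF v] jA
    by (simp add: h_def char_diff[OF x] char_mult[OF x] char_scaleR[OF x])
  from truncate_to_peak[OF hA this] obtain w where w: "w \<in> peaks"
    and yw: "\<And>y. y \<in> spectrum A \<Longrightarrow> Re (y h) \<le> 0 \<Longrightarrow> y w = 0" by blast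
  have "norm (j * w) \<le> d"
  proof (rule norm_le_char)
    fix y assume y: "y \<in> spectrum A"
    have prod: "cmod (y (j * w)) = cmod (y j) * cmod (y w)"
      using jA peakD[OF w] by (simp add: char_mult[OF y] norm_mult)
    show "cmod (y (j * w)) \<le> d"
    proof (cases "cmod (y j) \<le> d")
      case True
      have "cmod (y w) \<le> 1" using char_contractive[OF y] peakD[OF w] order_trans by blast
      then show ?thesis unfolding prod using mult_mono[OF True, of "cmod (y w)" 1] d by simp
    next
      case False
      have "(cmod (y v))\<^sup>2 \<le> 1"
        using char_contractive[OF y] peakD[OF v] order_trans by (metis norm_ge_zero power_le_one)
      moreover have "1 \<le> inverse (d\<^sup>2) * (cmod (y j))\<^sup>2"
        using False d power_mono[of d "cmod (y j)" 2] by (simp add: field_simps)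
      moreover have "Re (y h) = (cmod (y v))\<^sup>2 - inverse (d\<^sup>2) * (cmod (y j))\<^sup>2"
      proof -
        have "y (v * v) = of_real ((cmod (y v))\<^sup>2)" using char_star_self[OF y, of v] peakD[OF v] by simp
        then have "y h = of_real ((cmod (y v))\<^sup>2 - inverse (d\<^sup>2) * (cmod (y j))\<^sup>2)"
          using peakD[OF v] jA char_star_self[OF y, of j]
          by (simp only: h_def char_diff[OF y] char_scaleR[OF y] mult star scaleR of_real_diff of_real_mult)
        then show ?thesis by (simp only: Re_complex_of_real)
      qed
      ultimately have "y w = 0" by (intro yw y) simp
      then show ?thesis unfolding prod using d by simp
    qed
  qed (use jA peakD[OF w] d in auto)
  then show ?thesis using that w by blast
qed

text \<open>This is the norm of the class of \<open>b\<close> in \<open>B / L\<close>: compressing by a peak does not change the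
  class and makes elements of \<open>L\<close> small. It is subadditive because peaks commute, so that two
  compressions can be combined.\<close>

definition local_norm :: "'b \<Rightarrow> real" where
  "local_norm b = (INF v\<in>peaks. norm (v * b * v))"

lemma local_norm_le: "v \<in> peaks \<Longrightarrow> local_norm b \<le> norm (v * b * v)"
  unfolding local_norm_def by (intro cINF_lower bdd_belowI2[where m=0]) auto

lemma local_norm_less: assumes "local_norm b < r" obtains v where "v \<in> peaks" "norm (v * b * v) < r"
proof -
  have "peaks \<noteq> {}" using peak_exists by blast
  moreover have "bdd_below ((\<lambda>v. norm (v * b * v)) ` peaks)" by (intro bdd_belowI2[where m=0]) simp
  ultimately have "\<exists>v\<in>peaks. norm (v * b * v) < r"
    using assms unfolding local_norm_def by (simp add: cINF_less_iff)
  then show ?thesis using that by blast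
qed

lemma local_norm_nonneg: "0 \<le> local_norm b"
  unfolding local_norm_def using peak_exists by (intro cINF_greatest) auto

lemma compress_le: assumes v: "v \<in> peaks" shows "norm (v * b * v) \<le> norm b"
  using peak_contractive[OF v] order_trans by blast

lemma compress_mult:
  assumes "v \<in> peaks" "w \<in> peaks"
  shows "(v * w) * b * (v * w) = w * (v * b * v) * w" "(v * w) * b * (v * w) = v * (w * b * w) * v"
proof -
  have vw: "v * w = w * v" using assms peakD comm by blast
  show "(v * w) * b * (v * w) = w * (v * b * v) * w" by (subst vw) (simp add: mult.assoc)
  show "(v * w) * b * (v * w) = v * (w * b * w) * v"
    by (subst (2) vw) (simp add: mult.assoc)
qed

lemma local_norm_le_norm: "local_norm b \<le> norm b"
  using peak_exists local_norm_le compress_le order_trans by metis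

lemma local_norm_add: "local_norm (b + c) \<le> local_norm b + local_norm c"
proof (rule field_le_epsilon)
  fix e :: real assume "e > 0"
  obtain v where v: "v \<in> peaks" "norm (v * b * v) < local_norm b + e/2"
    using local_norm_less[of b "local_norm b + e/2"] \<open>e > 0\<close> by auto
  obtain w where w: "w \<in> peaks" "norm (w * c * w) < local_norm c + e/2"
    using local_norm_less[of c "local_norm c + e/2"] \<open>e > 0\<close> by auto
  have "local_norm (b + c) \<le> norm ((v * w) * (b + c) * (v * w))" using v w by (intro local_norm_le peak_mult)
  also have "(v * w) * (b + c) * (v * w) = w * (v * b * v) * w + v * (w * c * w) * v"
    by (simp only: distrib_left distrib_right compress_mult(1)[OF v(1) w(1), of b] compress_mult(2)[OF v(1) w(1), of c])
  also have "norm \<dots> \<le> norm (v * b * v) + norm (w * c * w)"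
    using v w by (intro norm_triangle_mono compress_le)
  finally show "local_norm (b + c) \<le> local_norm b + local_norm c + e" using v w by simp
qed

lemma local_norm_scaleC: "local_norm (l *\<^sub>C b) = cmod l * local_norm b"
proof (rule scaleC_homogeneous[where S = UNIV])
  fix l b
  show "local_norm (l *\<^sub>C b) \<le> cmod l * local_norm b"
  proof (rule le_mult_if_approx)
    fix e :: real assume "0 < e"
    then obtain v where v: "v \<in> peaks" "norm (v * b * v) < local_norm b + e"
      using local_norm_less[of b "local_norm b + e"] by auto
    then show "\<exists>s. s < local_norm b + e \<and> local_norm (l *\<^sub>C b) \<le> cmod l * s"
      using local_norm_le[OF v(1), of "l *\<^sub>C b"]
      by (auto simp: mult_scaleC_left mult_scaleC_right norm_scaleC)
  qed simp
qed (auto simp: local_norm_nonneg)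

lemma sublinear_local_norm: "sublinear local_norm"
  unfolding sublinear_def using local_norm_add local_norm_scaleC[of "of_real _"]
  by (simp add: scaleC_of_real)

lemma local_norm_zeroI: assumes "\<And>d. 0 < d \<Longrightarrow> \<exists>v\<in>peaks. norm (v * b * v) \<le> d" shows "local_norm b = 0"
proof (rule antisym[OF field_le_epsilon local_norm_nonneg])
  fix e :: real assume "e > 0"
  then obtain v where "v \<in> peaks" "norm (v * b * v) \<le> e" using assms by blast
  then show "local_norm b \<le> 0 + e" using local_norm_le[of v b] by simp
qed

lemma local_norm_J: assumes j: "j \<in> J" shows "local_norm (j * b) = 0" "local_norm (b * j) = 0" "local_norm j = 0"
proof -
  have kill: "\<exists>w\<in>peaks. norm (w * (j * b) * w) \<le> d \<and> norm (w * (b * j) * w) \<le> d \<and> norm (w * j * w) \<le> d"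
    if d: "d > 0" for d
  proof -
    have p: "1 + norm b > 0" by (simp add: add_pos_nonneg)
    then obtain w where w: "w \<in> peaks" "norm (j * w) \<le> d / (1 + norm b)"
      using peak_kills[OF j, of "d / (1 + norm b)"] d by auto
    have wj: "w * j = j * w" using w j peakD comm J_iff by blast
    have "norm (j * w) * (1 + norm b) \<le> d" using w(2) unfolding pos_le_divide_eq[OF p] .
    then have small: "norm (j * w) + norm (j * w) * norm b \<le> d" by (simp add: distrib_left)
    have nn: "0 \<le> norm (j * w) * norm b" by simp
    have "norm (w * (j * b) * w) \<le> norm ((j * w) * b)"
      using peak_contractive(1)[OF w(1), of "w * (j * b)"] wj by (simp flip: mult.assoc)
    moreover have "norm (w * (b * j) * w) \<le> norm (b * (j * w))"
      using peak_contractive(2)[OF w(1), of "(b * j) * w"] by (simp add: mult.assoc)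
    moreover have "norm (w * j * w) \<le> norm (j * w)"
      using peak_contractive(2)[OF w(1), of "j * w"] by (simp add: mult.assoc)
    ultimately have "norm (w * (j * b) * w) \<le> d \<and> norm (w * (b * j) * w) \<le> d \<and> norm (w * j * w) \<le> d"
      using small nn norm_mult_ineq[of "j * w" b] norm_mult_ineq[of b "j * w"] norm_ge_zero[of "j * w"]
        mult.commute[of "norm b" "norm (j * w)"] by linarith
    then show ?thesis using w(1) by blast
  qed
  show "local_norm (j * b) = 0" by (rule local_norm_zeroI) (use kill in blast)
  show "local_norm (b * j) = 0" by (rule local_norm_zeroI) (use kill in blast)
  show "local_norm j = 0" by (rule local_norm_zeroI) (use kill in blast)
qed

lemma local_norm_ge_char: assumes a: "a \<in> A" shows "cmod (x a) \<le> local_norm a"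
  unfolding local_norm_def
proof (rule cINF_greatest)
  show "peaks \<noteq> {}" using peak_exists by blast
  fix v assume v: "v \<in> peaks"
  have "cmod (x a) = cmod (x (v * a * v))" using a peakD[OF v] by (simp add: char_mult[OF x])
  also have "\<dots> \<le> norm (v * a * v)" using a peakD[OF v] by (intro char_contractive[OF x]) auto
  finally show "cmod (x a) \<le> norm (v * a * v)" .
qed

lemma peak_diff_J: "a \<in> A \<Longrightarrow> v \<in> peaks \<Longrightarrow> a - x a *\<^sub>C v \<in> J"
  using peakD[of v] by (simp add: J_iff char_diff[OF x] char_scale[OF x])

lemma closed_local_null: "closed {b. local_norm b = 0}"
proof -
  have lip: "local_norm b \<le> local_norm c + norm (b - c)" for b c
    using local_norm_add[of c "b - c"] local_norm_le_norm[of "b - c"] by simp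
  have "continuous_on UNIV local_norm"
  proof (rule lipschitz_on_continuous_on[OF lipschitz_onI])
    show "dist (local_norm b) (local_norm c) \<le> 1 * dist b c" for b c
      using lip[of b c] lip[of c b] by (simp add: dist_norm norm_minus_commute abs_le_iff)
  qed simp
  then show ?thesis by (intro closed_Collect_eq) auto
qed

lemma subspace_local_null: "complex_vector.subspace {b. local_norm b = 0}"
proof (rule complex_vector.subspaceI)
  show "0 \<in> {b. local_norm b = 0}" using sublinear_zero[OF sublinear_local_norm] by simp
  fix b c assume "b \<in> {b. local_norm b = 0}" "c \<in> {b. local_norm b = 0}"
  then show "b + c \<in> {b. local_norm b = 0}"
    using local_norm_add[of b c] local_norm_nonneg[of "b + c"] by simp
qed (simp add: local_norm_scaleC)

text \<open>Along the approximate unit, \<open>v * c - c\<close> is the limit of \<open>(v * u - u) * c\<close>, and \<open>v * u - u\<close>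
  lies in \<open>J\<close>.\<close>

lemma cut_left:
  assumes v: "v \<in> peaks" and K: "closed K" "\<And>j. j \<in> J \<Longrightarrow> j * c \<in> K"
  shows "v * c - c \<in> K"
proof (rule Lim_in_closed_set[OF K(1) _ U_ne])
  show "((\<lambda>u. (v * u - u) * c) \<longlongrightarrow> v * c - c) U"
    using tendsto_diff[OF tendsto_mult_left[OF U_left[of c], of v] U_left[of c]]
    by (simp add: left_diff_distrib mult.assoc)
  show "\<forall>\<^sub>F u in U. (v * u - u) * c \<in> K"
    by (rule eventually_mono[OF U_in], rule K(2))
       (use peakD[OF v] in \<open>auto simp: J_iff char_diff[OF x] char_mult[OF x]\<close>)
qed

lemma cut_right:
  assumes v: "v \<in> peaks" and K: "closed K" "\<And>j. j \<in> J \<Longrightarrow> c * j \<in> K"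
  shows "c * v - c \<in> K"
proof (rule Lim_in_closed_set[OF K(1) _ U_ne])
  show "((\<lambda>u. c * (u * v - u)) \<longlongrightarrow> c * v - c) U"
    using tendsto_diff[OF tendsto_mult_right[OF U_right[of c], of v] U_right[of c]]
    by (simp add: right_diff_distrib mult.assoc)
  show "\<forall>\<^sub>F u in U. c * (u * v - u) \<in> K"
    by (rule eventually_mono[OF U_in], rule K(2))
       (use peakD[OF v] in \<open>auto simp: J_iff char_diff[OF x] char_mult[OF x]\<close>)
qed

lemma L_closed: "closed L" and L_subspace: "complex_vector.subspace L"
  by (simp_all add: kernel_sum_def closed_sum_def subspace_closed_span closed_closed_span)

lemma L_left: assumes "j \<in> J" shows "j * b \<in> L"
  unfolding kernel_sum_def closed_sum_def
  by (rule subsetD[OF closed_span_superset]) (simp add: closed_prod_mem assms)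

lemma L_right: assumes "j \<in> J" shows "b * j \<in> L"
  unfolding kernel_sum_def closed_sum_def
  by (rule subsetD[OF closed_span_superset]) (simp add: closed_prod_mem assms)

lemma kernel_sum_iff: "b \<in> L \<longleftrightarrow> local_norm b = 0"
proof
  have "L \<subseteq> {b. local_norm b = 0}"
    unfolding kernel_sum_def
    by (intro closed_sum_minimal closed_prod_minimal subspace_local_null closed_local_null)
       (auto simp: local_norm_J)
  then show "b \<in> L \<Longrightarrow> local_norm b = 0" by blast
  assume b: "local_norm b = 0"
  show "b \<in> L"
  proof (rule closed_approachable[OF L_closed, THEN iffD1], intro allI impI)
    fix e :: real assume "0 < e"
    then obtain v where v: "v \<in> peaks" "norm (v * b * v) < e" using local_norm_less[of b e] b by auto
    have "v * b - b \<in> L" by (rule cut_left[OF v(1) L_closed L_left])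
    moreover have "v * b * v - v * b \<in> L" by (rule cut_right[OF v(1) L_closed L_right])
    ultimately have "- ((v * b * v - v * b) + (v * b - b)) \<in> L"
      by (intro complex_vector.subspace_neg complex_vector.subspace_add L_subspace)
    then have "b - v * b * v \<in> L" by simp
    then show "\<exists>y\<in>L. dist y b < e" using v(2) by (intro bexI[of _ "b - v * b * v"]) (auto simp: dist_norm)
  qed
qed

lemma J_A: "j \<in> J \<Longrightarrow> j \<in> A"
  by (simp add: J_iff)

lemma J_mult: "a \<in> A \<Longrightarrow> j \<in> J \<Longrightarrow> a * j \<in> J \<and> j * a \<in> J"
  by (simp add: J_iff char_mult[OF x])

lemma J_sub: assumes j: "j \<in> J" shows "j \<in> J \<odot> UNIV" "j \<in> UNIV \<odot> J"
proof -
  show "j \<in> J \<odot> UNIV"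
    by (rule Lim_in_closed_set[OF closed_closed_prod _ U_ne U_right[of j]]) (simp add: closed_prod_mem j)
  show "j \<in> UNIV \<odot> J"
    by (rule Lim_in_closed_set[OF closed_closed_prod _ U_ne U_left[of j]]) (simp add: closed_prod_mem j)
qed

lemma C_iff: "c \<in> C \<longleftrightarrow> (\<forall>j\<in>J. c * j \<in> J \<odot> UNIV) \<and> (\<forall>j\<in>J. j * c \<in> UNIV \<odot> J)"
  by (simp add: localizing_algebra_def)

lemma A_sub_C: "a \<in> A \<Longrightarrow> a \<in> C"
  by (simp add: C_iff J_sub J_mult)

lemma C_subspace: "complex_vector.subspace C"
  by (rule complex_vector.subspaceI)
     (auto simp: C_iff distrib_left distrib_right mult_scaleC_left mult_scaleC_right
       intro: complex_vector.subspace_0[OF subspace_closed_prod]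
         complex_vector.subspace_add[OF subspace_closed_prod]
         complex_vector.subspace_scale[OF subspace_closed_prod])

lemma JB_right: assumes y: "y \<in> J \<odot> UNIV" shows "y * b \<in> J \<odot> UNIV"
proof -
  have "J \<odot> UNIV \<subseteq> {y. y * b \<in> J \<odot> UNIV}"
    by (rule closed_prod_minimal)
       (auto simp: mult.assoc closed_prod_mem subspace_closed_prod closed_closed_prod
         intro!: subspace_vimage_mult_right closed_vimage_mult_right)
  then show ?thesis using y by blast
qed

lemma BJ_left: assumes y: "y \<in> UNIV \<odot> J" shows "b * y \<in> UNIV \<odot> J"
proof -
  have "UNIV \<odot> J \<subseteq> {y. b * y \<in> UNIV \<odot> J}"
    by (rule closed_prod_minimal)
       (auto simp: closed_prod_mem subspace_closed_prod closed_closed_prod simp flip: mult.assoc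
         intro!: subspace_vimage_mult_left closed_vimage_mult_left)
  then show ?thesis using y by blast
qed

lemma C_mult: assumes c: "c \<in> C" and d: "d \<in> C" shows "c * d \<in> C"
proof -
  have "J \<odot> UNIV \<subseteq> {b. c * b \<in> J \<odot> UNIV}"
    by (intro closed_prod_minimal subspace_vimage_mult_left closed_vimage_mult_left subspace_closed_prod
        closed_closed_prod) (use c JB_right in \<open>auto simp: C_iff simp flip: mult.assoc\<close>)
  moreover have "UNIV \<odot> J \<subseteq> {b. b * d \<in> UNIV \<odot> J}"
    by (intro closed_prod_minimal subspace_vimage_mult_right closed_vimage_mult_right subspace_closed_prod
        closed_closed_prod) (use d BJ_left in \<open>auto simp: C_iff mult.assoc\<close>)
  moreover have "d * j \<in> J \<odot> UNIV" "j * c \<in> UNIV \<odot> J" if "j \<in> J" for j using c d that by (simp_all add: C_iff)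
  ultimately have "c * (d * j) \<in> J \<odot> UNIV" "(j * c) * d \<in> UNIV \<odot> J" if "j \<in> J" for j using that by (blast, blast)
  then show ?thesis by (simp add: C_iff mult.assoc)
qed

lemma H_closed: "closed H" and H_subspace: "complex_vector.subspace H"
  and H_mem: "j \<in> J \<Longrightarrow> c \<in> C \<Longrightarrow> j * c \<in> H"
  by (simp_all add: localizing_ideal_def closed_closed_prod subspace_closed_prod closed_prod_mem)

text \<open>For \<open>y\<close> in \<open>J \<odot> UNIV\<close> the element \<open>y y\<^sup>\<star>\<close> lies in \<open>L\<close>, and the norm of its compression by
  \<open>v\<close> is the square of \<open>norm (v y)\<close>. So \<open>y\<close> is a limit of elements \<open>y - v y\<close>, and these are in \<open>H\<close>
  when \<open>y\<close> is in \<open>C\<close>.\<close>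

lemma JB_inter_C: assumes y: "y \<in> J \<odot> UNIV" "y \<in> C" shows "y \<in> H"
proof -
  have "J \<odot> UNIV \<subseteq> L"
    by (rule closed_prod_minimal) (simp_all add: L_left L_subspace L_closed)
  then have yy: "local_norm (y * y\<^sup>\<star>) = 0" using JB_right[OF y(1)] kernel_sum_iff by blast
  have small: "\<exists>v\<in>peaks. norm (v * y) < e" if e: "e > 0" for e
  proof -
    obtain v where v: "v \<in> peaks" "norm (v * (y * y\<^sup>\<star>) * v) < e\<^sup>2"
      using local_norm_less[of "y * y\<^sup>\<star>" "e\<^sup>2"] yy e by auto
    have "v * (y * y\<^sup>\<star>) * v = (v * y) * (v * y)\<^sup>\<star>" using peakD[OF v(1)] by (simp add: star_mult mult.assoc)
    then have "(norm (v * y))\<^sup>2 < e\<^sup>2" using v(2) cstar_identity'[of "v * y"] by simp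
    then show ?thesis using v(1) e power2_less_imp_less[of "norm (v * y)" e] by auto
  qed
  show ?thesis
  proof (rule closed_approachable[OF H_closed, THEN iffD1], intro allI impI)
    fix e :: real assume "0 < e"
    then obtain v where v: "v \<in> peaks" "norm (v * y) < e" using small by blast
    have "v * y - y \<in> H" by (rule cut_left[OF v(1) H_closed]) (simp add: H_mem y)
    then have "- (v * y - y) \<in> H" by (rule complex_vector.subspace_neg[OF H_subspace])
    then show "\<exists>z\<in>H. dist z y < e" using v(2) by (intro bexI[of _ "y - v * y"]) (auto simp: dist_norm)
  qed
qed

text \<open>Since \<open>c\<close> is in \<open>L\<close>, some compression \<open>v c v\<close> is small. The difference \<open>c - v c v\<close> is a limit
  of sums of products of \<open>c\<close> with elements of \<open>J\<close>; those of the form \<open>c j\<close> are in \<open>H\<close> because \<open>c\<close>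
  carries \<open>J\<close> into \<open>J \<odot> UNIV\<close>.\<close>

lemma localizing_algebra_inter_kernel_sum: assumes c: "c \<in> C" "c \<in> L" shows "c \<in> H"
proof (rule closed_approachable[OF H_closed, THEN iffD1], intro allI impI)
  fix e :: real assume "0 < e"
  then obtain v where v: "v \<in> peaks" "norm (v * c * v) < e"
    using local_norm_less[of c e] c kernel_sum_iff by auto
  have cut: "v * y - y \<in> H" if "y \<in> C" for y by (rule cut_left[OF v(1) H_closed]) (simp add: H_mem that)
  have "v * c * v - v * c \<in> H"
  proof (rule cut_right[OF v(1) H_closed])
    fix j assume j: "j \<in> J"
    have cj: "c * j \<in> C" by (intro C_mult c A_sub_C J_A j)
    then have "c * j \<in> H" using c(1) j by (intro JB_inter_C) (auto simp: C_iff)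
    then have "(v * (c * j) - c * j) + c * j \<in> H" using cut[OF cj]
      by (intro complex_vector.subspace_add[OF H_subspace])
    then show "v * c * j \<in> H" by (simp add: mult.assoc)
  qed
  then have "- ((v * c * v - v * c) + (v * c - c)) \<in> H" using cut[OF c(1)]
    by (intro complex_vector.subspace_neg[OF H_subspace] complex_vector.subspace_add[OF H_subspace])
  then have "c - v * c * v \<in> H" by simp
  then show "\<exists>y\<in>H. dist y c < e" using v(2) by (intro bexI[of _ "c - v * c * v"]) (auto simp: dist_norm)
qed

lemma H_sub_L: "H \<subseteq> L"
  unfolding localizing_ideal_def by (rule closed_prod_minimal) (auto simp: L_left L_closed L_subspace)

lemma coset_eq:
  assumes "complex_vector.subspace S" shows "coset b S = coset c S \<longleftrightarrow> b - c \<in> S"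
proof
  assume "coset b S = coset c S"
  moreover have "b \<in> coset b S" unfolding coset_def using complex_vector.subspace_0[OF assms] by force
  ultimately show "b - c \<in> S" unfolding coset_def by auto
next
  assume bc: "b - c \<in> S"
  have "coset b S \<subseteq> coset c S" if "b - c \<in> S" for b c
  proof
    fix y assume "y \<in> coset b S"
    then obtain s where s: "s \<in> S" "y = b + s" by (auto simp: coset_def)
    have "(b - c) + s \<in> S" by (rule complex_vector.subspace_add[OF assms that s(1)])
    moreover have "y = c + ((b - c) + s)" using s by simp
    ultimately show "y \<in> coset c S" unfolding coset_def by blast
  qed
  moreover have "c - b \<in> S" using complex_vector.subspace_neg[OF assms bc] by simp
  ultimately show "coset b S = coset c S" using bc by blast
qed

lemma localized_to_quotient_coset: "localized_to_quotient A x (coset c H) = coset c L"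
proof -
  have eq: "coset k L = coset c L" if "k \<in> coset c H" for k
    using that H_sub_L by (auto simp: coset_eq[OF L_subspace] coset_def[of c H])
  have "c \<in> coset c H" unfolding coset_def using complex_vector.subspace_0[OF H_subspace] by force
  then have "(\<Union>k\<in>coset c H. coset c L) = coset c L" by blast
  moreover have "localized_to_quotient A x (coset c H) = (\<Union>k\<in>coset c H. coset c L)"
    unfolding localized_to_quotient_def by (intro SUP_cong refl eq)
  ultimately show ?thesis by simp
qed

text \<open>On the cosets of elements of \<open>C\<close> the projection inverts the map from \<open>C / H\<close> to \<open>B / L\<close>;
  injectivity of that map is \<open>C \<inter> L \<subseteq> H\<close>.\<close>

lemma localizing_projection_eq:
  assumes c: "c \<in> C" and bc: "b - c \<in> L" shows "localizing_projection A x b = coset c H"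
proof -
  have inj: "inj_on (localized_to_quotient A x) (localized_algebra A x)"
  proof (rule inj_onI)
    fix K M assume "K \<in> localized_algebra A x" "M \<in> localized_algebra A x"
    then obtain k m where k: "k \<in> C" "K = coset k H" and m: "m \<in> C" "M = coset m H"
      by (auto simp: localized_algebra_def)
    assume "localized_to_quotient A x K = localized_to_quotient A x M"
    then have "k - m \<in> L" using k m by (simp add: localized_to_quotient_coset coset_eq[OF L_subspace])
    moreover have "k - m \<in> C" by (rule complex_vector.subspace_diff[OF C_subspace k(1) m(1)])
    ultimately show "K = M" using k m localizing_algebra_inter_kernel_sum by (simp add: coset_eq[OF H_subspace])
  qed
  have "coset b L = localized_to_quotient A x (coset c H)"
    using bc by (simp add: localized_to_quotient_coset coset_eq[OF L_subspace])
  then show ?thesis unfolding localizing_projection_def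
    using the_inv_into_f_f[OF inj] c by (simp add: localized_algebra_def)
qed

lemma localizing_projection_zero_iff:
  assumes c: "c \<in> C" and bc: "b - c \<in> L"
  shows "localizing_projection A x b = H \<longleftrightarrow> b \<in> L"
proof -
  have "coset 0 H = H" by (simp add: coset_def)
  then have "localizing_projection A x b = H \<longleftrightarrow> c - 0 \<in> H"
    unfolding localizing_projection_eq[OF c bc] by (metis coset_eq[OF H_subspace])
  also have "\<dots> \<longleftrightarrow> c \<in> L" using H_sub_L localizing_algebra_inter_kernel_sum[OF c] unfolding diff_zero by blast
  also have "\<dots> \<longleftrightarrow> b \<in> L"
  proof
    assume "c \<in> L"
    then have "c + (b - c) \<in> L" using bc by (rule complex_vector.subspace_add[OF L_subspace])
    then show "b \<in> L" by simp
  next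
    assume "b \<in> L"
    then have "b - (b - c) \<in> L" using bc by (rule complex_vector.subspace_diff[OF L_subspace])
    then show "c \<in> L" by simp
  qed
  finally show ?thesis .
qed

end

section \<open>States\<close>

definition positive_functional :: "('b::cstar_algebra \<Rightarrow> complex) \<Rightarrow> bool" where
  "positive_functional f \<longleftrightarrow> bounded_linear f \<and> (\<forall>c b. f (c *\<^sub>C b) = c * f b) \<and>
     (\<forall>b. f (b\<^sup>\<star> * b) \<in> \<real>\<^sub>\<ge>\<^sub>0)"

lemma is_state_iff: "is_state f \<longleftrightarrow> positive_functional f \<and> onorm f = 1"
  by (auto simp: is_state_def positive_functional_def)

lemma positive_functionalD:
  assumes "positive_functional f"
  shows pf_bl: "bounded_linear f" and pf_scale: "f (c *\<^sub>C b) = c * f b"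
    and pf_nonneg: "0 \<le> Re (f (b\<^sup>\<star> * b))" and pf_real: "Im (f (b\<^sup>\<star> * b)) = 0"
  using assms unfolding positive_functional_def by (auto simp: complex_nonneg_Reals_iff)

lemma pf_add: "positive_functional f \<Longrightarrow> f (b + c) = f b + f c"
  by (simp add: linear_simps pf_bl)

lemma pf_diff: "positive_functional f \<Longrightarrow> f (b - c) = f b - f c"
  by (simp add: linear_simps pf_bl)

lemma pf_null_closed_subspace:
  assumes f: "positive_functional f"
  shows "closed {b. f b = 0}" "complex_vector.subspace {b. f b = 0}"
proof -
  have "continuous_on UNIV f" using pf_bl[OF f] by (rule linear_continuous_on)
  then show "closed {b. f b = 0}" by (intro closed_Collect_eq) auto
  have "f 0 = 0" using pf_scale[OF f, of 0 0] by simp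
  then show "complex_vector.subspace {b. f b = 0}"
    unfolding complex_vector.subspace_def by (simp add: pf_add[OF f] pf_scale[OF f])
qed

lemma cauchy_schwarz:
  assumes f: "positive_functional f"
  shows "(cmod (f (a\<^sup>\<star> * b)))\<^sup>2 \<le> Re (f (a\<^sup>\<star> * a)) * Re (f (b\<^sup>\<star> * b))"
proof -
  define X Y z w where "X = Re (f (a\<^sup>\<star> * a))" and "Y = Re (f (b\<^sup>\<star> * b))"
    and "z = f (a\<^sup>\<star> * b)" and "w = f (b\<^sup>\<star> * a)"
  have X: "f (a\<^sup>\<star> * a) = of_real X" and Y: "f (b\<^sup>\<star> * b) = of_real Y"
    using pf_real[OF f] by (simp_all add: X_def Y_def complex_eq_iff)
  have Y0: "0 \<le> Y" unfolding Y_def by (rule pf_nonneg[OF f])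
  have expand: "f ((a + l *\<^sub>C b)\<^sup>\<star> * (a + l *\<^sub>C b)) = of_real X + l * z + cnj l * w + (cnj l * l) * of_real Y" for l
    by (simp add: star_add star_scaleC distrib_left distrib_right mult_scaleC_left mult_scaleC_right
        scaleC_scaleC pf_add[OF f] pf_scale[OF f] X Y z_def w_def mult.commute)
  have "w = cnj z"
    using pf_real[OF f, of "a + 1 *\<^sub>C b"] pf_real[OF f, of "a + \<i> *\<^sub>C b"]
    unfolding expand by (simp add: complex_eq_iff)
  have quad: "0 \<le> X + (cmod z)\<^sup>2 * (t\<^sup>2 * Y - 2 * t)" for t :: real
  proof -
    define l where "l = - of_real t * cnj z"
    have "of_real X + l * z + cnj l * w + (cnj l * l) * of_real Y
        = of_real X + of_real (t\<^sup>2 * Y - 2 * t) * (z * cnj z)"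
      by (simp add: l_def \<open>w = cnj z\<close> algebra_simps power2_eq_square)
    also have "\<dots> = of_real (X + (cmod z)\<^sup>2 * (t\<^sup>2 * Y - 2 * t))"
      by (simp only: complex_norm_square[symmetric] of_real_add of_real_mult mult.commute)
    finally show ?thesis using pf_nonneg[OF f, of "a + l *\<^sub>C b"] unfolding expand
      by (simp only: Re_complex_of_real)
  qed
  show ?thesis
  proof (cases "Y = 0")
    case True
    have "(cmod z)\<^sup>2 = 0"
    proof (rule ccontr)
      assume nz: "(cmod z)\<^sup>2 \<noteq> 0"
      then have "(cmod z)\<^sup>2 * (2 * ((X + 1) / (2 * (cmod z)\<^sup>2))) = X + 1" by (simp add: field_simps)
      then show False using quad[of "(X + 1) / (2 * (cmod z)\<^sup>2)"] True by (simp add: algebra_simps)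
    qed
    then show ?thesis using True by (simp add: z_def Y_def)
  next
    case False
    then have "0 < Y" using Y0 by simp
    have "(1 / Y)\<^sup>2 * Y - 2 * (1 / Y) = - (1 / Y)" using \<open>0 < Y\<close> by (simp add: field_simps power2_eq_square)
    then have "(cmod z)\<^sup>2 / Y \<le> X" using quad[of "1 / Y"] by simp
    then show ?thesis using \<open>0 < Y\<close> by (simp add: pos_divide_le_eq X_def Y_def z_def)
  qed
qed

lemma pf_null_left:
  assumes f: "positive_functional f" and b: "f (b\<^sup>\<star> * b) = 0" shows "f (c * b) = 0"
  using cauchy_schwarz[OF f, of "c\<^sup>\<star>" b] b by (simp add: star_star)

lemma pf_null_right:
  assumes f: "positive_functional f" and b: "f (b * b\<^sup>\<star>) = 0" shows "f (b * c) = 0"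
  using cauchy_schwarz[OF f, of "b\<^sup>\<star>" c] b by (simp add: star_star)

context abelian_inclusion_point
begin

lemma peak_L: assumes v: "v \<in> peaks" shows "v * b - b \<in> L" "b * v - b \<in> L"
  using cut_left[OF v L_closed L_left] cut_right[OF v L_closed L_right] by (blast, blast)

lemma char_tendsto: "((\<lambda>u. x u) \<longlongrightarrow> 1) U"
proof -
  obtain e where e: "e \<in> peaks" by (rule peak_exists)
  have "((\<lambda>u. x (u * e) - x e) \<longlongrightarrow> 0) U"
  proof (rule Lim_null_comparison)
    show "((\<lambda>u. norm (u * e - e)) \<longlongrightarrow> 0) U" using U_left[of e] by (simp add: LIM_zero tendsto_norm_zero)
    show "\<forall>\<^sub>F u in U. cmod (x (u * e) - x e) \<le> norm (u * e - e)"
    proof (rule eventually_mono[OF U_in])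
      fix u assume "u \<in> A \<and> u\<^sup>\<star> = u \<and> norm u \<le> 1"
      then show "cmod (x (u * e) - x e) \<le> norm (u * e - e)"
        using char_contractive[OF x, of "u * e - e"] peakD[OF e] by (simp add: char_diff[OF x])
    qed
  qed
  then have "((\<lambda>u. x (u * e)) \<longlongrightarrow> 1) U" using peakD[OF e] LIM_zero_cancel by metis
  moreover have "\<forall>\<^sub>F u in U. x (u * e) = x u"
    using U_in by eventually_elim (use peakD[OF e] in \<open>simp add: char_mult[OF x]\<close>)
  ultimately show ?thesis by (rule Lim_transform_eventually)
qed

text \<open>A functional of norm one equal to \<open>x\<close> on \<open>A\<close> tends to \<open>1\<close> along the approximate
  unit. Applied to elements of the approximate unit, the estimates for multiplication by \<open>h + i t\<close> and
  by \<open>K - b\<^sup>\<star> b\<close> make the functional real on self-adjoint elements and nonnegative at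
  \<open>b\<^sup>\<star> b\<close>.\<close>

lemma contractive_extension_is_state:
  assumes add: "\<And>b c. G (b + c) = G b + G c" and scale: "\<And>l b. G (l *\<^sub>C b) = l * G b"
    and contr: "\<And>b. cmod (G b) \<le> norm b" and ext: "\<And>a. a \<in> A \<Longrightarrow> G a = x a"
  shows "is_state G"
proof -
  have bl: "bounded_linear G"
    by (rule bounded_linear_intro[of G 1])
       (use add scale[of "of_real _"] contr in \<open>simp_all add: scaleC_of_real scaleR_conv_of_real\<close>)
  have Gu: "((\<lambda>u. G u) \<longlongrightarrow> 1) U"
    by (rule Lim_transform_eventually[OF char_tendsto]) (rule eventually_mono[OF U_in], simp add: ext)
  have diff: "G (b - c) = G b - G c" for b c using bl by (simp add: linear_simps)
  have herm: "Im (G h) = 0" if h: "h\<^sup>\<star> = h" for h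
  proof (rule Im_zero_if_quadratic_bound)
    fix t :: real
    have "cmod (G h + \<i> * of_real t * 1) \<le> sqrt ((norm h)\<^sup>2 + t\<^sup>2)"
    proof (rule tendsto_upperbound[OF _ _ U_ne])
      show "((\<lambda>u. cmod (G (h * u) + \<i> * of_real t * G u)) \<longlongrightarrow> cmod (G h + \<i> * of_real t * 1)) U"
        by (intro tendsto_intros Gu bounded_linear.tendsto[OF bl] U_right)
      show "\<forall>\<^sub>F u in U. cmod (G (h * u) + \<i> * of_real t * G u) \<le> sqrt ((norm h)\<^sup>2 + t\<^sup>2)"
      proof (rule eventually_mono[OF U_in])
        fix u assume u: "u \<in> A \<and> u\<^sup>\<star> = u \<and> norm u \<le> 1"
        have "cmod (G (h * u) + \<i> * of_real t * G u) = cmod (G (h * u + (\<i> * of_real t) *\<^sub>C u))"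
          by (simp add: add scale)
        also have "\<dots> \<le> sqrt ((norm h)\<^sup>2 + t\<^sup>2) * norm u"
          by (rule order_trans[OF contr norm_selfadjoint_add_imaginary[OF h]])
        also have "\<dots> \<le> sqrt ((norm h)\<^sup>2 + t\<^sup>2)" using u by (simp add: mult_left_le)
        finally show "cmod (G (h * u) + \<i> * of_real t * G u) \<le> sqrt ((norm h)\<^sup>2 + t\<^sup>2)" .
      qed
    qed
    from power_mono[OF this, of 2] show "(cmod (G h + \<i> * of_real t))\<^sup>2 \<le> (norm h)\<^sup>2 + t\<^sup>2" by simp
  qed
  have "G (b\<^sup>\<star> * b) \<in> \<real>\<^sub>\<ge>\<^sub>0" for b
  proof -
    let ?c = "b\<^sup>\<star> * b"
    have im: "Im (G ?c) = 0" by (rule herm) (simp add: star_mult star_star)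
    obtain K where K: "K \<ge> 0" "\<And>d. norm (K *\<^sub>R d - ?c * d) \<le> K * norm d"
      using positive_star_mult_self[of b] unfolding is_positive_def by metis
    have "cmod (of_real K * 1 - G ?c) \<le> K"
    proof (rule tendsto_upperbound[OF _ _ U_ne])
      show "((\<lambda>u. cmod (of_real K * G u - G (?c * u))) \<longlongrightarrow> cmod (of_real K * 1 - G ?c)) U"
        by (intro tendsto_intros Gu bounded_linear.tendsto[OF bl] U_right)
      show "\<forall>\<^sub>F u in U. cmod (of_real K * G u - G (?c * u)) \<le> K"
      proof (rule eventually_mono[OF U_in])
        fix u assume u: "u \<in> A \<and> u\<^sup>\<star> = u \<and> norm u \<le> 1"
        have "of_real K * G u - G (?c * u) = G (K *\<^sub>R u - ?c * u)"
          using scale[of "of_real K" u] by (simp add: diff scaleC_of_real)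
        then have "cmod (of_real K * G u - G (?c * u)) \<le> K * norm u"
          using contr[of "K *\<^sub>R u - ?c * u"] K(2)[of u] by simp
        also have "\<dots> \<le> K * 1" using u K by (intro mult_left_mono) auto
        finally show "cmod (of_real K * G u - G (?c * u)) \<le> K" by simp
      qed
    qed
    then have "\<bar>K - Re (G ?c)\<bar> \<le> K" using abs_Re_le_cmod[of "of_real K * 1 - G ?c"] by simp
    then show ?thesis using im by (simp add: complex_nonneg_Reals_iff)
  qed
  moreover have "onorm G = 1"
  proof (rule antisym)
    show "onorm G \<le> 1" by (rule onorm_bound) (use contr in auto)
    obtain e where e: "e \<in> peaks" by (rule peak_exists)
    have "1 = cmod (G e)" using ext peakD[OF e] by simp
    also have "\<dots> \<le> onorm G * norm e" by (rule onorm[OF bl])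
    also have "\<dots> \<le> onorm G * 1" using peakD[OF e] by (intro mult_left_mono onorm_pos_le[OF bl]) auto
    finally show "1 \<le> onorm G" by simp
  qed
  ultimately show ?thesis using bl scale unfolding is_state_def by blast
qed

lemma local_norm_peak: assumes e: "e \<in> peaks" shows "local_norm e = 1"
proof (rule antisym)
  show "local_norm e \<le> 1" using local_norm_le_norm[of e] peakD[OF e] by simp
  show "1 \<le> local_norm e" using local_norm_ge_char[of e] peakD[OF e] by simp
qed

text \<open>The derivative of the quotient norm of \<open>B / L\<close> at the class of \<open>e\<close>, which plays the role of the
  unit, bounds the real parts of the states extending \<open>x\<close>, and each of its values is attained.\<close>

lemma exists_state:
  assumes e: "e \<in> peaks"
  obtains G where "is_state G" "\<And>a. a \<in> A \<Longrightarrow> G a = x a" "Re (G c) = tangent local_norm e c"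
proof -
  obtain g where g: "linear g" "\<And>b. g b \<le> tangent local_norm e b" "g c = tangent local_norm e c"
    using hahn_banach[OF sublinear_tangent[OF sublinear_local_norm], of e c] by blast
  have gp: "g b \<le> local_norm b" for b
    using g(2)[of b] tangent_le_self[OF sublinear_local_norm] order_trans by blast
  have ge: "1 \<le> g e"
    using g(2)[of "- e"] tangent_minus[OF sublinear_local_norm, of e] local_norm_peak[OF e]
    by (simp add: linear_neg[OF g(1)])
  define G where "G b = Complex (g b) (- g (\<i> *\<^sub>C b))" for b
  have gscale: "g (l *\<^sub>C b) = Re l * g b + Im l * g (\<i> *\<^sub>C b)" for l b
  proof -
    have "l *\<^sub>C b = Re l *\<^sub>R b + Im l *\<^sub>R (\<i> *\<^sub>C b)"
      by (subst complex_eq[of l]) (simp add: scaleC_add_left scaleC_of_real scaleC_scaleC mult.commute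
          flip: scaleC_scaleR scaleC_of_real)
    then show ?thesis by (simp only: linear_add[OF g(1)] linear_scale[OF g(1)] real_scaleR_def)
  qed
  have scale: "G (l *\<^sub>C b) = l * G b" for l b
    using gscale[of l b] gscale[of "\<i> * l" b] by (simp add: G_def complex_eq_iff scaleC_scaleC algebra_simps)
  have add: "G (b + c) = G b + G c" for b c
    by (simp add: G_def complex_eq_iff scaleC_add_right linear_add[OF g(1)])
  have Gp: "cmod (G b) \<le> local_norm b" for b
  proof (cases "G b = 0")
    case False
    define l where "l = cnj (G b) / of_real (cmod (G b))"
    have "G (l *\<^sub>C b) = of_real (cmod (G b))"
      using False by (simp add: scale l_def complex_norm_square[symmetric] power2_eq_square
          mult.commute[of "cnj (G b)"])
    then have "cmod (G b) = g (l *\<^sub>C b)" by (simp add: G_def complex_eq_iff)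
    also have "\<dots> \<le> local_norm (l *\<^sub>C b)" by (rule gp)
    also have "\<dots> = local_norm b" using False by (simp add: local_norm_scaleC l_def norm_divide)
    finally show ?thesis .
  qed (simp add: local_norm_nonneg)
  have Ge: "G e = 1"
  proof -
    have "cmod (G e) \<le> 1" "1 \<le> Re (G e)" using Gp[of e] local_norm_peak[OF e] ge by (simp_all add: G_def)
    then have "(Re (G e))\<^sup>2 + (Im (G e))\<^sup>2 \<le> 1" "1 \<le> (Re (G e))\<^sup>2"
      by (simp_all add: cmod_power2[symmetric] power_le_one one_le_power)
    then have "(Im (G e))\<^sup>2 \<le> 0" by linarith
    then have "Im (G e) = 0" by simp
    moreover have "Re (G e) \<le> 1" using \<open>cmod (G e) \<le> 1\<close> complex_Re_le_cmod[of "G e"] by linarith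
    ultimately show ?thesis using \<open>1 \<le> Re (G e)\<close> by (simp add: complex_eq_iff)
  qed
  have ext: "G a = x a" if a: "a \<in> A" for a
  proof -
    have "G (a - x a *\<^sub>C e) = 0" using Gp[of "a - x a *\<^sub>C e"] local_norm_J(3)[OF peak_diff_J[OF a e]] by simp
    moreover have "G a = G (a - x a *\<^sub>C e) + G (x a *\<^sub>C e)" by (simp flip: add)
    ultimately show ?thesis by (simp add: scale Ge)
  qed
  have "is_state G"
    by (rule contractive_extension_is_state[OF add scale order_trans[OF Gp local_norm_le_norm] ext])
  moreover have "Re (G c) = tangent local_norm e c" by (simp add: G_def g(3))
  ultimately show ?thesis using that ext by blast
qed

text \<open>By the Cauchy-Schwarz inequality, \<open>f (j b)\<close> is controlled by \<open>f (j j\<^sup>\<star>) = x (j j\<^sup>\<star>) = 0\<close>.\<close>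

lemma extension_null_on_L:
  assumes f: "positive_functional f" "\<And>a. a \<in> A \<Longrightarrow> f a = x a" and b: "b \<in> L"
  shows "f b = 0"
proof -
  have null: "f (j * b) = 0" "f (b * j) = 0" if j: "j \<in> J" for j b
  proof -
    have "j * j\<^sup>\<star> \<in> J" "j\<^sup>\<star> * j \<in> J" using J_mult[OF star[OF J_A[OF j]] j] by auto
    then have jj: "f (j * j\<^sup>\<star>) = 0" "f (j\<^sup>\<star> * j) = 0" using f(2) by (simp_all add: J_iff)
    show "f (j * b) = 0" by (rule pf_null_right[OF f(1) jj(1)])
    show "f (b * j) = 0" by (rule pf_null_left[OF f(1) jj(2)])
  qed
  note K = pf_null_closed_subspace[OF f(1)]
  have "J \<odot> UNIV \<subseteq> {b. f b = 0}" by (rule closed_prod_minimal[OF _ K(2,1)]) (simp add: null(1))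
  moreover have "UNIV \<odot> J \<subseteq> {b. f b = 0}" by (rule closed_prod_minimal[OF _ K(2,1)]) (simp add: null(2))
  ultimately have "L \<subseteq> {b. f b = 0}" unfolding kernel_sum_def by (rule closed_sum_minimal[OF _ _ K(2,1)])
  then show ?thesis using b by blast
qed

text \<open>Modulo \<open>L\<close>, multiplication by \<open>a\<close> is multiplication by the number \<open>x a\<close>.\<close>

lemma extension_module:
  assumes f: "positive_functional f" "\<And>a. a \<in> A \<Longrightarrow> f a = x a" and a: "a \<in> A"
  shows "f (a * b) = x a * f b" "f (b * a) = x a * f b"
proof -
  obtain e where e: "e \<in> peaks" by (rule peak_exists)
  have null: "f b = 0" if "b \<in> L" for b by (rule extension_null_on_L[OF f that])
  have J: "a - x a *\<^sub>C e \<in> J" by (rule peak_diff_J[OF a e])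
  have "a * b = (a - x a *\<^sub>C e) * b + x a *\<^sub>C (e * b - b) + x a *\<^sub>C b"
    by (simp add: algebra_simps mult_scaleC_left complex_vector.scale_right_diff_distrib)
  then show "f (a * b) = x a * f b"
    using null[OF L_left[OF J]] null[OF peak_L(1)[OF e, of b]]
    by (simp only: pf_add[OF f(1)] pf_scale[OF f(1)] mult_zero_right add_0)
  have "b * a = b * (a - x a *\<^sub>C e) + x a *\<^sub>C (b * e - b) + x a *\<^sub>C b"
    by (simp add: algebra_simps mult_scaleC_right complex_vector.scale_right_diff_distrib)
  then show "f (b * a) = x a * f b"
    using null[OF L_right[OF J]] null[OF peak_L(2)[OF e, of b]]
    by (simp only: pf_add[OF f(1)] pf_scale[OF f(1)] mult_zero_right add_0)
qed

section \<open>Free points\<close>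

lemma absorbing_peak:
  assumes a: "a \<in> A" "x a = 1" and d: "0 < d"
  obtains w where "w \<in> peaks" "norm (a * w - w) \<le> d"
proof -
  obtain v where v: "v \<in> peaks" by (rule peak_exists)
  have "a * v - v \<in> J" using a peakD[OF v] by (simp add: J_iff char_diff[OF x] char_mult[OF x])
  then obtain w where w: "w \<in> peaks" "norm ((a * v - v) * w) \<le> d" using peak_kills d by blast
  have "norm (a * (v * w) - v * w) \<le> d" using w by (simp add: algebra_simps)
  then show ?thesis using that[OF peak_mult[OF v w(1)]] by blast
qed

text \<open>Where \<open>w\<close> lives, \<open>v\<close> and \<open>e\<close> are nearly \<open>1\<close>. Hence \<open>norm (v (c + N e) v) \<le> N + d\<close> says
  that the compression of \<open>N + c\<close> by \<open>w\<close> is at most \<open>(N + d) w\<^sup>2\<close> up to a small error, that is,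
  that the compression of \<open>c\<close> is nearly below \<open>d\<close>.\<close>

lemma compressed_upper_bound:
  assumes e: "e \<in> peaks" and v: "v \<in> peaks" and c: "c\<^sup>\<star> = c" and N: "0 \<le> N" and d: "0 < d"
    and le: "norm (v * (c + N *\<^sub>R e) * v) \<le> N + d"
  obtains w0 where "w0 \<in> peaks"
    "\<And>w1 D y. \<lbrakk>w1 \<in> peaks; commutative_subalgebra D; (w0 * w1) * c * (w0 * w1) \<in> D; y \<in> spectrum D\<rbrakk>
       \<Longrightarrow> Re (y ((w0 * w1) * c * (w0 * w1))) \<le> 2 * d"
proof -
  define r where "r = d / (2 * norm c + N + 1)"
  have den: "0 < 2 * norm c + N + 1" using N by (simp add: add_nonneg_pos)
  have r: "0 < r" "r * (2 * norm c + N) \<le> d"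
  proof -
    show "0 < r" using d den by (simp add: r_def)
    then have "r * (2 * norm c + N) \<le> r * (2 * norm c + N + 1)" by (intro mult_left_mono) auto
    also have "\<dots> = d" using den by (simp add: r_def)
    finally show "r * (2 * norm c + N) \<le> d" .
  qed
  define a where "a = v * e * v"
  have vA: "v \<in> A" and eA: "e \<in> A" and aA: "a \<in> A" using peakD[OF v] peakD[OF e] by (auto simp: a_def)
  have xa: "x a = 1" using peakD[OF v] peakD[OF e] by (simp add: a_def char_mult[OF x])
  obtain p where p: "p \<in> peaks" "norm (v * p - p) \<le> r" using absorbing_peak[OF vA peakD(4)[OF v] r(1)] .
  obtain q where q: "q \<in> peaks" "norm (a * q - q) \<le> r" using absorbing_peak[OF aA xa r(1)] .
  have bound: "Re (y ((p * q * w1) * c * (p * q * w1))) \<le> 2 * d"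
    if w1: "w1 \<in> peaks" and D: "commutative_subalgebra D" and TD: "(p * q * w1) * c * (p * q * w1) \<in> D"
      and y: "y \<in> spectrum D" for w1 D y
  proof -
    define w where "w = p * q * w1"
    have w: "w \<in> peaks" unfolding w_def by (intro peak_mult p q w1)
    note contr = peak_contractive
    have vw: "norm (v * w - w) \<le> r"
    proof -
      have "v * w - w = (v * p - p) * (q * w1)" by (simp add: w_def algebra_simps)
      then show ?thesis using contr(1)[OF peak_mult[OF q(1) w1], of "v * p - p"] p by simp
    qed
    have aw: "norm (a * w - w) \<le> r"
    proof -
      have "p * q = q * p" using p q peakD comm by blast
      then have "w = q * (p * w1)" by (simp add: w_def mult.assoc)
      then have "a * w - w = (a * q - q) * (p * w1)" by (simp add: algebra_simps)
      then show ?thesis using contr(1)[OF peak_mult[OF p(1) w1], of "a * q - q"] q by simp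
    qed
    have wv: "norm (w * v - w) \<le> r"
      using vw norm_star[of "v * w - w"] peakD[OF v] peakD[OF w] by (simp add: star_diff star_mult)
    define T where "T = w * c * w"
    define Y where "Y = v * (c + N *\<^sub>R e) * v"
    define M where "M = N + d"
    have M: "0 \<le> M" "norm Y \<le> M" using N d le by (simp_all add: M_def Y_def)
    have Ysa: "Y\<^sup>\<star> = Y" using c peakD[OF v] peakD[OF e]
      by (simp add: Y_def star_mult star_add star_scaleR mult.assoc)
    \<comment> \<open>\<open>z = sqrt (M - Y) * w\<close>, where the square root is \<open>sqrt M - s\<close>\<close>
    obtain E where E: "commutative_subalgebra E" "Y \<in> E" using in_commutative_subalgebra[OF Ysa] .
    interpret E: commutative_subalgebra E by (rule E)
    obtain s where s: "s \<in> E" "s\<^sup>\<star> = s"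
      and ys: "\<And>y. y \<in> spectrum E \<Longrightarrow> y s = of_real (sqrt M - sqrt (max 0 (M - Re (y Y))))"
      by (rule E.functional_calculus[OF E(2) Ysa, of "\<lambda>t. sqrt M - sqrt (max 0 (M - t))"])
         (use M in \<open>auto intro!: continuous_intros\<close>)
    have ss: "s * s = (2 * sqrt M) *\<^sub>R s - Y"
    proof (rule E.eq_char)
      fix y assume y: "y \<in> spectrum E"
      define t where "t = Re (y Y)"
      define f where "f = sqrt M - sqrt (max 0 (M - t))"
      have yY: "y Y = of_real t" using E.char_selfadjoint[OF y E(2) Ysa] by (simp add: t_def)
      have yf: "y s = of_real f" using ys[OF y] by (simp add: f_def t_def)
      have "t \<le> M" using E.char_contractive[OF y E(2)] M complex_Re_le_cmod[of "y Y"] by (simp add: t_def)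
      then have "(sqrt M - f) * (sqrt M - f) = M - t" by (simp add: f_def)
      then have "f * f = 2 * sqrt M * f - t" using M by (simp add: algebra_simps)
      then have "of_real (f * f) = (of_real (2 * sqrt M * f - t) :: complex)" by simp
      then show "y (s * s) = y ((2 * sqrt M) *\<^sub>R s - Y)"
        using s E(2) by (simp add: E.char_mult[OF y] E.char_diff[OF y] E.char_scaleR[OF y] yY yf)
    qed (use s E in auto)
    define z where "z = sqrt M *\<^sub>R w - s * w"
    have zz: "z\<^sup>\<star> * z = M *\<^sub>R (w * w) - w * Y * w"
    proof -
      have "z\<^sup>\<star> * z = (sqrt M * sqrt M) *\<^sub>R (w * w) - w * ((2 * sqrt M) *\<^sub>R s - s * s) * w"
        using s peakD[OF w] unfolding mult_2[of "sqrt M"] scaleR_left_distrib[of "sqrt M" "sqrt M"]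
        by (simp only: z_def star_diff star_mult star_scaleR) (simp add: algebra_simps)
      then show ?thesis using M by (simp add: ss)
    qed
    define R where "R = (w * v - w) * c * v * w + w * c * (v * w - w) + N *\<^sub>R (w * (a * w - w))"
    have wYw: "w * Y * w = N *\<^sub>R (w * w) + T + R"
      by (simp add: Y_def R_def T_def a_def algebra_simps)
    have nR: "norm R \<le> d"
    proof -
      have "norm ((w * v - w) * c * v * w) \<le> norm ((w * v - w) * c)"
        using contr(1)[OF peak_mult[OF v w], of "(w * v - w) * c"] by (simp add: mult.assoc)
      also have "\<dots> \<le> norm (w * v - w) * norm c" by (rule norm_mult_ineq)
      also have "\<dots> \<le> r * norm c" using wv by (intro mult_right_mono) auto
      finally have 1: "norm ((w * v - w) * c * v * w) \<le> r * norm c" .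
      have "norm (w * c * (v * w - w)) \<le> norm (c * (v * w - w))"
        using contr(2)[OF w, of "c * (v * w - w)"] by (simp add: mult.assoc)
      also have "\<dots> \<le> norm c * norm (v * w - w)" by (rule norm_mult_ineq)
      also have "\<dots> \<le> norm c * r" using vw by (intro mult_left_mono) auto
      finally have 2: "norm (w * c * (v * w - w)) \<le> r * norm c" by (simp add: mult.commute)
      have "norm (w * (a * w - w)) \<le> r" using contr(2)[OF w] aw order_trans by blast
      then have 3: "norm (N *\<^sub>R (w * (a * w - w))) \<le> N * r" using N by (simp add: mult_left_mono)
      have "norm R \<le> r * norm c + r * norm c + N * r"
        unfolding R_def by (intro norm_triangle_mono 1 2 3)
      also have "\<dots> = r * (2 * norm c + N)" by (simp add: algebra_simps)
      finally show ?thesis using r(2) by simp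
    qed
    define Q where "Q = d *\<^sub>R (w * w) - R"
    have "Q - T = z\<^sup>\<star> * z" unfolding zz wYw Q_def M_def by (simp add: algebra_simps)
    then have "is_positive (Q - T)" using positive_star_mult_self[of z] by simp
    moreover have "T\<^sup>\<star> = T" using c peakD[OF w] by (simp add: T_def star_mult mult.assoc)
    ultimately have "Re (y T) \<le> norm Q"
      using commutative_subalgebra.char_le_if_positive_diff[OF D _ _ _ y, of T Q] TD
      by (simp add: T_def w_def)
    also have "\<dots> \<le> d * 1 + d"
    proof -
      have "norm (w * w) \<le> 1" using contr(1)[OF w, of w] peakD(3)[OF w] by simp
      then have "norm (d *\<^sub>R (w * w)) \<le> d * 1" using d by (simp add: mult_left_le)
      then show ?thesis unfolding Q_def using nR norm_triangle_ineq4[of "d *\<^sub>R (w * w)" R] by simp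
    qed
    finally show ?thesis by (simp add: T_def w_def)
  qed
  show ?thesis by (rule that[OF peak_mult[OF p(1) q(1)]], rule bound)
qed

context
  fixes f assumes unique: "\<And>g. is_state g \<Longrightarrow> (\<And>a. a \<in> A \<Longrightarrow> g a = x a) \<Longrightarrow> g = f"
begin

text \<open>When \<open>f\<close> is the only state extending \<open>x\<close>, the derivative of the quotient norm at the class of
  \<open>e\<close> in the direction \<open>c\<close> must be \<open>Re (f c)\<close>. Written out, this produces a peak \<open>v\<close>.\<close>

lemma unique_state_is_derivative:
  assumes e: "e \<in> peaks" and d: "0 < d"
  obtains N v where "0 \<le> N" "v \<in> peaks" "norm (v * (c + N *\<^sub>R e) * v) < N + Re (f c) + d"
proof -
  obtain G where G: "is_state G" "\<And>a. a \<in> A \<Longrightarrow> G a = x a" "Re (G c) = tangent local_norm e c"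
    using exists_state[OF e, of c] by blast
  have "G = f" by (rule unique[OF G(1,2)])
  then have "tangent local_norm e c < Re (f c) + d" using G(3) d by simp
  then obtain N where N: "0 \<le> N" "local_norm (c + N *\<^sub>R e) - N * local_norm e < Re (f c) + d"
    using tangent_approx[OF sublinear_local_norm] by blast
  then have "local_norm (c + N *\<^sub>R e) < N + Re (f c) + d" by (simp add: local_norm_peak[OF e])
  then show ?thesis using local_norm_less that N(1) by blast
qed

text \<open>If \<open>f c = 0\<close>, the previous estimate for \<open>c\<close> and for \<open>- c\<close> makes some compression of
  \<open>c\<close> small.\<close>

lemma unique_state_kernel:
  assumes c: "c\<^sup>\<star> = c" and fc: "f c = 0" and fmc: "f (- c) = 0"
  shows "c \<in> L"
proof (rule ccontr)
  assume "c \<notin> L"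
  then have pos: "0 < local_norm c" using kernel_sum_iff local_norm_nonneg[of c] by force
  define d where "d = local_norm c / 4"
  have d: "0 < d" using pos by (simp add: d_def)
  obtain e where e: "e \<in> peaks" by (rule peak_exists)
  obtain N v where N: "0 \<le> N" "v \<in> peaks" "norm (v * (c + N *\<^sub>R e) * v) < N + Re (f c) + d"
    using unique_state_is_derivative[OF e d] .
  obtain N' v' where N': "0 \<le> N'" "v' \<in> peaks" "norm (v' * (- c + N' *\<^sub>R e) * v') < N' + Re (f (- c)) + d"
    using unique_state_is_derivative[OF e d] .
  have c': "(- c)\<^sup>\<star> = - c" using c by (simp add: star_minus)
  obtain w where w: "w \<in> peaks"
    and up: "\<And>w1 D y. \<lbrakk>w1 \<in> peaks; commutative_subalgebra D; (w * w1) * c * (w * w1) \<in> D; y \<in> spectrum D\<rbrakk>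
       \<Longrightarrow> Re (y ((w * w1) * c * (w * w1))) \<le> 2 * d"
    by (rule compressed_upper_bound[OF e N(2) c N(1) d]) (use N(3) fc in auto)
  obtain w' where w': "w' \<in> peaks"
    and low: "\<And>w1 D y. \<lbrakk>w1 \<in> peaks; commutative_subalgebra D; (w' * w1) * (- c) * (w' * w1) \<in> D; y \<in> spectrum D\<rbrakk>
       \<Longrightarrow> Re (y ((w' * w1) * (- c) * (w' * w1))) \<le> 2 * d"
    by (rule compressed_upper_bound[OF e N'(2) c' N'(1) d]) (use N'(3) fmc in auto)
  define k where "k = w * w'"
  define T where "T = k * c * k"
  have k: "k \<in> peaks" unfolding k_def by (rule peak_mult[OF w w'])
  have Tsa: "T\<^sup>\<star> = T" using c peakD[OF k] by (simp add: T_def star_mult mult.assoc)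
  obtain D where D: "commutative_subalgebra D" "T \<in> D" using in_commutative_subalgebra[OF Tsa] .
  interpret D: commutative_subalgebra D by (rule D)
  have "norm T \<le> 2 * d"
  proof (rule D.norm_le_char[OF D(2)])
    fix y assume y: "y \<in> spectrum D"
    have "Re (y T) \<le> 2 * d" using up[OF w' D(1) _ y] D(2) by (simp add: T_def k_def)
    moreover have "w * w' = w' * w" using w w' peakD comm by blast
    then have "(w' * w) * (- c) * (w' * w) = - T" by (simp add: T_def k_def)
    then have "Re (y (- T)) \<le> 2 * d" using low[OF w D(1) _ y] D.minus[OF D(2)] by simp
    ultimately have "\<bar>Re (y T)\<bar> \<le> 2 * d" by (simp add: D.char_minus[OF y D(2)])
    then show "cmod (y T) \<le> 2 * d" using D.char_selfadjoint[OF y D(2) Tsa] by (metis norm_of_real)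
  qed (use d in simp)
  moreover have "local_norm c \<le> norm T" unfolding T_def by (rule local_norm_le[OF k])
  ultimately show False using pos by (simp add: d_def)
qed

end

text \<open>Subtracting \<open>f (b\<^sup>\<star> b) e\<close> from \<open>b\<^sup>\<star> b\<close> gives a self-adjoint element killed by \<open>f\<close>, hence an
  element of \<open>L\<close>. So the class of \<open>b\<^sup>\<star> b\<close> comes from \<open>A\<close>, where the projection is under control,
  and it is \<open>f (b\<^sup>\<star> b)\<close> times the class of \<open>e\<close>.\<close>

lemma localizing_projection_free:
  assumes f: "is_state f" "\<And>a. a \<in> A \<Longrightarrow> f a = x a"
    and unique: "\<And>g. is_state g \<Longrightarrow> (\<And>a. a \<in> A \<Longrightarrow> g a = x a) \<Longrightarrow> g = f"
  shows "localizing_projection A x (b\<^sup>\<star> * b) = H \<longleftrightarrow> f (b\<^sup>\<star> * b) = 0"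
proof -
  have pf: "positive_functional f" using f by (simp add: is_state_iff)
  obtain e where e: "e \<in> peaks" by (rule peak_exists)
  define t where "t = Re (f (b\<^sup>\<star> * b))"
  have t: "f (b\<^sup>\<star> * b) = of_real t" using pf_real[OF pf, of b] by (simp add: t_def complex_eq_iff)
  have fe: "f (t *\<^sub>R e) = of_real t"
    using pf_scale[OF pf, of "of_real t" e] f(2) peakD[OF e] by (simp add: scaleC_of_real)
  define c where "c = b\<^sup>\<star> * b - t *\<^sub>R e"
  have "c \<in> L"
  proof (rule unique_state_kernel[OF unique])
    show "c\<^sup>\<star> = c" using peakD[OF e] by (simp add: c_def star_diff star_mult star_star star_scaleR)
    show fc: "f c = 0" by (simp add: c_def pf_diff[OF pf] t fe)
    show "f (- c) = 0" using pf_scale[OF pf, of "-1" c] fc by simp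
  qed
  then have "localizing_projection A x (b\<^sup>\<star> * b) = H \<longleftrightarrow> b\<^sup>\<star> * b \<in> L"
    unfolding c_def by (intro localizing_projection_zero_iff A_sub_C) (use peakD[OF e] in auto)
  also have "\<dots> \<longleftrightarrow> f (b\<^sup>\<star> * b) = 0"
  proof
    assume "f (b\<^sup>\<star> * b) = 0"
    then show "b\<^sup>\<star> * b \<in> L" using \<open>c \<in> L\<close> t by (simp add: c_def)
  qed (rule extension_null_on_L[OF pf f(2)])
  finally show ?thesis .
qed

text \<open>If \<open>t = f (b\<^sup>\<star> b)\<close> were positive, the derivative in the direction \<open>- b\<^sup>\<star> b\<close> would give a
  compression of \<open>N e - b\<^sup>\<star> b\<close> of norm below \<open>N\<close>. Modulo the ideal this is a compression of
  \<open>N e\<close>, an element of \<open>A\<close> of norm at least \<open>N\<close>, and the quotient map preserves norms on \<open>A\<close>.\<close>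

lemma unique_state_null_on_ideal:
  assumes f: "is_state f" and unique: "\<And>g. is_state g \<Longrightarrow> (\<And>a. a \<in> A \<Longrightarrow> g a = x a) \<Longrightarrow> g = f"
    and I: "closed_ideal I" "I \<inter> A = {0}" and b: "b \<in> I"
  shows "f (b\<^sup>\<star> * b) = 0"
proof -
  have pf: "positive_functional f" using f by (simp add: is_state_iff)
  define t where "t = Re (f (b\<^sup>\<star> * b))"
  have "t \<le> 0"
  proof (rule ccontr)
    assume "\<not> t \<le> 0"
    then have t: "0 < t / 2" by simp
    obtain e where e: "e \<in> peaks" by (rule peak_exists)
    obtain N v where N: "0 \<le> N" and v: "v \<in> peaks"
      and lt: "norm (v * (- (b\<^sup>\<star> * b) + N *\<^sub>R e) * v) < N + Re (f (- (b\<^sup>\<star> * b))) + t / 2"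
      using unique_state_is_derivative[OF unique e t] .
    have "Re (f (- (b\<^sup>\<star> * b))) = - t" using pf_scale[OF pf, of "-1" "b\<^sup>\<star> * b"] by (simp add: t_def)
    then have less: "norm (v * (- (b\<^sup>\<star> * b) + N *\<^sub>R e) * v) < N" using lt t by simp
    let ?a = "N *\<^sub>R (v * e * v)"
    have aA: "?a \<in> A" using peakD[OF v] peakD[OF e] by auto
    have "N = cmod (x ?a)"
      using N peakD[OF v] peakD[OF e] by (simp add: char_scaleR[OF x] char_mult[OF x])
    also have "\<dots> \<le> norm ?a" by (rule char_contractive[OF x aA])
    also have "\<dots> = infdist ?a I"
      using isometric_on_quotient[OF I(1) commutative_subalgebra_axioms I(2) aA] by simp
    also have "\<dots> \<le> norm (?a - v * (b\<^sup>\<star> * b) * v)"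
      by (intro infdist_ideal_le[OF I(1)] ideal_right[OF I(1)] ideal_left[OF I(1)] b)
    also have "?a - v * (b\<^sup>\<star> * b) * v = v * (- (b\<^sup>\<star> * b) + N *\<^sub>R e) * v" by (simp add: algebra_simps)
    finally show False using less by simp
  qed
  then show ?thesis using pf_nonneg[OF pf, of b] pf_real[OF pf, of b] by (simp add: t_def complex_eq_iff)
qed

end

section \<open>The gray ideal\<close>

context abelian_inclusion
begin

lemma point: "x \<in> spectrum A \<Longrightarrow> abelian_inclusion_point A U x"
  by (simp add: abelian_inclusion_point_def abelian_inclusion_point_axioms_def abelian_inclusion_axioms)

lemma free_in_spectrum: "x \<in> free_points A \<Longrightarrow> x \<in> spectrum A"
  by (simp add: free_points_def)

definition free_state :: "('b \<Rightarrow> complex) \<Rightarrow> 'b \<Rightarrow> complex" where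
  "free_state x = (THE f. is_state f \<and> (\<forall>a\<in>A. f a = x a))"

lemma free_state:
  assumes x: "x \<in> free_points A"
  shows "is_state (free_state x)" "a \<in> A \<Longrightarrow> free_state x a = x a"
    "is_state g \<Longrightarrow> (\<And>a. a \<in> A \<Longrightarrow> g a = x a) \<Longrightarrow> g = free_state x"
proof -
  have ex: "\<exists>!f. is_state f \<and> (\<forall>a\<in>A. f a = x a)" using x by (simp add: free_points_def)
  from theI'[OF ex] show "is_state (free_state x)" "a \<in> A \<Longrightarrow> free_state x a = x a"
    by (simp_all add: free_state_def)
  show "is_state g \<Longrightarrow> (\<And>a. a \<in> A \<Longrightarrow> g a = x a) \<Longrightarrow> g = free_state x"
    unfolding free_state_def by (rule the1_equality[OF ex, symmetric]) simp
qed

lemma free_state_pf: "x \<in> free_points A \<Longrightarrow> positive_functional (free_state x)"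
  using free_state(1) by (simp add: is_state_iff)

lemma gray_iff: "b \<in> gray_ideal A \<longleftrightarrow> (\<forall>x\<in>free_points A. free_state x (b\<^sup>\<star> * b) = 0)"
proof -
  have "localizing_projection A x (b\<^sup>\<star> * b) = localizing_ideal A x \<longleftrightarrow> free_state x (b\<^sup>\<star> * b) = 0"
    if x: "x \<in> free_points A" for x
  proof -
    note fs = free_state[OF x]
    interpret abelian_inclusion_point A U x by (rule point[OF free_in_spectrum[OF x]])
    show ?thesis
    proof (rule localizing_projection_free[OF fs(1)])
      show "g = free_state x" if "is_state g" "\<And>a. a \<in> A \<Longrightarrow> g a = x a" for g using that by (rule fs(3))
    qed (rule fs(2))
  qed
  then show ?thesis by (simp add: gray_ideal_def)
qed

text \<open>In this form the gray ideal is visibly a closed left ideal.\<close>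

lemma gray_iff_left_null: "b \<in> gray_ideal A \<longleftrightarrow> (\<forall>x\<in>free_points A. \<forall>c. free_state x (c * b) = 0)"
proof -
  have "free_state x (b\<^sup>\<star> * b) = 0 \<longleftrightarrow> (\<forall>c. free_state x (c * b) = 0)" if "x \<in> free_points A" for x
    using pf_null_left[OF free_state_pf[OF that], of b] by metis
  then show ?thesis by (simp add: gray_iff)
qed

lemma gray_eq_Inter:
  "gray_ideal A = (\<Inter>x\<in>free_points A. \<Inter>c. {b. c * b \<in> {b. free_state x b = 0}})"
  using gray_iff_left_null by auto

lemma gray_closed: "closed (gray_ideal A)"
  unfolding gray_eq_Inter
  by (intro closed_INT ballI closed_vimage_mult_left pf_null_closed_subspace(1) free_state_pf)

lemma gray_subspace: "complex_vector.subspace (gray_ideal A)"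
proof (rule complex_vector.subspaceI)
  show "0 \<in> gray_ideal A"
    using complex_vector.subspace_0[OF pf_null_closed_subspace(2)[OF free_state_pf]]
    by (simp add: gray_iff_left_null)
qed (simp_all add: gray_iff_left_null distrib_left mult_scaleC_right
      pf_add[OF free_state_pf] pf_scale[OF free_state_pf])

lemma gray_left: "b \<in> gray_ideal A \<Longrightarrow> c * b \<in> gray_ideal A"
  by (simp add: gray_iff_left_null flip: mult.assoc)

lemma gray_inter: "gray_ideal A \<inter> A = {a \<in> A. \<forall>x\<in>free_points A. x a = 0}"
proof -
  have "free_state x (a\<^sup>\<star> * a) = 0 \<longleftrightarrow> x a = 0" if "x \<in> free_points A" "a \<in> A" for x a
    using free_state(2)[OF that(1), of "a\<^sup>\<star> * a"] char_star_self[OF free_in_spectrum[OF that(1)] that(2)] that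
    by simp
  then show ?thesis using gray_iff by auto
qed

lemma opaque_inter: "opaque_ideal A \<inter> A = {0}"
proof -
  have iff: "localizing_projection A x (a\<^sup>\<star> * a) = localizing_ideal A x \<longleftrightarrow> a\<^sup>\<star> * a \<in> kernel_sum A x"
    if x: "x \<in> spectrum A" and a: "a \<in> A" for x a
  proof -
    interpret abelian_inclusion_point A U x by (rule point[OF x])
    show ?thesis
      by (rule localizing_projection_zero_iff[of "a\<^sup>\<star> * a"])
         (use a complex_vector.subspace_0[OF L_subspace] in \<open>auto intro: A_sub_C\<close>)
  qed
  have "a = 0" if a: "a \<in> A" "a \<in> opaque_ideal A" for a
  proof (rule eq_char)
    fix x assume x: "x \<in> spectrum A"
    interpret abelian_inclusion_point A U x by (rule point[OF x])
    have "a\<^sup>\<star> * a \<in> kernel_sum A x" using a x iff by (simp add: opaque_ideal_def)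
    then have "x (a\<^sup>\<star> * a) = 0" using local_norm_ge_char[of "a\<^sup>\<star> * a"] kernel_sum_iff a by simp
    then show "x a = x 0" using char_star_self[OF x a(1)] char_zero[OF x] by simp
  qed (use a in auto)
  moreover have "0 \<in> opaque_ideal A"
    using iff[OF _ zero] complex_vector.subspace_0[OF abelian_inclusion_point.L_subspace[OF point]]
    by (simp add: opaque_ideal_def)
  ultimately show ?thesis by auto
qed

lemma vanishing_on_closure:
  "{a \<in> A. \<forall>x\<in>free_points A. x a = 0}
     = {a \<in> A. \<forall>x \<in> spectrum_topology A closure_of free_points A. x a = 0}"
proof -
  have top: "topspace (spectrum_topology A) = spectrum A"
    unfolding spectrum_topology_def by (auto simp: PiE_def spectrum_def)
  have sub: "free_points A \<subseteq> spectrum_topology A closure_of free_points A"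
    by (rule closure_of_subset) (auto simp: top free_in_spectrum)
  have vanish: "x a = 0" if a: "a \<in> A" "\<forall>x\<in>free_points A. x a = 0"
    and x: "x \<in> spectrum_topology A closure_of free_points A" for a x
  proof (rule ccontr)
    assume nz: "x a \<noteq> 0"
    let ?T = "{y \<in> topspace (spectrum_topology A). y a \<in> - {0}}"
    have "continuous_map (spectrum_topology A) euclidean (\<lambda>y. y a)"
      unfolding spectrum_topology_def
      by (intro continuous_map_from_subtopology continuous_map_product_projection a)
    then have T: "openin (spectrum_topology A) ?T"
      by (rule openin_continuous_map_preimage) (simp add: open_Compl)
    note cl = iffD1[OF in_closure_of x]
    have xT: "x \<in> ?T" using conjunct1[OF cl] nz by simp
    have "\<exists>y. y \<in> free_points A \<and> y \<in> ?T"
      by (rule mp[OF spec[OF conjunct2[OF cl], of ?T] conjI[OF xT T]])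
    then obtain y where y: "y \<in> free_points A" "y \<in> ?T" by blast
    have "y a = 0" by (rule bspec[OF a(2) y(1)])
    then show False using y(2) by simp
  qed
  show ?thesis
  proof (intro Collect_cong conj_cong refl iffI ballI)
    fix a x assume "a \<in> A" "\<forall>x\<in>free_points A. x a = 0" "x \<in> spectrum_topology A closure_of free_points A"
    then show "x a = 0" by (rule vanish)
  next
    fix a x assume "\<forall>x\<in>spectrum_topology A closure_of free_points A. x a = 0" "x \<in> free_points A"
    then show "x a = 0" using subsetD[OF sub] by simp
  qed
qed

lemma normalizer_star_self:
  assumes "n \<in> normalizers A" shows "n\<^sup>\<star> * n \<in> A"
proof (rule Lim_in_closed_set[OF closed _ U_ne])
  show "((\<lambda>u. n\<^sup>\<star> * u * n) \<longlongrightarrow> n\<^sup>\<star> * n) U" by (intro tendsto_mult_right U_right)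
  show "\<forall>\<^sub>F u in U. n\<^sup>\<star> * u * n \<in> A"
    by (rule eventually_mono[OF U_in]) (use assms in \<open>simp add: normalizers_def\<close>)
qed

lemma normalizer_star: "n \<in> normalizers A \<Longrightarrow> n\<^sup>\<star> \<in> normalizers A"
  by (simp add: normalizers_def star_star)

lemma normalizer_products:
  assumes n: "n \<in> normalizers A"
  shows "n\<^sup>\<star> * n \<in> A" "n * n\<^sup>\<star> \<in> A" "a \<in> A \<Longrightarrow> n\<^sup>\<star> * a * n \<in> A" "a \<in> A \<Longrightarrow> n * a * n\<^sup>\<star> \<in> A"
  using normalizer_star_self[OF n] normalizer_star_self[OF normalizer_star[OF n]] n
  by (simp_all add: star_star normalizers_def)

text \<open>The functional \<open>g b = f (n\<^sup>\<star> b n)\<close> satisfies \<open>(cmod (g b))\<^sup>2 \<le> r * g (b\<^sup>\<star> b)\<close> with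
  \<open>r = f (n\<^sup>\<star> n)\<close>, by the Cauchy-Schwarz inequality for \<open>u n\<close> and \<open>b n\<close> in the limit along \<open>U\<close>. Taking
  suprema, the norm of \<open>g\<close> has square at most \<open>r\<close> times itself.\<close>

lemma compression_bound:
  fixes f :: "'b \<Rightarrow> complex"
  assumes f: "positive_functional f"
  shows "cmod (f (n\<^sup>\<star> * b * n)) \<le> Re (f (n\<^sup>\<star> * n)) * norm b"
proof -
  define g where "g b = f (n\<^sup>\<star> * b * n)" for b
  define r where "r = Re (f (n\<^sup>\<star> * n))"
  have bl: "bounded_linear g"
    unfolding g_def
    by (rule bounded_linear_compose[OF pf_bl[OF f]])
       (intro bounded_linear_compose[OF bounded_linear_mult_left bounded_linear_mult_right])
  have r0: "0 \<le> r" unfolding r_def by (rule pf_nonneg[OF f])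
  have K0: "0 \<le> onorm g" by (rule onorm_pos_le[OF bl])
  have sq: "(cmod (g b))\<^sup>2 \<le> r * Re (g (b\<^sup>\<star> * b))" for b
  proof (rule tendsto_le[OF U_ne])
    show "((\<lambda>u. (cmod (g (u * b)))\<^sup>2) \<longlongrightarrow> (cmod (g b))\<^sup>2) U"
      by (intro tendsto_intros bounded_linear.tendsto[OF bl] U_left)
    have "((\<lambda>u. Re (f ((n\<^sup>\<star> * u) * (u * n)))) \<longlongrightarrow> r) U"
      unfolding r_def by (intro tendsto_intros bounded_linear.tendsto[OF pf_bl[OF f]] U_left U_right)
    then show "((\<lambda>u. Re (f ((n\<^sup>\<star> * u) * (u * n))) * Re (g (b\<^sup>\<star> * b))) \<longlongrightarrow> r * Re (g (b\<^sup>\<star> * b))) U"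
      by (rule tendsto_mult_right)
    show "\<forall>\<^sub>F u in U. (cmod (g (u * b)))\<^sup>2 \<le> Re (f ((n\<^sup>\<star> * u) * (u * n))) * Re (g (b\<^sup>\<star> * b))"
    proof (rule eventually_mono[OF U_in])
      fix u assume u: "u \<in> A \<and> u\<^sup>\<star> = u \<and> norm u \<le> 1"
      then show "(cmod (g (u * b)))\<^sup>2 \<le> Re (f ((n\<^sup>\<star> * u) * (u * n))) * Re (g (b\<^sup>\<star> * b))"
        using cauchy_schwarz[OF f, of "u * n" "b * n"] by (simp add: g_def star_mult mult.assoc)
    qed
  qed
  have "onorm g \<le> sqrt (r * onorm g)"
  proof (rule onorm_bound)
    fix b
    have "(cmod (g b))\<^sup>2 \<le> r * (onorm g * (norm b)\<^sup>2)"
    proof -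
      have "Re (g (b\<^sup>\<star> * b)) \<le> onorm g * norm (b\<^sup>\<star> * b)"
        using onorm[OF bl, of "b\<^sup>\<star> * b"] complex_Re_le_cmod order_trans by blast
      then show ?thesis using sq[of b] r0 mult_left_mono[of "Re (g (b\<^sup>\<star> * b))" "onorm g * norm (b\<^sup>\<star> * b)" r]
        by (simp add: cstar_identity)
    qed
    also have "\<dots> = (sqrt (r * onorm g) * norm b)\<^sup>2" using r0 K0 by (simp add: power_mult_distrib)
    finally show "cmod (g b) \<le> sqrt (r * onorm g) * norm b"
      by (rule power2_le_imp_le) (use r0 K0 in simp)
  qed (use r0 K0 in simp)
  then have "(onorm g)\<^sup>2 \<le> r * onorm g" using K0 r0 by (metis real_sqrt_le_iff real_sqrt_unique sqrt_le_D)
  then have "onorm g \<le> r"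
    using K0 r0 by (cases "onorm g = 0") (auto simp: power2_eq_square)
  then have "onorm g * norm b \<le> r * norm b" by (intro mult_right_mono) auto
  then show ?thesis using onorm[OF bl, of b] unfolding g_def r_def by linarith
qed

text \<open>Normalizers act on the spectrum: the restriction of \<open>f (n\<^sup>\<star> _ n)\<close> to \<open>A\<close> is a multiple of a
  character, since \<open>n n\<^sup>\<star>\<close> lies in \<open>A\<close> and hence commutes with \<open>A\<close>.\<close>

lemma normalizer_translate:
  assumes x: "x \<in> spectrum A" and f: "positive_functional f" "\<And>a. a \<in> A \<Longrightarrow> f a = x a"
    and n: "n \<in> normalizers A" and r: "f (n\<^sup>\<star> * n) = of_real r" "0 < r"
  defines "y \<equiv> restrict (\<lambda>a. x (n\<^sup>\<star> * a * n) / of_real r) A"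
  shows "y \<in> spectrum A" "is_state (\<lambda>b. f (n\<^sup>\<star> * b * n) / of_real r)"
    "\<And>a. a \<in> A \<Longrightarrow> f (n\<^sup>\<star> * a * n) / of_real r = y a" "y (n * n\<^sup>\<star>) = of_real r"
proof -
  note ns = normalizer_products(1,2)[OF n] and nan = normalizer_products(3)[OF n]
  have xr: "x (n\<^sup>\<star> * n) = of_real r" using f(2)[OF ns(1)] r by simp
  have "y (a * b) = y a * y b" if a: "a \<in> A" and b: "b \<in> A" for a b
  proof -
    have "(n\<^sup>\<star> * a * n) * (n\<^sup>\<star> * b * n) = n\<^sup>\<star> * a * ((n * n\<^sup>\<star>) * b) * n" by (simp add: mult.assoc)
    also have "(n * n\<^sup>\<star>) * b = b * (n * n\<^sup>\<star>)" using ns b comm by blast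
    also have "n\<^sup>\<star> * a * (b * (n * n\<^sup>\<star>)) * n = (n\<^sup>\<star> * (a * b) * n) * (n\<^sup>\<star> * n)" by (simp add: mult.assoc)
    finally have "x (n\<^sup>\<star> * a * n) * x (n\<^sup>\<star> * b * n) = x (n\<^sup>\<star> * (a * b) * n) * of_real r"
      using char_mult[OF x] nan a b ns xr by (metis mult)
    then show ?thesis using a b r(2) by (simp add: y_def field_simps)
  qed
  moreover have "y (a + b) = y a + y b" if "a \<in> A" "b \<in> A" for a b
    using that nan char_add[OF x] by (simp add: y_def distrib_left distrib_right add_divide_distrib)
  moreover have "y (c *\<^sub>C a) = c * y a" if "a \<in> A" for a c
    using that nan char_scale[OF x] by (simp add: y_def mult_scaleC_left mult_scaleC_right)
  moreover have "n\<^sup>\<star> * (n * n\<^sup>\<star>) * n = (n\<^sup>\<star> * n) * (n\<^sup>\<star> * n)" by (simp add: mult.assoc)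
  then show ynn: "y (n * n\<^sup>\<star>) = of_real r"
    using ns r(2) char_mult[OF x ns(1) ns(1)] xr by (simp add: y_def)
  then have "y (n * n\<^sup>\<star>) \<noteq> 0" using r(2) by simp
  ultimately show y: "y \<in> spectrum A" using ns unfolding spectrum_def y_def by auto
  show ext: "f (n\<^sup>\<star> * a * n) / of_real r = y a" if "a \<in> A" for a
    using that f(2)[OF nan] by (simp add: y_def)
  show "is_state (\<lambda>b. f (n\<^sup>\<star> * b * n) / of_real r)"
  proof (rule abelian_inclusion_point.contractive_extension_is_state[OF point[OF y]])
    fix b c l
    show "f (n\<^sup>\<star> * (b + c) * n) / of_real r = f (n\<^sup>\<star> * b * n) / of_real r + f (n\<^sup>\<star> * c * n) / of_real r"
      by (simp add: distrib_left distrib_right pf_add[OF f(1)] add_divide_distrib)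
    show "f (n\<^sup>\<star> * (l *\<^sub>C b) * n) / of_real r = l * (f (n\<^sup>\<star> * b * n) / of_real r)"
      by (simp add: mult_scaleC_left mult_scaleC_right pf_scale[OF f(1)])
    show "cmod (f (n\<^sup>\<star> * b * n) / of_real r) \<le> norm b"
      using compression_bound[OF f(1), of n b] r by (simp add: norm_divide pos_divide_le_eq mult.commute)
  qed (rule ext)
qed

text \<open>The action preserves free points: a state \<open>g\<close> extending the translate \<open>y\<close> of \<open>x\<close> gives back, by
  translating with \<open>n\<^sup>\<star>\<close>, a state extending \<open>x\<close>, from which \<open>g\<close> can be recovered.\<close>

lemma free_state_translate:
  assumes x: "x \<in> free_points A" and n: "n \<in> normalizers A"
    and r: "free_state x (n\<^sup>\<star> * n) = of_real r" "0 < r"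
  obtains y where "y \<in> free_points A" "\<And>b. free_state x (n\<^sup>\<star> * b * n) = of_real r * free_state y b"
proof -
  let ?f = "free_state x"
  note xs = free_in_spectrum[OF x]
  define y where "y = restrict (\<lambda>a. x (n\<^sup>\<star> * a * n) / of_real r) A"
  note tr = normalizer_translate[OF xs free_state_pf[OF x] free_state(2)[OF x] n r, folded y_def]
  note ns = normalizer_products(1,2)[OF n] and nan = normalizer_products(3,4)[OF n]
  have xr: "x (n\<^sup>\<star> * n) = of_real r" using free_state(2)[OF x ns(1)] r by simp
  have y: "y \<in> spectrum A" by (rule tr(1)) simp
  have ynn: "y (n * n\<^sup>\<star>) = of_real r" by (rule tr(4)) simp
  have uniq: "g b = ?f (n\<^sup>\<star> * b * n) / of_real r"
    if g: "is_state g" "\<And>a. a \<in> A \<Longrightarrow> g a = y a" for g b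
  proof -
    have pg: "positive_functional g" using g by (simp add: is_state_iff)
    have gr: "g ((n\<^sup>\<star>)\<^sup>\<star> * n\<^sup>\<star>) = of_real r" using g(2)[OF ns(2)] ynn by (simp add: star_star)
    have "is_state (\<lambda>b. g ((n\<^sup>\<star>)\<^sup>\<star> * b * n\<^sup>\<star>) / of_real r)"
      by (rule normalizer_translate(2)[OF y pg g(2) normalizer_star[OF n] gr r(2)])
    then have st: "is_state (\<lambda>b. g (n * b * n\<^sup>\<star>) / of_real r)" by (simp add: star_star)
    have "g (n * a * n\<^sup>\<star>) / of_real r = x a" if a: "a \<in> A" for a
    proof -
      have "n\<^sup>\<star> * (n * a * n\<^sup>\<star>) * n = (n\<^sup>\<star> * n) * a * (n\<^sup>\<star> * n)" by (simp add: mult.assoc)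
      then have "x (n\<^sup>\<star> * (n * a * n\<^sup>\<star>) * n) = of_real r * x a * of_real r"
        using ns a by (simp add: char_mult[OF xs] xr)
      then show ?thesis using g(2)[OF nan(2)[OF a]] nan(2)[OF a] r(2) by (simp add: y_def)
    qed
    then have "(\<lambda>b. g (n * b * n\<^sup>\<star>) / of_real r) = ?f" by (rule free_state(3)[OF x st])
    then have "?f (n\<^sup>\<star> * b * n) = g (n * (n\<^sup>\<star> * b * n) * n\<^sup>\<star>) / of_real r" by metis
    also have "n * (n\<^sup>\<star> * b * n) * n\<^sup>\<star> = (n * n\<^sup>\<star>) * (b * (n * n\<^sup>\<star>))" by (simp add: mult.assoc)
    also have "g \<dots> = of_real r * (of_real r * g b)"
      using abelian_inclusion_point.extension_module[OF point[OF y] pg g(2) ns(2)] ynn by simp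
    finally show ?thesis using r(2) by simp
  qed
  have "\<exists>!g. is_state g \<and> (\<forall>a\<in>A. g a = y a)"
  proof (rule ex1I)
    show "is_state (\<lambda>b. ?f (n\<^sup>\<star> * b * n) / of_real r) \<and> (\<forall>a\<in>A. ?f (n\<^sup>\<star> * a * n) / of_real r = y a)"
      using tr by blast
    show "g = (\<lambda>b. ?f (n\<^sup>\<star> * b * n) / of_real r)" if "is_state g \<and> (\<forall>a\<in>A. g a = y a)" for g
      using uniq[of g] that by blast
  qed
  then have yf: "y \<in> free_points A" using y by (simp add: free_points_def)
  have "?f (n\<^sup>\<star> * b * n) = of_real r * free_state y b" for b
    using uniq[OF free_state(1)[OF yf] free_state(2)[OF yf], of b] r(2) by simp
  then show ?thesis using that yf by blast
qed

text \<open>Right multiplication by \<open>n\<close> replaces the condition at a free point by the condition at its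
  translate, which is free again, or by nothing if \<open>x (n\<^sup>\<star> n) = 0\<close>.\<close>

lemma gray_right_normalizer:
  assumes b: "b \<in> gray_ideal A" and n: "n \<in> normalizers A" shows "b * n \<in> gray_ideal A"
  unfolding gray_iff
proof
  fix x assume x: "x \<in> free_points A"
  define r where "r = Re (free_state x (n\<^sup>\<star> * n))"
  note pf = free_state_pf[OF x]
  have r: "free_state x (n\<^sup>\<star> * n) = of_real r" "0 \<le> r"
    using pf_real[OF pf] pf_nonneg[OF pf] by (simp_all add: r_def complex_eq_iff)
  have eq: "(b * n)\<^sup>\<star> * (b * n) = n\<^sup>\<star> * (b\<^sup>\<star> * b) * n" by (simp add: star_mult mult.assoc)
  show "free_state x ((b * n)\<^sup>\<star> * (b * n)) = 0"
  proof (cases "r = 0")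
    case True
    then show ?thesis unfolding eq using pf_null_left[OF pf, of n "n\<^sup>\<star> * (b\<^sup>\<star> * b)"] r by simp
  next
    case False
    then have "0 < r" using r by simp
    then obtain y where "y \<in> free_points A" "\<And>b. free_state x (n\<^sup>\<star> * b * n) = of_real r * free_state y b"
      using free_state_translate[OF x n r(1)] by metis
    then show ?thesis unfolding eq using b by (simp add: gray_iff)
  qed
qed

lemma gray_closed_ideal:
  assumes dense: "closed_span (normalizers A) = UNIV" shows "closed_ideal (gray_ideal A)"
proof -
  have "b * c \<in> gray_ideal A" if b: "b \<in> gray_ideal A" for b c
  proof -
    have "closed_span (normalizers A) \<subseteq> {c. b * c \<in> gray_ideal A}"
      by (intro closed_span_minimal subspace_vimage_mult_left closed_vimage_mult_left gray_closed gray_subspace)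
         (auto intro: gray_right_normalizer[OF b])
    then show ?thesis using dense by blast
  qed
  then show ?thesis using gray_closed gray_subspace gray_left by (simp add: closed_ideal_def)
qed

lemma gray_largest:
  assumes I: "closed_ideal I" "I \<inter> A = {0}" shows "I \<subseteq> gray_ideal A"
proof
  fix b assume b: "b \<in> I"
  have "free_state x (b\<^sup>\<star> * b) = 0" if x: "x \<in> free_points A" for x
  proof -
    note fs = free_state[OF x]
    interpret abelian_inclusion_point A U x by (rule point[OF free_in_spectrum[OF x]])
    show ?thesis
    proof (rule unique_state_null_on_ideal[OF fs(1) _ I b])
      show "g = free_state x" if "is_state g" "\<And>a. a \<in> A \<Longrightarrow> g a = x a" for g using that by (rule fs(3))
    qed
  qed
  then show "b \<in> gray_ideal A" by (simp add: gray_iff)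
qed

end

lemma regular_inclusion_obtains:
  fixes A :: "'b::cstar_algebra set"
  assumes "regular_inclusion A" "\<forall>a\<in>A. \<forall>b\<in>A. a * b = b * a"
  obtains U where "abelian_inclusion A U"
proof -
  obtain U :: "'b filter" where U: "U \<noteq> bot"
    "\<forall>\<^sub>F u in U. u \<in> A \<and> (\<exists>c. u = c\<^sup>\<star> * c) \<and> norm u \<le> 1"
    "\<forall>b. ((\<lambda>u. u * b) \<longlongrightarrow> b) U \<and> ((\<lambda>u. b * u) \<longlongrightarrow> b) U"
    using assms(1) unfolding regular_inclusion_def contains_approximate_unit_def by blast
  have "abelian_inclusion A U"
  proof
    show "commutative_star_subalgebra A"
      using assms by (simp add: commutative_star_subalgebra_def regular_inclusion_def)
    show "\<forall>\<^sub>F u in U. u \<in> A \<and> u\<^sup>\<star> = u \<and> norm u \<le> 1"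
      by (rule eventually_mono[OF U(2)]) (auto simp: star_mult star_star)
  qed (use U in auto)
  then show ?thesis by (rule that)
qed

theorem proposition11p11:
  fixes A :: "'b::cstar_algebra set"
  assumes "regular_inclusion A"
    and "\<forall>a\<in>A. \<forall>b\<in>A. a * b = b * a"
  shows "opaque_ideal A \<inter> A = {0}
    \<and> gray_ideal A \<inter> A = {a \<in> A. \<forall>x \<in> free_points A. x a = 0}
    \<and> gray_ideal A \<inter> A = {a \<in> A. \<forall>x \<in> spectrum_topology A closure_of free_points A. x a = 0}
    \<and> (spectrum_topology A closure_of free_points A = spectrum A \<longrightarrow>
         closed_ideal (gray_ideal A) \<and> gray_ideal A \<inter> A = {0} \<and>
         (\<forall>I. closed_ideal I \<and> I \<inter> A = {0} \<longrightarrow> I \<subseteq> gray_ideal A))"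
proof -
  obtain U where "abelian_inclusion A U" using regular_inclusion_obtains[OF assms] .
  then interpret abelian_inclusion A U .
  have dense: "closed_span (normalizers A) = UNIV" using assms(1) by (simp add: regular_inclusion_def)
  have "gray_ideal A \<inter> A = {0}" if "spectrum_topology A closure_of free_points A = spectrum A"
    unfolding gray_inter vanishing_on_closure that
    using eq_char[of _ 0] char_zero by fastforce
  then show ?thesis
    using opaque_inter gray_inter vanishing_on_closure gray_closed_ideal[OF dense] gray_largest by auto
qed

end
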